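(* Let $(\mathsf{A},\Delta)$ be a compact quantum group with dense Hopf $*$-algebra $\mathcal{A}$, let $(j_{st})_{0\le s\le t}$ be a Lévy process on $\mathcal{A}$ with convolution semigroup of states $(\varphi_t)_{t\ge 0}$ on $\mathcal{A}$, and let $\mathsf{A}_r$ be the reduced $C^*$-algebra generated by $\mathcal{A}$. Then $(j_{st})$ gives rise to a unique strongly continuous quantum Markov semigroup $(T_t)_{t\ge 0}$ on $\mathsf{A}_r$; that is, there is a unique quantum Markov semigroup $(T_t)_{t\ge0}$ on $\mathsf{A}_r$ such that $T_t|_{\mathcal{A}}=(\mathrm{id}\otimes\varphi_t)\circ\Delta$ for all $t\ge 0$.
   Context: A compact quantum group is a pair $(\mathsf{A},\Delta)$ with $\mathsf{A}$ a unital $C^*$-algebra and $\Delta:\mathsf{A}\to\mathsf{A}\otimes\mathsf{A}$ (spatial tensor product) a coassociative unital $*$-homomorphism such that the linear spans of $(1\otimes\mathsf{A})\Delta(\mathsf{A})$ and $(\mathsf{A}\otimes 1)\Delta(\mathsf{A})$ are dense in $\mathsf{A}\otimes\mathsf{A}$. $\mathcal{A}\subseteq\mathsf{A}$ denotes the dense Hopf $*$-algebra spanned by the coefficients of finite-dimensional unitary corepresentations, with counit $\varepsilon$. The Haar state $h$ is the unique state with $(h\otimes\mathrm{id})\Delta(a)=h(a)1=(\mathrm{id}\otimes h)\Delta(a)$; it is faithful on $\mathcal{A}$. The reduced $C^*$-algebra $\mathsf{A}_r$ is the norm closure of the image of $\mathcal{A}$ in the GNS representation of $h$; $\mathcal{A}$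 is identified with a dense $*$-subalgebra of $\mathsf{A}_r$. A quantum Markov semigroup on a $C^*$-algebra is a strongly continuous semigroup $(T_t)_{t\ge0}$ of operators such that every $T_t$ is a unital completely positive contraction. A Lévy process on a $*$-bialgebra $\mathcal{A}$ is a family $(j_{st})_{0\le s\le t}$ of unital $*$-homomorphisms from $\mathcal{A}$ into a unital $*$-algebra $\mathcal{B}$ with a state $\Phi$ such that: (i) $[j_{st}(\mathcal{A}),j_{s't'}(\mathcal{A})]=\{0\}$ for $0\le s\le t\le s'\le t'$, and $\Phi(j_{s_1t_1}(a_1)\cdots j_{s_nt_n}(a_n))=\prod_i\Phi(j_{s_it_i}(a_i))$ for $0\le s_1\le t_1\le s_2\le\dots\le t_n$ and $a_i\in\mathcal{A}$; (ii) $m_{\mathcal{B}}\circ(j_{st}\otimes j_{tu})\circ\Delta=j_{su}$ for $s\le t\le u$, where $m_{\mathcal{B}}$ is multiplication; (iii) $\Phi\circ j_{st}$ depends only on $t-s$; (iv) $\lim_{t\searrow s}j_{st}(a)=j_{ss}(a)=\varepsilon(a)1_{\mathcal{B}}$ for all $a\in\mathcal{A}$. Its convolution semigroup of states is $\varphi_t=\Phi\circ j_{0t}$; it satisfies $\varphi_0=\varepsilon$, $\varphi_s\star\varphi_t:=(\varphi_s\otimes\varphi_t)\circ\Delta=\varphi_{s+t}$, $\lim_{t\to0}\varphi_t(a)=\varepsilon(a)$, $\varphi_t(1)=1$, and $\varphi_t(a^*a)\ge0$. *)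

theory Defs
  imports "HOL-Analysis.Analysis"
begin

section \<open>Unital complex *-algebras and C*-algebras\<close>

class complex_star_algebra = real_algebra_1 +
  fixes scaleC :: "complex \<Rightarrow> 'a \<Rightarrow> 'a"  (infixr \<open>*\<^sub>C\<close> 75)
    and star :: "'a \<Rightarrow> 'a"
  assumes scaleC_add_right: "c *\<^sub>C (x + y) = c *\<^sub>C x + c *\<^sub>C y"
    and scaleC_add_left: "(c + d) *\<^sub>C x = c *\<^sub>C x + d *\<^sub>C x"
    and scaleC_scaleC: "c *\<^sub>C d *\<^sub>C x = (c * d) *\<^sub>C x"
    and scaleC_of_real: "complex_of_real r *\<^sub>C x = r *\<^sub>R x"
    and mult_scaleC_left: "(c *\<^sub>C x) * y = c *\<^sub>C (x * y)"
    and mult_scaleC_right: "x * (c *\<^sub>C y) = c *\<^sub>C (x * y)"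
    and star_star: "star (star x) = x"
    and star_add: "star (x + y) = star x + star y"
    and star_scaleC: "star (c *\<^sub>C x) = cnj c *\<^sub>C star x"
    and star_mult: "star (x * y) = star y * star x"

class cstar_algebra = complex_star_algebra + real_normed_algebra_1 + banach +
  assumes norm_scaleC: "norm (c *\<^sub>C x) = cmod c * norm x"
    and norm_star_mult: "norm (star x * x) = (norm x)\<^sup>2"

instantiation complex :: cstar_algebra
begin

definition scaleC_complex :: "complex \<Rightarrow> complex \<Rightarrow> complex"
  where "scaleC_complex c z = c * z"

definition star_complex :: "complex \<Rightarrow> complex"
  where "star_complex z = cnj z"

instance
  by standard
    (auto simp: scaleC_complex_def star_complex_def algebra_simps norm_mult
      scaleR_conv_of_real power2_eq_square)

end

definition clinear :: "('a::complex_star_algebra \<Rightarrow> 'b::complex_star_algebra) \<Rightarrow> bool"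
  where "clinear f \<longleftrightarrow> (\<forall>x y. f (x + y) = f x + f y) \<and> (\<forall>c x. f (c *\<^sub>C x) = c *\<^sub>C f x)"

definition bounded_clinear :: "('a::cstar_algebra \<Rightarrow> 'b::cstar_algebra) \<Rightarrow> bool"
  where "bounded_clinear f \<longleftrightarrow> clinear f \<and> (\<exists>K. \<forall>x. norm (f x) \<le> K * norm x)"

text \<open>The complex span, expressed as the real span of all complex multiples.\<close>

definition cspan :: "'a::complex_star_algebra set \<Rightarrow> 'a set"
  where "cspan S = span {c *\<^sub>C x | c x. x \<in> S}"

definition star_subalgebra :: "'a::complex_star_algebra set \<Rightarrow> bool"
  where "star_subalgebra A \<longleftrightarrow>
    1 \<in> A \<and> (\<forall>x\<in>A. \<forall>y\<in>A. x + y \<in> A \<and> x * y \<in> A) \<and>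
    (\<forall>c. \<forall>x\<in>A. c *\<^sub>C x \<in> A) \<and> (\<forall>x\<in>A. star x \<in> A)"

definition unital_star_hom_on ::
    "'a::complex_star_algebra set \<Rightarrow> ('a \<Rightarrow> 'b::complex_star_algebra) \<Rightarrow> bool"
  where "unital_star_hom_on A f \<longleftrightarrow>
    f 1 = 1 \<and> (\<forall>x\<in>A. \<forall>y\<in>A. f (x + y) = f x + f y \<and> f (x * y) = f x * f y) \<and>
    (\<forall>c. \<forall>x\<in>A. f (c *\<^sub>C x) = c *\<^sub>C f x) \<and> (\<forall>x\<in>A. f (star x) = star (f x))"

definition is_state :: "('a::complex_star_algebra \<Rightarrow> complex) \<Rightarrow> bool"
  where "is_state f \<longleftrightarrow> clinear f \<and> f 1 = 1 \<and> (\<forall>x. f (star x * x) \<in> \<real>\<^sub>\<ge>\<^sub>0)"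

text \<open>On a C*-algebra a state is a positive functional of norm one.\<close>

definition is_cstar_state :: "('a::cstar_algebra \<Rightarrow> complex) \<Rightarrow> bool"
  where "is_cstar_state f \<longleftrightarrow> is_state f \<and> (\<forall>x. cmod (f x) \<le> norm x)"


section \<open>Representations on Hilbert spaces\<close>

text \<open>
  Every Hilbert space is isomorphic to some \<open>\<ell>\<^sup>2(X)\<close>.  Here \<open>\<ell>\<^sup>2(X)\<close> consists of functions on
  the whole index type that vanish off \<open>X\<close>; operators on it are total functions of which only
  the values on \<open>\<ell>\<^sup>2(X)\<close> are relevant.
\<close>

definition ell2 :: "'i set \<Rightarrow> ('i \<Rightarrow> complex) set"
  where "ell2 X = {f. (\<forall>i. i \<notin> X \<longrightarrow> f i = 0) \<and> (\<lambda>i. (cmod (f i))\<^sup>2) summable_on UNIV}"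

definition ell2_inner :: "('i \<Rightarrow> complex) \<Rightarrow> ('i \<Rightarrow> complex) \<Rightarrow> complex"
  where "ell2_inner f g = (\<Sum>\<^sub>\<infinity>i. cnj (f i) * g i)"

definition ell2_norm :: "('i \<Rightarrow> complex) \<Rightarrow> real"
  where "ell2_norm f = sqrt (\<Sum>\<^sub>\<infinity>i. (cmod (f i))\<^sup>2)"

type_synonym 'i operator = "('i \<Rightarrow> complex) \<Rightarrow> ('i \<Rightarrow> complex)"

definition bounded_operator :: "'i set \<Rightarrow> 'i operator \<Rightarrow> bool"
  where "bounded_operator X S \<longleftrightarrow>
    (\<forall>f\<in>ell2 X. S f \<in> ell2 X) \<and>
    (\<forall>f\<in>ell2 X. \<forall>g\<in>ell2 X. S (\<lambda>i. f i + g i) = (\<lambda>i. S f i + S g i)) \<and>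
    (\<forall>c. \<forall>f\<in>ell2 X. S (\<lambda>i. c * f i) = (\<lambda>i. c * S f i)) \<and>
    (\<exists>K. \<forall>f\<in>ell2 X. ell2_norm (S f) \<le> K * ell2_norm f)"

definition operator_norm :: "'i set \<Rightarrow> 'i operator \<Rightarrow> real"
  where "operator_norm X S = Sup {ell2_norm (S f) | f. f \<in> ell2 X \<and> ell2_norm f \<le> 1}"

definition star_rep :: "'i set \<Rightarrow> ('a::complex_star_algebra \<Rightarrow> 'i operator) \<Rightarrow> bool"
  where "star_rep X \<pi> \<longleftrightarrow>
    (\<forall>a. bounded_operator X (\<pi> a)) \<and>
    (\<forall>f\<in>ell2 X.
       \<pi> 1 f = f \<and>
       (\<forall>a b. \<pi> (a + b) f = (\<lambda>i. \<pi> a f i + \<pi> b f i) \<and> \<pi> (a * b) f = \<pi> a (\<pi> b f)) \<and>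
       (\<forall>c a. \<pi> (c *\<^sub>C a) f = (\<lambda>i. c * \<pi> a f i))) \<and>
    (\<forall>a. \<forall>f\<in>ell2 X. \<forall>g\<in>ell2 X. ell2_inner f (\<pi> a g) = ell2_inner (\<pi> (star a) f) g)"

text \<open>For a *-representation of a C*-algebra, being faithful is the same as being isometric.\<close>

definition faithful_rep :: "'i set \<Rightarrow> ('a::cstar_algebra \<Rightarrow> 'i operator) \<Rightarrow> bool"
  where "faithful_rep X \<pi> \<longleftrightarrow> star_rep X \<pi> \<and> (\<forall>a. operator_norm X (\<pi> a) = norm a)"


section \<open>The spatial tensor product\<close>

text \<open>
  \<open>spatial_tensor tens\<close> says that the type \<open>'c\<close>, with elementary tensors \<open>tens a b\<close>, is the
  spatial tensor product of \<open>'a\<close> and \<open>'b\<close>: for faithful representations \<open>\<pi>\<close>, \<open>\<rho>\<close> on Hilbert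
  spaces \<open>\<ell>\<^sup>2(X)\<close>, \<open>\<ell>\<^sup>2(Y)\<close>, it is represented by \<open>\<sigma>\<close> isometrically as the norm closure of the span
  of the operators \<open>\<pi>(a) \<otimes> \<rho>(b)\<close> on \<open>\<ell>\<^sup>2(X) \<otimes> \<ell>\<^sup>2(Y) = \<ell>\<^sup>2(X \<times> Y)\<close>.  The result does not depend
  on the choice of \<open>\<pi>\<close> and \<open>\<rho>\<close>, and index sets inside the algebras themselves are large
  enough: a C*-algebra \<open>A\<close> has a faithful representation on a Hilbert space of dimension at
  most the cardinality of \<open>A\<close>.
\<close>

definition spatial_tensor ::
    "('a::cstar_algebra \<Rightarrow> 'b::cstar_algebra \<Rightarrow> 'c::cstar_algebra) \<Rightarrow> bool"
  where "spatial_tensor tens \<longleftrightarrow>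
    (\<exists>(X :: 'a set) (Y :: 'b set) \<pi> \<rho> \<sigma>.
       faithful_rep X \<pi> \<and> faithful_rep Y \<rho> \<and> faithful_rep (X \<times> Y) \<sigma> \<and>
       (\<forall>a b. \<forall>f\<in>ell2 X. \<forall>g\<in>ell2 Y.
          \<sigma> (tens a b) (\<lambda>(i, j). f i * g j) = (\<lambda>(i, j). \<pi> a f i * \<rho> b g j))) \<and>
    closure (cspan {tens a b | a b. True}) = UNIV"

text \<open>
  The continuous linear extension of a bilinear map \<open>\<beta>\<close> to the completed tensor product (it is
  unique if it exists, elementary tensors being total).
\<close>

definition ctensor_map ::
    "('a \<Rightarrow> 'b \<Rightarrow> 'c::cstar_algebra) \<Rightarrow> ('a \<Rightarrow> 'b \<Rightarrow> 'd::cstar_algebra) \<Rightarrow> 'c \<Rightarrow> 'd"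
  where "ctensor_map tens \<beta> = (THE F. bounded_clinear F \<and> (\<forall>a b. F (tens a b) = \<beta> a b))"

text \<open>
  The algebraic tensor product \<open>A \<odot> A\<close> inside the completed one, and the linear map on it induced
  by a map \<open>\<beta>\<close> that is bilinear on \<open>A\<close>.  For a spatial tensor product the value is independent of
  the decomposition into elementary tensors.
\<close>

definition alg_tensor :: "('a \<Rightarrow> 'a \<Rightarrow> 'c::monoid_add) \<Rightarrow> 'a set \<Rightarrow> 'c set"
  where "alg_tensor tens A = {(\<Sum>(a, b)\<leftarrow>ps. tens a b) | ps. set ps \<subseteq> A \<times> A}"

definition tensor_map ::
    "('a \<Rightarrow> 'a \<Rightarrow> 'c::monoid_add) \<Rightarrow> 'a set \<Rightarrow> ('a \<Rightarrow> 'a \<Rightarrow> 'v::monoid_add) \<Rightarrow> 'c \<Rightarrow> 'v"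
  where "tensor_map tens A \<beta> x =
    (THE v. \<exists>ps. set ps \<subseteq> A \<times> A \<and> x = (\<Sum>(a, b)\<leftarrow>ps. tens a b) \<and> v = (\<Sum>(a, b)\<leftarrow>ps. \<beta> a b))"


section \<open>Compact quantum groups\<close>

text \<open>
  \<open>tens\<close> is the tensor product \<open>A \<otimes> A\<close>, and \<open>tens3\<close> exhibits \<open>(A \<otimes> A) \<otimes> A\<close>.  In the
  coassociativity law, the inner \<open>ctensor_map\<close> is the map \<open>y \<mapsto> a \<otimes> y\<close> from \<open>A \<otimes> A\<close> to
  \<open>A \<otimes> (A \<otimes> A)\<close>, the latter being identified with \<open>(A \<otimes> A) \<otimes> A\<close>.
\<close>

locale compact_quantum_group =
  fixes tens :: "'a::cstar_algebra \<Rightarrow> 'a \<Rightarrow> 'c::cstar_algebra"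
    and tens3 :: "'c \<Rightarrow> 'a \<Rightarrow> 'd::cstar_algebra"
    and \<Delta> :: "'a \<Rightarrow> 'c"
  assumes tens: "spatial_tensor tens"
    and tens3: "spatial_tensor tens3"
    and comult_hom: "unital_star_hom_on UNIV \<Delta>"
    and coassoc: "ctensor_map tens (\<lambda>a b. tens3 (\<Delta> a) b) (\<Delta> x) =
      ctensor_map tens (\<lambda>a b. ctensor_map tens (\<lambda>p q. tens3 (tens a p) q) (\<Delta> b)) (\<Delta> x)"
    and dense_left: "closure (cspan {tens 1 a * \<Delta> b | a b. True}) = UNIV"
    and dense_right: "closure (cspan {tens a 1 * \<Delta> b | a b. True}) = UNIV"

definition haar_state ::
    "('a::cstar_algebra \<Rightarrow> 'a \<Rightarrow> 'c::cstar_algebra) \<Rightarrow> ('a \<Rightarrow> 'c) \<Rightarrow> ('a \<Rightarrow> complex) \<Rightarrow> bool"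
  where "haar_state tens \<Delta> h \<longleftrightarrow> is_cstar_state h \<and>
    (\<forall>a. ctensor_map tens (\<lambda>x y. h x *\<^sub>C y) (\<Delta> a) = h a *\<^sub>C 1 \<and>
         ctensor_map tens (\<lambda>x y. h y *\<^sub>C x) (\<Delta> a) = h a *\<^sub>C 1)"

definition unitary_corep ::
    "('a::cstar_algebra \<Rightarrow> 'a \<Rightarrow> 'c::cstar_algebra) \<Rightarrow> ('a \<Rightarrow> 'c) \<Rightarrow> nat \<Rightarrow> (nat \<Rightarrow> nat \<Rightarrow> 'a) \<Rightarrow> bool"
  where "unitary_corep tens \<Delta> n u \<longleftrightarrow>
    (\<forall>i<n. \<forall>j<n.
       (\<Sum>k<n. star (u k i) * u k j) = (if i = j then 1 else 0) \<and>
       (\<Sum>k<n. u i k * star (u j k)) = (if i = j then 1 else 0) \<and>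
       \<Delta> (u i j) = (\<Sum>k<n. tens (u i k) (u k j)))"

definition coefficient_algebra ::
    "('a::cstar_algebra \<Rightarrow> 'a \<Rightarrow> 'c::cstar_algebra) \<Rightarrow> ('a \<Rightarrow> 'c) \<Rightarrow> 'a set"
  where "coefficient_algebra tens \<Delta> =
    cspan {u i j | n u i j. unitary_corep tens \<Delta> n u \<and> i < n \<and> j < n}"

text \<open>
  A dense Hopf *-algebra \<open>A\<close> with counit \<open>\<epsilon>\<close>.  Coassociativity and multiplicativity of the
  comultiplication are inherited from the ambient compact quantum group.
\<close>

definition dense_hopf_star_algebra ::
    "('a::cstar_algebra \<Rightarrow> 'a \<Rightarrow> 'c::cstar_algebra) \<Rightarrow> ('a \<Rightarrow> 'c) \<Rightarrow> 'a set \<Rightarrow> ('a \<Rightarrow> complex) \<Rightarrow> bool"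
  where "dense_hopf_star_algebra tens \<Delta> A \<epsilon> \<longleftrightarrow>
    star_subalgebra A \<and> closure A = UNIV \<and> \<Delta> ` A \<subseteq> alg_tensor tens A \<and>
    unital_star_hom_on A \<epsilon> \<and>
    (\<forall>a\<in>A. tensor_map tens A (\<lambda>x y. \<epsilon> x *\<^sub>C y) (\<Delta> a) = a \<and>
           tensor_map tens A (\<lambda>x y. \<epsilon> y *\<^sub>C x) (\<Delta> a) = a) \<and>
    (\<exists>\<kappa>. \<kappa> ` A \<subseteq> A \<and>
       (\<forall>x\<in>A. \<forall>y\<in>A. \<kappa> (x + y) = \<kappa> x + \<kappa> y) \<and> (\<forall>c. \<forall>x\<in>A. \<kappa> (c *\<^sub>C x) = c *\<^sub>C \<kappa> x) \<and>
       (\<forall>a\<in>A. tensor_map tens A (\<lambda>x y. \<kappa> x * y) (\<Delta> a) = \<epsilon> a *\<^sub>C 1 \<and>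
              tensor_map tens A (\<lambda>x y. x * \<kappa> y) (\<Delta> a) = \<epsilon> a *\<^sub>C 1))"


section \<open>The reduced C*-algebra\<close>

definition gns_rep ::
    "('a::cstar_algebra \<Rightarrow> complex) \<Rightarrow> 'i set \<Rightarrow> ('a \<Rightarrow> 'i operator) \<Rightarrow> ('i \<Rightarrow> complex) \<Rightarrow> bool"
  where "gns_rep h X \<pi> \<xi> \<longleftrightarrow>
    star_rep X \<pi> \<and> \<xi> \<in> ell2 X \<and> (\<forall>a. ell2_inner \<xi> (\<pi> a \<xi>) = h a) \<and>
    (\<forall>f\<in>ell2 X. \<forall>e>0. \<exists>a. ell2_norm (\<lambda>i. f i - \<pi> a \<xi> i) < e)"

text \<open>
  The type \<open>'r\<close> is identified, through the isometric representation \<open>\<sigma>\<close>, with the norm closure of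
  the image of \<open>A\<close> in the GNS representation of \<open>h\<close>; \<open>\<iota>\<close> is the resulting embedding of \<open>A\<close>
  (only its values on \<open>A\<close> matter).  The GNS space of \<open>h\<close> has dimension at most the cardinality
  of \<open>'a\<close>.
\<close>

definition reduced_cstar_algebra ::
    "'a::cstar_algebra set \<Rightarrow> ('a \<Rightarrow> complex) \<Rightarrow> ('a \<Rightarrow> 'r::cstar_algebra) \<Rightarrow> bool"
  where "reduced_cstar_algebra A h \<iota> \<longleftrightarrow>
    (\<exists>(X :: 'a set) \<pi> \<xi> \<sigma>.
       gns_rep h X \<pi> \<xi> \<and> faithful_rep X \<sigma> \<and> (\<forall>a\<in>A. \<forall>f\<in>ell2 X. \<sigma> (\<iota> a) f = \<pi> a f)) \<and>
    closure (\<iota> ` A) = UNIV"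


section \<open>Quantum Markov semigroups\<close>

text \<open>Positive elements of the C*-algebra of \<open>n \<times> n\<close> matrices are those of the form \<open>Y\<^sup>* Y\<close>.\<close>

definition matrix_positive :: "nat \<Rightarrow> (nat \<Rightarrow> nat \<Rightarrow> 'a::complex_star_algebra) \<Rightarrow> bool"
  where "matrix_positive n M \<longleftrightarrow>
    (\<exists>Y. \<forall>i<n. \<forall>j<n. M i j = (\<Sum>k<n. star (Y k i) * Y k j))"

definition completely_positive ::
    "('a::complex_star_algebra \<Rightarrow> 'b::complex_star_algebra) \<Rightarrow> bool"
  where "completely_positive T \<longleftrightarrow> clinear T \<and>
    (\<forall>n M. matrix_positive n M \<longrightarrow> matrix_positive n (\<lambda>i j. T (M i j)))"

text \<open>Only the values \<open>T t\<close> for \<open>t \<ge> 0\<close> are relevant.\<close>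

definition quantum_markov_semigroup :: "(real \<Rightarrow> 'a::cstar_algebra \<Rightarrow> 'a) \<Rightarrow> bool"
  where "quantum_markov_semigroup T \<longleftrightarrow>
    T 0 = id \<and> (\<forall>s\<ge>0. \<forall>t\<ge>0. T (s + t) = T s \<circ> T t) \<and>
    (\<forall>x. continuous_on {0..} (\<lambda>t. T t x)) \<and>
    (\<forall>t\<ge>0. clinear (T t) \<and> T t 1 = 1 \<and> completely_positive (T t) \<and>
            (\<forall>x. norm (T t x) \<le> norm x))"


section \<open>Levy processes\<close>

text \<open>
  The target \<open>'b\<close> is a *-algebra without topology, so the limit in the last axiom is taken in
  distribution, with respect to the state \<open>\<Phi>\<close>.
\<close>

locale levy_process =
  fixes tens :: "'a::cstar_algebra \<Rightarrow> 'a \<Rightarrow> 'c::cstar_algebra"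
    and \<Delta> :: "'a \<Rightarrow> 'c"
    and A :: "'a set"
    and \<epsilon> :: "'a \<Rightarrow> complex"
    and \<Phi> :: "'b::complex_star_algebra \<Rightarrow> complex"
    and j :: "real \<Rightarrow> real \<Rightarrow> 'a \<Rightarrow> 'b"
  assumes state: "is_state \<Phi>"
    and hom: "0 \<le> s \<Longrightarrow> s \<le> t \<Longrightarrow> unital_star_hom_on A (j s t)"
    and commute: "0 \<le> s \<Longrightarrow> s \<le> t \<Longrightarrow> t \<le> s' \<Longrightarrow> s' \<le> t' \<Longrightarrow> a \<in> A \<Longrightarrow> a' \<in> A \<Longrightarrow>
      j s t a * j s' t' a' = j s' t' a' * j s t a"
    and factorize: "(\<And>i. i < n \<Longrightarrow> 0 \<le> \<tau> i \<and> \<tau> i \<le> \<tau>' i \<and> \<alpha> i \<in> A) \<Longrightarrow>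
      (\<And>i. Suc i < n \<Longrightarrow> \<tau>' i \<le> \<tau> (Suc i)) \<Longrightarrow>
      \<Phi> (prod_list (map (\<lambda>i. j (\<tau> i) (\<tau>' i) (\<alpha> i)) [0..<n])) = (\<Prod>i<n. \<Phi> (j (\<tau> i) (\<tau>' i) (\<alpha> i)))"
    and increments: "0 \<le> s \<Longrightarrow> s \<le> t \<Longrightarrow> t \<le> u \<Longrightarrow> a \<in> A \<Longrightarrow>
      tensor_map tens A (\<lambda>x y. j s t x * j t u y) (\<Delta> a) = j s u a"
    and stationary: "0 \<le> s \<Longrightarrow> s \<le> t \<Longrightarrow> 0 \<le> s' \<Longrightarrow> s' \<le> t' \<Longrightarrow> t - s = t' - s' \<Longrightarrow> a \<in> A \<Longrightarrow>
      \<Phi> (j s t a) = \<Phi> (j s' t' a)"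
    and initial: "0 \<le> s \<Longrightarrow> a \<in> A \<Longrightarrow> j s s a = \<epsilon> a *\<^sub>C 1"
    and continuity: "0 \<le> s \<Longrightarrow> a \<in> A \<Longrightarrow> ((\<lambda>t. \<Phi> (j s t a)) \<longlongrightarrow> \<epsilon> a) (at_right s)"

end

theory Submission
  imports Defs
begin

text \<open>
  Write \<open>T\<close> for \<open>(id \<otimes> \<phi>\<^sub>t) \<circ> \<Delta>\<close>.  By Fell's absorption principle, \<open>W : x \<otimes> y \<mapsto> \<Delta>(x) (1 \<otimes> y)\<close> is a
  unitary on the tensor product of the GNS spaces of the Haar state and of \<open>\<phi>\<^sub>t\<close> that intertwines
  \<open>a \<otimes> 1\<close> with \<open>\<Delta>(a)\<close>.  If \<open>W\<close> maps \<open>\<Sum> x\<^sub>r \<otimes> y\<^sub>r\<close> to \<open>b \<otimes> 1\<close> and \<open>\<Sum> x'\<^sub>s \<otimes> y'\<^sub>s\<close> to \<open>c \<otimes> 1\<close>, this means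
  \<open>h(b\<^sup>* T(a) c) = \<Sum> h(x\<^sub>r\<^sup>* a x'\<^sub>s) \<phi>\<^sub>t(y\<^sub>r\<^sup>* y'\<^sub>s)\<close>, an identity that follows from the invariance of \<open>h\<close> alone.
  Since the kernel \<open>\<phi>\<^sub>t(y\<^sub>r\<^sup>* y\<^sub>s)\<close> is positive semidefinite, \<open>T\<close> preserves positivity of operator matrices
  on the GNS space of \<open>h\<close>.  Applied to the positive matrix with diagonal entries \<open>\<parallel>a\<parallel>\<close> and off-diagonal
  entries \<open>a\<close>, \<open>a\<^sup>*\<close>, this makes \<open>T\<close> contractive for the reduced norm, so that it extends.  Positive operator
  matrices over a concrete C*-algebra have the form \<open>Y\<^sup>* Y\<close> by the binomial series for the square root.
\<close>

section \<open>Complex *-algebras\<close>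

text \<open>The obstacle is that \<open>\<phi> t\<close> lives on \<open>A\<close> and need not be
  bounded for the reduced norm: at \<open>t = 0\<close> it is the counit, which extends to the
  reduced algebra only in the coamenable case. Hence \<open>id \<otimes> \<phi>\<^sub>t\<close>
  cannot be handled as a slice map on a completed tensor product, and contractivity has to come from
  elsewhere. What \<open>\<phi> t\<close> does supply is positive semidefinite Gram matrices of
  finite families in \<open>A\<close>. The GNS space of \<open>\<phi> t\<close> and the unitary
  \<open>W\<close> are therefore never built: finite lists of pairs stand for vectors, and the Schur
  product of a Gram matrix with a given form replaces the tensor product of Hilbert spaces. Of the
  two functionals it is the bounded one, \<open>h\<close>, that is extended to the completed tensor
  product; \<open>\<phi> t\<close> is applied afterwards, to elements of \<open>A\<close>. The
  semigroup law and continuity at zero are settled on \<open>A\<close>, where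
  \<open>\<Delta> a\<close> is a finite sum, and reach the reduced algebra by contractivity and
  density.\<close>

lemma scaleC_one [simp]: "1 *\<^sub>C x = (x::'a::complex_star_algebra)"
  using scaleC_of_real[of 1 x] by simp

lemma scaleC_zero_left [simp]: "0 *\<^sub>C x = (0::'a::complex_star_algebra)"
  using scaleC_of_real[of 0 x] by simp

lemma scaleC_zero_right [simp]: "c *\<^sub>C 0 = (0::'a::complex_star_algebra)"
  using scaleC_add_right[of c 0 "0::'a"] by simp

lemma scaleC_minus_one [simp]: "(- 1) *\<^sub>C x = - (x::'a::complex_star_algebra)"
  using scaleC_of_real[of "- 1" x] by simp

lemma scaleC_minus_right: "c *\<^sub>C (- x) = - (c *\<^sub>C (x::'a::complex_star_algebra))"
  using scaleC_add_right[of c x "- x"] by (simp add: eq_neg_iff_add_eq_0 add.commute)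

lemma scaleC_sum_right: "c *\<^sub>C (\<Sum>i\<in>I. f i) = (\<Sum>i\<in>I. c *\<^sub>C (f i::'a::complex_star_algebra))"
  by (induction I rule: infinite_finite_induct) (auto simp: scaleC_add_right)

lemma scaleC_sum_left: "(\<Sum>i\<in>I. c i) *\<^sub>C x = (\<Sum>i\<in>I. c i *\<^sub>C (x::'a::complex_star_algebra))"
  by (induction I rule: infinite_finite_induct) (auto simp: scaleC_add_left)

lemma star_zero [simp]: "star (0::'a::complex_star_algebra) = 0"
  using star_add[of 0 "0::'a"] by simp

lemma star_one [simp]: "star (1::'a::complex_star_algebra) = 1"
  by (metis star_mult star_star mult.left_neutral mult.right_neutral)

lemma star_sum: "star (\<Sum>i\<in>I. f i) = (\<Sum>i\<in>I. star (f i::'a::complex_star_algebra))"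
  by (induction I rule: infinite_finite_induct) (auto simp: star_add)

lemma norm_star [simp]: "norm (star x) = norm (x::'a::cstar_algebra)"
proof -
  have le: "norm y \<le> norm (star y)" for y :: 'a
  proof (cases "norm y = 0")
    case False
    have "(norm y)\<^sup>2 \<le> norm (star y) * norm y"
      using norm_mult_ineq[of "star y" y] by (simp add: norm_star_mult)
    with False show ?thesis by (simp add: power2_eq_square)
  qed simp
  show ?thesis using le[of x] le[of "star x"] by (simp add: star_star)
qed

lemma bounded_linear_star: "bounded_linear (star :: 'a::cstar_algebra \<Rightarrow> 'a)"
proof (rule bounded_linear_intro)
  show "star (r *\<^sub>R x) = r *\<^sub>R star x" for r and x :: 'a
    using star_scaleC[of "complex_of_real r" x] by (simp add: scaleC_of_real)
  show "norm (star x) \<le> norm x * 1" for x :: 'a by simp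
qed (simp add: star_add)

lemma bounded_linear_scaleC: "bounded_linear (\<lambda>x::'a::cstar_algebra. c *\<^sub>C x)"
proof (rule bounded_linear_intro)
  show "c *\<^sub>C (r *\<^sub>R x) = r *\<^sub>R (c *\<^sub>C x)" for r and x :: 'a
    by (simp add: scaleC_of_real[symmetric] scaleC_scaleC mult.commute)
  show "norm (c *\<^sub>C x) \<le> norm x * cmod c" for x :: 'a
    by (simp add: norm_scaleC mult.commute)
qed (auto simp: scaleC_add_right)

lemma clinear_add: "clinear f \<Longrightarrow> f (x + y) = f x + f y"
  and clinear_scaleC: "clinear f \<Longrightarrow> f (c *\<^sub>C x) = c *\<^sub>C f x"
  by (auto simp: clinear_def)

lemma clinear_scaleR:
  assumes "clinear f"
  shows "f (r *\<^sub>R x) = r *\<^sub>R f x"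
  using clinear_scaleC[OF assms, of "complex_of_real r" x] by (simp add: scaleC_of_real)

lemma clinear_zero: "clinear f \<Longrightarrow> f 0 = 0"
  using clinear_scaleR[of f 0 0] by simp

lemma clinear_diff: "clinear f \<Longrightarrow> f (x - y) = f x - f y"
  using clinear_add[of f x "(- 1) *\<^sub>R y"] clinear_scaleR[of f "- 1" y] by simp

lemma clinear_sum: "clinear f \<Longrightarrow> f (\<Sum>i\<in>I. g i) = (\<Sum>i\<in>I. f (g i))"
  by (induction I rule: infinite_finite_induct) (auto simp: clinear_zero clinear_add)

lemma clinear_sum_list: "clinear f \<Longrightarrow> f (\<Sum>p\<leftarrow>ps. g p) = (\<Sum>p\<leftarrow>ps. f (g p))"
  by (induction ps) (auto simp: clinear_zero clinear_add)

lemma clinear_bounded_linear: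
  fixes f :: "'a::cstar_algebra \<Rightarrow> 'b::cstar_algebra"
  assumes "clinear f" "\<And>x. norm (f x) \<le> K * norm x"
  shows "bounded_linear f"
  by (rule bounded_linear_intro[where K = K])
    (use assms in \<open>auto simp: clinear_add clinear_scaleR mult.commute\<close>)

lemma bounded_clinear_bounded_linear: "bounded_clinear f \<Longrightarrow> bounded_linear f"
  unfolding bounded_clinear_def using clinear_bounded_linear by blast

lemma cspan_superset: "x \<in> S \<Longrightarrow> x \<in> cspan S"
  unfolding cspan_def by (rule span_base) (metis (mono_tags, lifting) mem_Collect_eq scaleC_one)

lemma cspan_induct [consumes 1, case_names zero add]:
  assumes "x \<in> cspan S" "P 0" "\<And>c x y. x \<in> S \<Longrightarrow> y \<in> cspan S \<Longrightarrow> P y \<Longrightarrow> P (c *\<^sub>C x + y)"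
  shows "P x"
proof -
  have "x \<in> span {c *\<^sub>C x | c x. x \<in> S}" using assms(1) by (simp add: cspan_def)
  \<comment> \<open>Membership in the span is carried along because the step hypothesis on
    \<open>P\<close> presupposes it for the tail. The real scalar of the span is absorbed into the
    complex coefficient.\<close>
  then have "x \<in> cspan S \<and> P x"
  proof (induction rule: span_induct_alt)
    case base
    then show ?case using assms(2) by (simp add: cspan_def span_zero)
  next
    case (step r z y)
    then obtain c x where z: "z = c *\<^sub>C x" "x \<in> S" by auto
    then have "r *\<^sub>R z = (complex_of_real r * c) *\<^sub>C x"
      by (simp add: scaleC_of_real[symmetric] scaleC_scaleC)
    moreover have "r *\<^sub>R z + y \<in> cspan S"
      using step unfolding cspan_def by (intro span_add span_scale) (auto intro: span_base)
    ultimately show ?case using assms(3) step z by auto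
  qed
  then show ?thesis by simp
qed

section \<open>Linear maps determined on, or extended from, a dense subspace\<close>

lemma clinear_eqI_dense:
  fixes f g :: "'a::cstar_algebra \<Rightarrow> 'b::cstar_algebra"
  assumes "bounded_linear f" "bounded_linear g" "closure S = UNIV" "\<And>x. x \<in> S \<Longrightarrow> f x = g x"
  shows "f = g"
proof
  fix x
  have "x \<in> closure S" using assms(3) by simp
  then obtain s where s: "\<And>n. s n \<in> S" "s \<longlonglongrightarrow> x" unfolding closure_sequential by blast
  have "(\<lambda>n. f (s n)) \<longlonglongrightarrow> f x" "(\<lambda>n. g (s n)) \<longlonglongrightarrow> g x"
    using bounded_linear.tendsto[OF assms(1) s(2)] bounded_linear.tendsto[OF assms(2) s(2)] by auto
  then show "f x = g x" using assms(4) s(1) LIMSEQ_unique by fastforce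
qed

text \<open>Boundedness gives uniform continuity and hence a continuous extension; since
  \<open>f\<close> is a total function without any property off \<open>S\<close>, linearity of the
  extension is recovered from sequences in \<open>S\<close>. It serves twice, for slices of the
  tensor product and for the semigroup on the reduced algebra.\<close>

lemma clinear_extension:
  fixes f :: "'a::cstar_algebra \<Rightarrow> 'b::cstar_algebra"
  assumes dense: "closure S = UNIV"
    and S_add: "\<And>x y. x \<in> S \<Longrightarrow> y \<in> S \<Longrightarrow> x + y \<in> S"
    and S_scaleC: "\<And>c x. x \<in> S \<Longrightarrow> c *\<^sub>C x \<in> S"
    and f_add: "\<And>x y. x \<in> S \<Longrightarrow> y \<in> S \<Longrightarrow> f (x + y) = f x + f y"
    and f_scaleC: "\<And>c x. x \<in> S \<Longrightarrow> f (c *\<^sub>C x) = c *\<^sub>C f x"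
    and f_bound: "\<And>x. x \<in> S \<Longrightarrow> norm (f x) \<le> K * norm x"
  obtains F where "clinear F" "\<And>x. norm (F x) \<le> K * norm x" "\<And>x. x \<in> S \<Longrightarrow> F x = f x"
proof -
  have f_diff: "f (x - y) = f x - f y \<and> x - y \<in> S" if "x \<in> S" "y \<in> S" for x y
    using S_add[OF that(1) S_scaleC[OF that(2), of "-1"]]
      f_add[OF that(1) S_scaleC[OF that(2), of "-1"]] f_scaleC[OF that(2), of "-1"] by simp
  have "uniformly_continuous_on S f"
  unfolding uniformly_continuous_on_def
  proof (intro allI impI)
    fix e :: real assume "e > 0"
    show "\<exists>d>0. \<forall>x\<in>S. \<forall>x'\<in>S. dist x' x < d \<longrightarrow> dist (f x') (f x) < e"
    proof (intro exI conjI ballI impI)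
      \<comment> \<open>Adding 1 to the absolute value keeps the denominator positive for every real
        \<open>K\<close>, including 0 and negative values.\<close>
      show "e / (\<bar>K\<bar> + 1) > 0" using \<open>e > 0\<close> by simp
      fix x x' assume *: "x \<in> S" "x' \<in> S" "dist x' x < e / (\<bar>K\<bar> + 1)"
      have "dist (f x') (f x) \<le> K * norm (x' - x)"
        using f_bound[of "x' - x"] f_diff[OF *(2,1)] by (simp add: dist_norm)
      also have "\<dots> \<le> (\<bar>K\<bar> + 1) * norm (x' - x)" by (intro mult_right_mono) auto
      also have "\<dots> < e" using *(3) by (simp add: dist_norm field_simps)
      finally show "dist (f x') (f x) < e" .
    qed
  qed
  then obtain F where F: "uniformly_continuous_on (closure S) F" "\<And>x. x \<in> S \<Longrightarrow> f x = F x"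
    by (rule uniformly_continuous_on_extension_on_closure) auto
  then have cont: "isCont F x" for x
    using dense uniformly_continuous_imp_continuous continuous_on_eq_continuous_at by force
  have seq: "\<exists>s. (\<forall>n. s n \<in> S) \<and> s \<longlonglongrightarrow> x" for x
    using dense closure_sequential[of x S] by auto
  have lim: "(\<lambda>n. F (s n)) \<longlonglongrightarrow> F x" if "s \<longlonglongrightarrow> x" for s x
    using isCont_tendsto_compose[OF cont that] .
  have add: "F (x + y) = F x + F y" for x y
  proof -
    obtain s t where s: "\<And>n. s n \<in> S" "s \<longlonglongrightarrow> x" and t: "\<And>n. t n \<in> S" "t \<longlonglongrightarrow> y"
      using seq[of x] seq[of y] by blast
    have "F (s n + t n) = F (s n) + F (t n)" for n
      using F(2) f_add S_add s(1) t(1) by metis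
    then have "(\<lambda>n. F (s n + t n)) \<longlonglongrightarrow> F x + F y"
      using tendsto_add[OF lim[OF s(2)] lim[OF t(2)]] by simp
    then show ?thesis
      using LIMSEQ_unique lim[OF tendsto_add[OF s(2) t(2)]] by blast
  qed
  have scale: "F (c *\<^sub>C x) = c *\<^sub>C F x" for c x
  proof -
    obtain s where s: "\<And>n. s n \<in> S" "s \<longlonglongrightarrow> x" using seq[of x] by blast
    have "F (c *\<^sub>C s n) = c *\<^sub>C F (s n)" for n
      using F(2) f_scaleC S_scaleC s(1) by metis
    then have "(\<lambda>n. F (c *\<^sub>C s n)) \<longlonglongrightarrow> c *\<^sub>C F x"
      using bounded_linear.tendsto[OF bounded_linear_scaleC lim[OF s(2)]] by simp
    then show ?thesis
      using LIMSEQ_unique lim[OF bounded_linear.tendsto[OF bounded_linear_scaleC s(2)]] by blast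
  qed
  have bound: "norm (F x) \<le> K * norm x" for x
  proof -
    obtain s where s: "\<And>n. s n \<in> S" "s \<longlonglongrightarrow> x" using seq[of x] by blast
    have "norm (F (s n)) \<le> K * norm (s n)" for n using f_bound F(2) s(1) by metis
    then show ?thesis
      by (intro LIMSEQ_le[OF tendsto_norm[OF lim[OF s(2)]] tendsto_mult_left[OF tendsto_norm[OF s(2)]]]) auto
  qed
  show ?thesis
    by (rule that[of F]) (auto simp: clinear_def add scale bound F(2)[symmetric])
qed

section \<open>Square-summable functions\<close>

lemma ell2_inner_summable:
  assumes "f \<in> ell2 X" "g \<in> ell2 X"
  shows "(\<lambda>i. norm (cnj (f i) * g i)) summable_on UNIV"
proof -
  have "(\<lambda>i. (cmod (f i))\<^sup>2 + (cmod (g i))\<^sup>2) summable_on UNIV"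
    using assms by (intro summable_on_add) (auto simp: ell2_def)
  then show ?thesis
  proof (rule summable_on_comparison_test)
    fix i
    show "norm (cnj (f i) * g i) \<le> (cmod (f i))\<^sup>2 + (cmod (g i))\<^sup>2"
    proof -
      have "0 \<le> cmod (f i) * cmod (g i)" by simp
      with sum_squares_bound[of "cmod (f i)" "cmod (g i)"] show ?thesis
        unfolding norm_mult complex_mod_cnj by linarith
    qed
  qed auto
qed

lemma ell2_inner_summable': "f \<in> ell2 X \<Longrightarrow> g \<in> ell2 X \<Longrightarrow> (\<lambda>i. cnj (f i) * g i) summable_on UNIV"
  by (rule Infinite_Sum.abs_summable_summable) (rule ell2_inner_summable)

lemma ell2_add: 
  assumes "f \<in> ell2 X" "g \<in> ell2 X"
  shows "(\<lambda>i. f i + g i) \<in> ell2 X"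
proof -
  have s: "(\<lambda>i. 2 * (cmod (f i))\<^sup>2 + 2 * (cmod (g i))\<^sup>2) summable_on UNIV"
    using assms by (intro summable_on_add summable_on_cmult_right) (auto simp: ell2_def)
  have "(\<lambda>i. (cmod (f i + g i))\<^sup>2) summable_on UNIV"
  proof (rule summable_on_comparison_test[OF s])
    fix i
    have "(cmod (f i + g i))\<^sup>2 \<le> (cmod (f i) + cmod (g i))\<^sup>2"
      by (intro power_mono norm_triangle_ineq) auto
    also have "\<dots> \<le> 2 * (cmod (f i))\<^sup>2 + 2 * (cmod (g i))\<^sup>2"
      using sum_squares_bound[of "cmod (f i)" "cmod (g i)"] by (simp add: power2_sum)
    finally show "(cmod (f i + g i))\<^sup>2 \<le> 2 * (cmod (f i))\<^sup>2 + 2 * (cmod (g i))\<^sup>2" .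
  qed auto
  then show ?thesis using assms by (auto simp: ell2_def)
qed

lemma ell2_scale: "f \<in> ell2 X \<Longrightarrow> (\<lambda>i. c * f i) \<in> ell2 X"
  by (auto simp: ell2_def norm_mult power_mult_distrib intro!: summable_on_cmult_right)

lemma ell2_zero: "(\<lambda>i. 0) \<in> ell2 X"
  by (simp add: ell2_def)

lemma ell2_diff: "f \<in> ell2 X \<Longrightarrow> g \<in> ell2 X \<Longrightarrow> (\<lambda>i. f i - g i) \<in> ell2 X"
  using ell2_add[of f X "\<lambda>i. (-1) * g i"] ell2_scale[of g X "-1"] by simp

lemma ell2_sum: "(\<And>k. k \<in> K \<Longrightarrow> f k \<in> ell2 X) \<Longrightarrow> (\<lambda>i. \<Sum>k\<in>K. f k i) \<in> ell2 X"
  by (induction K rule: infinite_finite_induct) (auto simp: ell2_zero ell2_add)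

lemma ell2_inner_add_left:
  "f \<in> ell2 X \<Longrightarrow> g \<in> ell2 X \<Longrightarrow> h \<in> ell2 X \<Longrightarrow>
   ell2_inner (\<lambda>i. f i + g i) h = ell2_inner f h + ell2_inner g h"
  unfolding ell2_inner_def
  by (subst infsum_add[symmetric]) (auto simp: ell2_inner_summable' ring_distribs)

lemma ell2_inner_add_right:
  "f \<in> ell2 X \<Longrightarrow> g \<in> ell2 X \<Longrightarrow> h \<in> ell2 X \<Longrightarrow>
   ell2_inner h (\<lambda>i. f i + g i) = ell2_inner h f + ell2_inner h g"
  unfolding ell2_inner_def
  by (subst infsum_add[symmetric]) (auto simp: ell2_inner_summable' ring_distribs)

lemma ell2_inner_scale_right: "ell2_inner f (\<lambda>i. c * g i) = c * ell2_inner f g"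
  unfolding ell2_inner_def
  by (subst infsum_cmult_right'[symmetric]) (simp add: mult_ac)

lemma ell2_inner_scale_left: "ell2_inner (\<lambda>i. c * f i) g = cnj c * ell2_inner f g"
  unfolding ell2_inner_def
  by (subst infsum_cmult_right'[symmetric]) (simp add: mult_ac)

lemma ell2_inner_zero [simp]: "ell2_inner (\<lambda>i. 0) f = 0" "ell2_inner f (\<lambda>i. 0) = 0"
  by (auto simp: ell2_inner_def)

lemma ell2_inner_diff_left:
  "f \<in> ell2 X \<Longrightarrow> g \<in> ell2 X \<Longrightarrow> h \<in> ell2 X \<Longrightarrow>
   ell2_inner (\<lambda>i. f i - g i) h = ell2_inner f h - ell2_inner g h"
  using ell2_inner_add_left[of f X "\<lambda>i. (-1) * g i" h] ell2_scale[of g X "-1"]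
    ell2_inner_scale_left[of "-1" g h] by simp

lemma ell2_inner_diff_right:
  "f \<in> ell2 X \<Longrightarrow> g \<in> ell2 X \<Longrightarrow> h \<in> ell2 X \<Longrightarrow>
   ell2_inner h (\<lambda>i. f i - g i) = ell2_inner h f - ell2_inner h g"
  using ell2_inner_add_right[of f X "\<lambda>i. (-1) * g i" h] ell2_scale[of g X "-1"]
    ell2_inner_scale_right[of h "-1" g] by simp

lemma ell2_inner_sum_right:
  "(\<And>k. k \<in> K \<Longrightarrow> f k \<in> ell2 X) \<Longrightarrow> h \<in> ell2 X \<Longrightarrow>
   ell2_inner h (\<lambda>i. \<Sum>k\<in>K. f k i) = (\<Sum>k\<in>K. ell2_inner h (f k))"
proof (induction K rule: infinite_finite_induct)
  case (insert k K)
  then show ?case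
    by (simp add: ell2_inner_add_right[of "f k" X "\<lambda>i. \<Sum>k\<in>K. f k i"] ell2_sum)
qed auto

lemma ell2_inner_sum_left:
  "(\<And>k. k \<in> K \<Longrightarrow> f k \<in> ell2 X) \<Longrightarrow> h \<in> ell2 X \<Longrightarrow>
   ell2_inner (\<lambda>i. \<Sum>k\<in>K. f k i) h = (\<Sum>k\<in>K. ell2_inner (f k) h)"
proof (induction K rule: infinite_finite_induct)
  case (insert k K)
  then show ?case
    by (simp add: ell2_inner_add_left[of "f k" X "\<lambda>i. \<Sum>k\<in>K. f k i"] ell2_sum)
qed auto

lemma ell2_inner_commute: "ell2_inner f g = cnj (ell2_inner g f)"
  unfolding ell2_inner_def by (subst infsum_cnj[symmetric]) (simp add: mult.commute)

lemma ell2_norm_nonneg [simp]: "0 \<le> ell2_norm f"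
  unfolding ell2_norm_def by (intro real_sqrt_ge_zero infsum_nonneg) auto

lemma ell2_norm_zero [simp]: "ell2_norm (\<lambda>i. 0) = 0"
  by (simp add: ell2_norm_def)

text \<open>If the squares are not summable, both infinite sums take the default value 0, so the
  identity holds for arbitrary functions. The strong exchange rule is used because it asks only that
  summability of the two families be equivalent.\<close>

lemma ell2_inner_self: "ell2_inner f f = complex_of_real ((ell2_norm f)\<^sup>2)"
proof -
  have "(ell2_norm f)\<^sup>2 = (\<Sum>\<^sub>\<infinity>i. (cmod (f i))\<^sup>2)"
    unfolding ell2_norm_def by (simp add: infsum_nonneg)
  moreover have "ell2_inner f f = (\<Sum>\<^sub>\<infinity>i. complex_of_real ((cmod (f i))\<^sup>2))"
    unfolding ell2_inner_def by (simp add: complex_norm_square mult.commute del: of_real_power)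
  moreover have "(\<Sum>\<^sub>\<infinity>i. complex_of_real ((cmod (f i))\<^sup>2)) = complex_of_real (\<Sum>\<^sub>\<infinity>i. (cmod (f i))\<^sup>2)"
  proof (rule infsum_bounded_linear_strong[OF _ bounded_linear_of_real])
    show "(\<lambda>i. complex_of_real ((cmod (f i))\<^sup>2)) summable_on UNIV \<longleftrightarrow> (\<lambda>i. (cmod (f i))\<^sup>2) summable_on UNIV"
      using summable_on_Re[of "\<lambda>i. complex_of_real ((cmod (f i))\<^sup>2)" UNIV]
        summable_on_of_real[of "\<lambda>i. (cmod (f i))\<^sup>2" UNIV] by (metis (no_types, lifting) Re_complex_of_real summable_on_cong)
  qed
  ultimately show ?thesis by simp
qed

lemma ell2_norm_scale: "ell2_norm (\<lambda>i. c * f i) = cmod c * ell2_norm f"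
proof -
  have "complex_of_real ((ell2_norm (\<lambda>i. c * f i))\<^sup>2) = cnj c * c * ell2_inner f f"
    by (simp only: ell2_inner_self[symmetric] ell2_inner_scale_left ell2_inner_scale_right mult_ac)
  also have "\<dots> = complex_of_real ((cmod c * ell2_norm f)\<^sup>2)"
    by (simp only: ell2_inner_self power_mult_distrib of_real_mult complex_norm_square mult_ac)
  finally have "complex_of_real ((ell2_norm (\<lambda>i. c * f i))\<^sup>2) = complex_of_real ((cmod c * ell2_norm f)\<^sup>2)" .
  then have "(ell2_norm (\<lambda>i. c * f i))\<^sup>2 = (cmod c * ell2_norm f)\<^sup>2" using of_real_eq_iff by blast
  then show ?thesis by (simp add: power2_eq_iff_nonneg)
qed

lemma ell2_norm_eq_0:
  assumes "f \<in> ell2 X" "ell2_norm f = 0"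
  shows "f = (\<lambda>i. 0)"
proof
  fix i
  have "(\<Sum>\<^sub>\<infinity>i. (cmod (f i))\<^sup>2) \<le> 0" using assms(2) by (simp add: ell2_norm_def)
  moreover have "(\<lambda>i. (cmod (f i))\<^sup>2) summable_on UNIV" using assms(1) by (simp add: ell2_def)
  ultimately have "(cmod (f i))\<^sup>2 = 0"
    by (intro nonneg_infsum_le_0D[of "\<lambda>i. (cmod (f i))\<^sup>2" UNIV i]) auto
  then show "f i = 0" by simp
qed

section \<open>The Cauchy-Schwarz inequality and continuity of the inner product\<close>

lemma ell2_cauchy_schwarz:
  assumes "f \<in> ell2 X" "g \<in> ell2 X"
  shows "cmod (ell2_inner f g) \<le> ell2_norm f * ell2_norm g"
proof (cases "ell2_norm g = 0")
  case True
  then show ?thesis using ell2_norm_eq_0[OF assms(2)] by simp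
next
  case False
  define n where "n = (ell2_norm g)\<^sup>2"
  \<comment> \<open>\<open>c\<close> times \<open>g\<close> is the orthogonal projection of
    \<open>f\<close> onto the line of \<open>g\<close>. The remainder \<open>d\<close> is orthogonal
    to \<open>g\<close>, and Pythagoras yields the inequality.\<close>
  define c where "c = ell2_inner g f / n"
  have n: "n > 0" using False by (simp add: n_def)
  define d where "d = (\<lambda>i. f i - c * g i)"
  have d: "d \<in> ell2 X" unfolding d_def using assms by (intro ell2_diff ell2_scale)
  have "ell2_inner g d = 0"
    unfolding d_def ell2_inner_diff_right[OF assms(1) ell2_scale[OF assms(2)] assms(2)]
    using n unfolding ell2_inner_scale_right ell2_inner_self n_def[symmetric] by (simp add: c_def)
  moreover have "f = (\<lambda>i. d i + c * g i)" by (auto simp: d_def)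
  moreover have "ell2_inner (\<lambda>i. d i + c * g i) (\<lambda>i. d i + c * g i) =
      ell2_inner d d + c * ell2_inner d g + cnj c * (ell2_inner g d + c * n)"
    using d assms by (simp only: ell2_inner_add_right[of _ X] ell2_inner_add_left[of _ X] ell2_scale ell2_add
        ell2_inner_scale_right ell2_inner_scale_left ell2_inner_self[of g] n_def distrib_left add_ac mult_ac)
  ultimately have "ell2_inner f f = ell2_inner d d + cnj c * c * n"
    using ell2_inner_commute[of d g] by simp
  then have "complex_of_real ((ell2_norm f)\<^sup>2) = complex_of_real ((ell2_norm d)\<^sup>2 + (cmod c)\<^sup>2 * n)"
    by (simp add: ell2_inner_self complex_norm_square mult_ac del: of_real_power)
  then have "(ell2_norm f)\<^sup>2 = (ell2_norm d)\<^sup>2 + (cmod c)\<^sup>2 * n" using of_real_eq_iff by blast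
  then have "(cmod c)\<^sup>2 * n \<le> (ell2_norm f)\<^sup>2" by simp
  moreover have "cmod c = cmod (ell2_inner g f) / n" using n by (simp add: c_def norm_divide)
  ultimately have "(cmod (ell2_inner g f))\<^sup>2 \<le> (ell2_norm f)\<^sup>2 * n"
    using n by (simp add: power_divide power2_eq_square field_simps)
  then have "(cmod (ell2_inner g f))\<^sup>2 \<le> (ell2_norm f * ell2_norm g)\<^sup>2"
    by (simp add: n_def power_mult_distrib)
  then have "cmod (ell2_inner g f) \<le> ell2_norm f * ell2_norm g"
    by (rule power2_le_imp_le) simp
  then show ?thesis using ell2_inner_commute[of f g] by simp
qed

lemma ell2_norm_add_le:
  assumes "f \<in> ell2 X" "g \<in> ell2 X"
  shows "ell2_norm (\<lambda>i. f i + g i) \<le> ell2_norm f + ell2_norm g"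
proof (rule power2_le_imp_le)
  have "complex_of_real ((ell2_norm (\<lambda>i. f i + g i))\<^sup>2) =
    complex_of_real ((ell2_norm f)\<^sup>2 + (ell2_norm g)\<^sup>2) + (ell2_inner f g + cnj (ell2_inner f g))"
    using assms ell2_inner_commute[of g f]
    by (simp add: ell2_inner_self[symmetric] ell2_inner_add_right[of _ X] ell2_inner_add_left[of _ X]
        ell2_add del: of_real_power)
  also have "\<dots> = complex_of_real ((ell2_norm f)\<^sup>2 + (ell2_norm g)\<^sup>2 + 2 * Re (ell2_inner f g))"
    by (simp add: complex_add_cnj)
  finally have "(ell2_norm (\<lambda>i. f i + g i))\<^sup>2 = (ell2_norm f)\<^sup>2 + (ell2_norm g)\<^sup>2 + 2 * Re (ell2_inner f g)"
    using of_real_eq_iff by blast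
  also have "Re (ell2_inner f g) \<le> ell2_norm f * ell2_norm g"
    using ell2_cauchy_schwarz[OF assms] complex_Re_le_cmod order_trans by blast
  finally show "(ell2_norm (\<lambda>i. f i + g i))\<^sup>2 \<le> (ell2_norm f + ell2_norm g)\<^sup>2"
    by (simp add: power2_sum)
qed simp

lemma ell2_norm_le_diff:
  assumes "f \<in> ell2 X" "g \<in> ell2 X"
  shows "ell2_norm f \<le> ell2_norm g + ell2_norm (\<lambda>i. f i - g i)"
  using ell2_norm_add_le[OF assms(2) ell2_diff[OF assms]] by simp

lemma ell2_norm_uminus: "ell2_norm (\<lambda>i. g i - f i) = ell2_norm (\<lambda>i. f i - g i)"
  using ell2_norm_scale[of "-1" "\<lambda>i. f i - g i"] by simp

lemma ell2_inner_tendsto: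
  assumes "\<And>n. f n \<in> ell2 X" "\<And>n. g n \<in> ell2 X" "f' \<in> ell2 X" "g' \<in> ell2 X"
    and "(\<lambda>n. ell2_norm (\<lambda>i. f n i - f' i)) \<longlonglongrightarrow> 0"
    and "(\<lambda>n. ell2_norm (\<lambda>i. g n i - g' i)) \<longlonglongrightarrow> 0"
  shows "(\<lambda>n. ell2_inner (f n) (g n)) \<longlonglongrightarrow> ell2_inner f' g'"
proof -
  have "norm (ell2_inner (f n) (g n) - ell2_inner f' g') \<le>
      ell2_norm (\<lambda>i. f n i - f' i) * (ell2_norm g' + ell2_norm (\<lambda>i. g n i - g' i)) +
      ell2_norm f' * ell2_norm (\<lambda>i. g n i - g' i)" for n
  proof -
    have "ell2_inner (f n) (g n) - ell2_inner f' g' =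
        ell2_inner (\<lambda>i. f n i - f' i) (g n) + ell2_inner f' (\<lambda>i. g n i - g' i)"
      using assms(1-4) by (simp add: ell2_inner_diff_left[of _ X] ell2_inner_diff_right[of _ X])
    then have "norm (ell2_inner (f n) (g n) - ell2_inner f' g') \<le>
        cmod (ell2_inner (\<lambda>i. f n i - f' i) (g n)) + cmod (ell2_inner f' (\<lambda>i. g n i - g' i))"
      by (simp add: norm_triangle_ineq)
    also have "cmod (ell2_inner (\<lambda>i. f n i - f' i) (g n)) \<le> ell2_norm (\<lambda>i. f n i - f' i) * ell2_norm (g n)"
      using assms(1-4) by (intro ell2_cauchy_schwarz[of _ X] ell2_diff)
    also have "ell2_norm (g n) \<le> ell2_norm g' + ell2_norm (\<lambda>i. g n i - g' i)"
      using assms(1-4) by (intro ell2_norm_le_diff[of _ X])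
    also have "cmod (ell2_inner f' (\<lambda>i. g n i - g' i)) \<le> ell2_norm f' * ell2_norm (\<lambda>i. g n i - g' i)"
      using assms(1-4) by (intro ell2_cauchy_schwarz[of _ X] ell2_diff)
    finally show ?thesis by (simp add: mult_left_mono)
  qed
  note bound = this
  have "(\<lambda>n. ell2_norm (\<lambda>i. f n i - f' i) * (ell2_norm g' + ell2_norm (\<lambda>i. g n i - g' i)) +
      ell2_norm f' * ell2_norm (\<lambda>i. g n i - g' i)) \<longlonglongrightarrow> 0 * (ell2_norm g' + 0) + ell2_norm f' * 0"
    by (intro tendsto_intros assms(5,6))
  then have "(\<lambda>n. ell2_norm (\<lambda>i. f n i - f' i) * (ell2_norm g' + ell2_norm (\<lambda>i. g n i - g' i)) +
      ell2_norm f' * ell2_norm (\<lambda>i. g n i - g' i)) \<longlonglongrightarrow> 0"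
    by simp
  with always_eventually[OF allI[OF bound]] have "(\<lambda>n. ell2_inner (f n) (g n) - ell2_inner f' g') \<longlonglongrightarrow> 0"
    by (rule Lim_null_comparison)
  then show ?thesis by (simp add: LIM_zero_iff)
qed

definition ell2_delta :: "'i \<Rightarrow> 'i \<Rightarrow> complex"
  where "ell2_delta x i = (if i = x then 1 else 0)"

lemma ell2_delta: 
  assumes "x \<in> X"
  shows "ell2_delta x \<in> ell2 X"
proof -
  have "(\<lambda>i. (cmod (ell2_delta x i))\<^sup>2) summable_on UNIV"
    by (rule finite_nonzero_values_imp_summable_on) (auto simp: ell2_delta_def)
  then show ?thesis using assms by (auto simp: ell2_def ell2_delta_def)
qed

lemma ell2_inner_delta: "ell2_inner (ell2_delta x) f = f x"
proof -
  have "ell2_inner (ell2_delta x) f = (\<Sum>\<^sub>\<infinity>i\<in>{x}. cnj (ell2_delta x i) * f i)"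
    unfolding ell2_inner_def by (rule infsum_cong_neutral) (auto simp: ell2_delta_def)
  then show ?thesis by (simp add: ell2_delta_def)
qed

lemma ell2_delta_inner: "ell2_inner f (ell2_delta x) = cnj (f x)"
  by (metis ell2_inner_commute ell2_inner_delta)

lemma ell2_eqI:
  assumes "f \<in> ell2 X" "g \<in> ell2 X" "\<And>x. x \<in> X \<Longrightarrow> f x = g x"
  shows "f = g"
proof
  fix i
  show "f i = g i" using assms by (cases "i \<in> X") (auto simp: ell2_def)
qed

subsection \<open>Tensor products of functions\<close>

lemma abs_summable_tensor:
  fixes a :: "'i \<Rightarrow> complex" and b :: "'j \<Rightarrow> complex"
  assumes "(\<lambda>i. norm (a i)) summable_on UNIV" "(\<lambda>j. norm (b j)) summable_on UNIV"
  shows "(\<lambda>p. norm (case p of (i, j) \<Rightarrow> a i * b j)) summable_on UNIV"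
proof -
  have "(\<lambda>p. norm (case p of (i, j) \<Rightarrow> a i * b j)) summable_on (SIGMA i:UNIV. UNIV)"
    unfolding Infinite_Sum.abs_summable_on_Sigma_iff
  proof (intro conjI ballI)
    show "(\<lambda>j. norm (case (i, j) of (i, j) \<Rightarrow> a i * b j)) summable_on UNIV" for i
      using summable_on_cmult_right[OF assms(2), of "norm (a i)"] by (simp add: norm_mult)
    have "(\<lambda>i. norm (a i) * (\<Sum>\<^sub>\<infinity>j. norm (b j))) summable_on UNIV"
      by (rule summable_on_cmult_left[OF assms(1)])
    then show "(\<lambda>i. norm (\<Sum>\<^sub>\<infinity>j. norm (case (i, j) of (i, j) \<Rightarrow> a i * b j))) summable_on UNIV"
      by (simp add: norm_mult infsum_cmult_right' abs_mult infsum_nonneg)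
  qed
  then show ?thesis by simp
qed

lemma infsum_tensor:
  fixes a :: "'i \<Rightarrow> complex" and b :: "'j \<Rightarrow> complex"
  assumes "(\<lambda>i. norm (a i)) summable_on UNIV" "(\<lambda>j. norm (b j)) summable_on UNIV"
  shows "(\<Sum>\<^sub>\<infinity>(i, j). a i * b j) = (\<Sum>\<^sub>\<infinity>i. a i) * (\<Sum>\<^sub>\<infinity>j. b j)"
proof -
  have "(\<lambda>(i, j). a i * b j) summable_on (SIGMA i:UNIV. UNIV)"
    using abs_summable_tensor[OF assms] Infinite_Sum.abs_summable_summable by fastforce
  from infsum_Sigma'_banach[OF this] show ?thesis
    by (simp add: infsum_cmult_right' infsum_cmult_left')
qed

definition ell2_tensor :: "('i \<Rightarrow> complex) \<Rightarrow> ('j \<Rightarrow> complex) \<Rightarrow> 'i \<times> 'j \<Rightarrow> complex"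
  where "ell2_tensor f g = (\<lambda>(i, j). f i * g j)"

lemma ell2_tensor:
  assumes "f \<in> ell2 X" "g \<in> ell2 Y"
  shows "ell2_tensor f g \<in> ell2 (X \<times> Y)"
proof -
  have "(\<lambda>i. norm (complex_of_real ((cmod (f i))\<^sup>2))) summable_on UNIV"
    "(\<lambda>i. norm (complex_of_real ((cmod (g i))\<^sup>2))) summable_on UNIV"
    using assms by (auto simp: ell2_def norm_power)
  from abs_summable_tensor[OF this] have "(\<lambda>p. (cmod (ell2_tensor f g p))\<^sup>2) summable_on UNIV"
    by (simp add: ell2_tensor_def case_prod_unfold norm_mult norm_power power_mult_distrib)
  then show ?thesis using assms by (auto simp: ell2_def ell2_tensor_def)
qed

lemma ell2_inner_tensor:
  assumes "f \<in> ell2 X" "f' \<in> ell2 X" "g \<in> ell2 Y" "g' \<in> ell2 Y"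
  shows "ell2_inner (ell2_tensor f g) (ell2_tensor f' g') = ell2_inner f f' * ell2_inner g g'"
  using infsum_tensor[OF ell2_inner_summable[OF assms(1,2)] ell2_inner_summable[OF assms(3,4)]]
  by (simp add: ell2_inner_def ell2_tensor_def case_prod_unfold mult_ac)

lemma ell2_norm_tensor:
  assumes "f \<in> ell2 X" "g \<in> ell2 Y"
  shows "ell2_norm (ell2_tensor f g) = ell2_norm f * ell2_norm g"
proof -
  have "complex_of_real ((ell2_norm (ell2_tensor f g))\<^sup>2) = complex_of_real ((ell2_norm f * ell2_norm g)\<^sup>2)"
    using assms by (simp add: ell2_inner_self[symmetric] ell2_inner_tensor[of _ X _ _ Y] power_mult_distrib del: of_real_power)
  then have "(ell2_norm (ell2_tensor f g))\<^sup>2 = (ell2_norm f * ell2_norm g)\<^sup>2" using of_real_eq_iff by blast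
  then show ?thesis by (simp add: power2_eq_iff_nonneg)
qed

lemma ell2_tensor_delta: "ell2_tensor (ell2_delta x) (ell2_delta y) = ell2_delta (x, y)"
  by (auto simp: ell2_tensor_def ell2_delta_def fun_eq_iff)

section \<open>Representations\<close>

locale hilbert_rep =
  fixes X :: "'i set" and \<pi> :: "'a::complex_star_algebra \<Rightarrow> 'i operator"
  assumes star_rep: "star_rep X \<pi>"
begin

lemma rep_ell2 [simp]: "f \<in> ell2 X \<Longrightarrow> \<pi> a f \<in> ell2 X"
  using star_rep by (simp add: star_rep_def bounded_operator_def)

lemma rep_add_vec: "f \<in> ell2 X \<Longrightarrow> g \<in> ell2 X \<Longrightarrow> \<pi> a (\<lambda>i. f i + g i) = (\<lambda>i. \<pi> a f i + \<pi> a g i)"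
  using star_rep by (simp add: star_rep_def bounded_operator_def)

lemma rep_scale_vec: "f \<in> ell2 X \<Longrightarrow> \<pi> a (\<lambda>i. c * f i) = (\<lambda>i. c * \<pi> a f i)"
  using star_rep by (simp add: star_rep_def bounded_operator_def)

lemma rep_zero_vec: "\<pi> a (\<lambda>i. 0) = (\<lambda>i. 0)"
  using rep_scale_vec[OF ell2_zero, of a 0] by simp

lemma rep_diff_vec: "f \<in> ell2 X \<Longrightarrow> g \<in> ell2 X \<Longrightarrow> \<pi> a (\<lambda>i. f i - g i) = (\<lambda>i. \<pi> a f i - \<pi> a g i)"
  using rep_add_vec[of f "\<lambda>i. (-1) * g i" a] rep_scale_vec[of g a "-1"] ell2_scale[of g X "-1"] by simp

lemma rep_sum_vec:
  "(\<And>k. k \<in> K \<Longrightarrow> f k \<in> ell2 X) \<Longrightarrow> \<pi> a (\<lambda>i. \<Sum>k\<in>K. f k i) = (\<lambda>i. \<Sum>k\<in>K. \<pi> a (f k) i)"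
  by (induction K rule: infinite_finite_induct) (simp_all add: rep_zero_vec rep_add_vec ell2_sum)

lemma rep_add: "f \<in> ell2 X \<Longrightarrow> \<pi> (a + b) f = (\<lambda>i. \<pi> a f i + \<pi> b f i)"
  and rep_mult: "f \<in> ell2 X \<Longrightarrow> \<pi> (a * b) f = \<pi> a (\<pi> b f)"
  and rep_scaleC: "f \<in> ell2 X \<Longrightarrow> \<pi> (c *\<^sub>C a) f = (\<lambda>i. c * \<pi> a f i)"
  and rep_one: "f \<in> ell2 X \<Longrightarrow> \<pi> 1 f = f"
  using star_rep by (simp_all add: star_rep_def)

lemma rep_zero: "f \<in> ell2 X \<Longrightarrow> \<pi> 0 f = (\<lambda>i. 0)"
  using rep_scaleC[of f 0 0] by simp

lemma rep_diff: "f \<in> ell2 X \<Longrightarrow> \<pi> (a - b) f = (\<lambda>i. \<pi> a f i - \<pi> b f i)"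
  using rep_add[of f a "(-1) *\<^sub>C b"] rep_scaleC[of f "-1" b] by simp

lemma rep_sum: "f \<in> ell2 X \<Longrightarrow> \<pi> (\<Sum>k\<in>K. a k) f = (\<lambda>i. \<Sum>k\<in>K. \<pi> (a k) f i)"
  by (induction K rule: infinite_finite_induct) (simp_all add: rep_zero rep_add)

lemma rep_sum_list: "f \<in> ell2 X \<Longrightarrow> \<pi> (\<Sum>k\<leftarrow>ks. a k) f = (\<lambda>i. \<Sum>k\<leftarrow>ks. \<pi> (a k) f i)"
  by (induction ks) (simp_all add: rep_zero rep_add)

lemma rep_adjoint: "f \<in> ell2 X \<Longrightarrow> g \<in> ell2 X \<Longrightarrow> ell2_inner f (\<pi> a g) = ell2_inner (\<pi> (star a) f) g"
  using star_rep by (simp add: star_rep_def)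

lemma rep_adjoint': "f \<in> ell2 X \<Longrightarrow> g \<in> ell2 X \<Longrightarrow> ell2_inner (\<pi> a f) g = ell2_inner f (\<pi> (star a) g)"
  using rep_adjoint[of f g "star a"] by (simp add: star_star)

text \<open>The adjoint replaces an expansion of \<open>f\<close> into basis vectors: the coordinate
  of \<open>\<pi> a f\<close> at \<open>y\<close> is the inner product of
  \<open>\<pi> (star a) (ell2_delta y)\<close> with \<open>f\<close>, and that vector vanishes
  because its own coordinates are read off from \<open>\<pi> a\<close> on basis vectors.\<close>

lemma rep_vanish:
  assumes "\<And>x. x \<in> X \<Longrightarrow> \<pi> a (ell2_delta x) = (\<lambda>i. 0)" "f \<in> ell2 X"
  shows "\<pi> a f = (\<lambda>i. 0)"
proof (rule ell2_eqI[of _ X])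
  fix y assume y: "y \<in> X"
  have "\<pi> (star a) (ell2_delta y) = (\<lambda>i. 0)"
  proof (rule ell2_eqI[of _ X])
    fix x assume x: "x \<in> X"
    then show "\<pi> (star a) (ell2_delta y) x = 0"
      using rep_adjoint'[of "ell2_delta x" "ell2_delta y" a] assms(1)[OF x] ell2_delta[of x X]
        ell2_delta[of y X] y by (simp add: ell2_inner_delta)
  qed (use y in \<open>simp_all add: ell2_delta ell2_zero\<close>)
  then show "\<pi> a f y = 0"
    using rep_adjoint[of "ell2_delta y" f a] assms(2) y by (simp add: ell2_inner_delta ell2_delta)
qed (use assms in \<open>simp_all add: ell2_zero\<close>)

end

section \<open>Isometric representations and the operator norm\<close>

locale isometric_rep =
  fixes X :: "'i set" and \<pi> :: "'a::cstar_algebra \<Rightarrow> 'i operator"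
  assumes faithful_rep: "faithful_rep X \<pi>"

sublocale isometric_rep \<subseteq> hilbert_rep
  by unfold_locales (use faithful_rep in \<open>simp add: faithful_rep_def\<close>)

context isometric_rep
begin

lemma norm_eq_Sup: "norm a = Sup {ell2_norm (\<pi> a f) | f. f \<in> ell2 X \<and> ell2_norm f \<le> 1}"
  using faithful_rep by (simp add: faithful_rep_def operator_norm_def)

text \<open>A real \<open>Sup\<close> bounds its set only once the set is known to be bounded above.
  The constant of \<open>bounded_operator\<close> provides this, and normalising \<open>f\<close>
  does the rest.\<close>

lemma rep_norm_le:
  assumes f: "f \<in> ell2 X"
  shows "ell2_norm (\<pi> a f) \<le> norm a * ell2_norm f"
proof (cases "ell2_norm f = 0")
  case True
  then show ?thesis using ell2_norm_eq_0[OF f] by (simp add: rep_zero_vec)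
next
  case False
  let ?S = "{ell2_norm (\<pi> a f) | f. f \<in> ell2 X \<and> ell2_norm f \<le> 1}"
  obtain K where K: "\<And>f. f \<in> ell2 X \<Longrightarrow> ell2_norm (\<pi> a f) \<le> K * ell2_norm f"
    using star_rep unfolding star_rep_def bounded_operator_def by metis
  have "bdd_above ?S"
  proof (rule bdd_aboveI[of _ "\<bar>K\<bar>"])
    fix r assume "r \<in> ?S"
    then obtain g where g: "g \<in> ell2 X" "ell2_norm g \<le> 1" "r = ell2_norm (\<pi> a g)" by auto
    have "K * ell2_norm g \<le> \<bar>K\<bar> * 1" using g(2) by (intro mult_mono) auto
    then show "r \<le> \<bar>K\<bar>" using K[OF g(1)] g(3) by simp
  qed
  define c where "c = complex_of_real (1 / ell2_norm f)"
  have pos: "ell2_norm f > 0" using False ell2_norm_nonneg[of f] by linarith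
  have c: "cmod c = 1 / ell2_norm f" using pos by (simp add: c_def norm_divide)
  have "ell2_norm (\<pi> a (\<lambda>i. c * f i)) \<in> ?S"
  proof -
    have "ell2_norm (\<lambda>i. c * f i) \<le> 1" using pos by (simp add: ell2_norm_scale c)
    then show ?thesis using ell2_scale[OF f, of c] by blast
  qed
  then have "ell2_norm (\<pi> a (\<lambda>i. c * f i)) \<le> norm a"
    unfolding norm_eq_Sup using \<open>bdd_above ?S\<close> by (rule cSup_upper)
  then show ?thesis using pos by (simp add: rep_scale_vec f ell2_norm_scale c field_simps)
qed

lemma norm_leI:
  assumes "0 \<le> K" "\<And>f. f \<in> ell2 X \<Longrightarrow> ell2_norm f \<le> 1 \<Longrightarrow> ell2_norm (\<pi> a f) \<le> K"
  shows "norm a \<le> K"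
  unfolding norm_eq_Sup
proof (rule cSup_least)
  show "{ell2_norm (\<pi> a f) | f. f \<in> ell2 X \<and> ell2_norm f \<le> 1} \<noteq> {}"
    using ell2_zero[of X] by (auto intro!: exI[of _ "\<lambda>i. 0"])
qed (use assms in auto)

text \<open>The left test vector is taken to be the image of the right one, after which one factor
  of its norm cancels.\<close>

lemma norm_leI_inner:
  assumes "0 \<le> K" "\<And>f g. f \<in> ell2 X \<Longrightarrow> g \<in> ell2 X \<Longrightarrow> cmod (ell2_inner f (\<pi> a g)) \<le> K * (ell2_norm f * ell2_norm g)"
  shows "norm a \<le> K"
proof (rule norm_leI[OF assms(1)])
  fix f assume f: "f \<in> ell2 X" "ell2_norm f \<le> 1"
  have "(ell2_norm (\<pi> a f))\<^sup>2 \<le> K * (ell2_norm (\<pi> a f) * ell2_norm f)"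
    using assms(2)[of "\<pi> a f" f] f by (simp add: ell2_inner_self norm_power)
  also have "\<dots> \<le> K * (ell2_norm (\<pi> a f) * 1)"
    using f assms(1) by (intro mult_left_mono) auto
  finally have "ell2_norm (\<pi> a f) * ell2_norm (\<pi> a f) \<le> K * ell2_norm (\<pi> a f)"
    by (simp add: power2_eq_square)
  then show "ell2_norm (\<pi> a f) \<le> K"
    using assms(1) ell2_norm_nonneg[of "\<pi> a f"] by (metis mult_le_cancel_right order_antisym_conv linorder_linear not_less)
qed

lemma rep_eqI:
  assumes "\<And>f. f \<in> ell2 X \<Longrightarrow> \<pi> a f = \<pi> b f"
  shows "a = b"
proof -
  have "norm (a - b) \<le> 0"
    by (rule norm_leI) (simp_all add: rep_diff assms)
  then show ?thesis by simp
qed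

lemma rep_eqI_delta:
  assumes "\<And>x. x \<in> X \<Longrightarrow> \<pi> a (ell2_delta x) = \<pi> b (ell2_delta x)"
  shows "a = b"
proof -
  have "\<pi> (a - b) f = (\<lambda>i. 0)" if "f \<in> ell2 X" for f
    by (rule rep_vanish) (use that assms in \<open>auto simp: rep_diff ell2_delta\<close>)
  then have "a - b = 0" by (intro rep_eqI) (simp add: rep_zero)
  then show ?thesis by simp
qed

lemma inner_rep_tendsto:
  assumes "a \<longlonglongrightarrow> b" "f \<in> ell2 X" "g \<in> ell2 X"
  shows "(\<lambda>n. ell2_inner f (\<pi> (a n) g)) \<longlonglongrightarrow> ell2_inner f (\<pi> b g)"
proof (rule ell2_inner_tendsto[where X = X])
  have "(\<lambda>n. norm (a n - b) * ell2_norm g) \<longlonglongrightarrow> 0 * ell2_norm g"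
    using assms(1) by (intro tendsto_intros) (simp add: tendsto_norm_zero LIM_zero_iff)
  then have lim: "(\<lambda>n. norm (a n - b) * ell2_norm g) \<longlonglongrightarrow> 0" by simp
  have bound: "norm (ell2_norm (\<lambda>i. \<pi> (a n) g i - \<pi> b g i)) \<le> norm (a n - b) * ell2_norm g" for n
    using rep_norm_le[OF assms(3), of "a n - b"] assms(3) by (simp add: rep_diff)
  show "(\<lambda>n. ell2_norm (\<lambda>i. \<pi> (a n) g i - \<pi> b g i)) \<longlonglongrightarrow> 0"
    by (rule Lim_null_comparison[OF always_eventually[OF allI[OF bound]] lim])
qed (use assms in auto)

end

section \<open>Spatial tensor products\<close>

text \<open>Fixes representations whose mere existence \<open>spatial_tensor\<close> asserts, so
  that elements of the tensor product can be computed with as operators.\<close>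

locale spatial_tensor_rep =
  A: isometric_rep X \<pi> + B: isometric_rep Y \<rho> + C: isometric_rep "X \<times> Y" \<sigma>
  for X :: "'i set" and \<pi> :: "'a::cstar_algebra \<Rightarrow> 'i operator"
    and Y :: "'j set" and \<rho> :: "'b::cstar_algebra \<Rightarrow> 'j operator"
    and \<sigma> :: "'c::cstar_algebra \<Rightarrow> ('i \<times> 'j) operator" +
  fixes tens :: "'a \<Rightarrow> 'b \<Rightarrow> 'c"
  assumes rep_tens: "f \<in> ell2 X \<Longrightarrow> g \<in> ell2 Y \<Longrightarrow>
      \<sigma> (tens a b) (ell2_tensor f g) = ell2_tensor (\<pi> a f) (\<rho> b g)"
    and tens_dense: "closure (cspan {tens a b | a b. True}) = UNIV"
begin

text \<open>\<open>rep_tens\<close> describes operators on product vectors only. This is enough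
  because the standard basis of the product space consists of product vectors; bilinearity,
  multiplicativity and the adjoint of \<open>tens\<close> all follow from it.\<close>

lemma tens_eqI:
  assumes "\<And>x y. x \<in> X \<Longrightarrow> y \<in> Y \<Longrightarrow>
    \<sigma> c (ell2_tensor (ell2_delta x) (ell2_delta y)) = \<sigma> d (ell2_tensor (ell2_delta x) (ell2_delta y))"
  shows "c = d"
  by (rule C.rep_eqI_delta) (use assms in \<open>auto simp: ell2_tensor_delta\<close>)

lemma tens_add_left: "tens (a + a') b = tens a b + tens a' b"
  by (rule tens_eqI)
    (simp add: rep_tens C.rep_add A.rep_add ell2_tensor ell2_delta,
     simp add: ell2_tensor_def fun_eq_iff distrib_right)

lemma tens_add_right: "tens a (b + b') = tens a b + tens a b'"
  by (rule tens_eqI)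
    (simp add: rep_tens C.rep_add B.rep_add ell2_tensor ell2_delta,
     simp add: ell2_tensor_def fun_eq_iff distrib_left)

lemma tens_scaleC_left: "tens (c *\<^sub>C a) b = c *\<^sub>C tens a b"
  by (rule tens_eqI)
    (simp add: rep_tens C.rep_scaleC A.rep_scaleC ell2_tensor ell2_delta,
     simp add: ell2_tensor_def fun_eq_iff mult_ac)

lemma tens_scaleC_right: "tens a (c *\<^sub>C b) = c *\<^sub>C tens a b"
  by (rule tens_eqI)
    (simp add: rep_tens C.rep_scaleC B.rep_scaleC ell2_tensor ell2_delta,
     simp add: ell2_tensor_def fun_eq_iff mult_ac)

lemma tens_mult: "tens a b * tens a' b' = tens (a * a') (b * b')"
  by (rule tens_eqI) (simp add: rep_tens C.rep_mult A.rep_mult B.rep_mult ell2_tensor ell2_delta)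

lemma tens_one: "tens 1 1 = 1"
  by (rule tens_eqI) (simp add: rep_tens C.rep_one A.rep_one B.rep_one ell2_tensor ell2_delta)

lemma tens_star: "star (tens a b) = tens (star a) (star b)"
proof (rule tens_eqI)
  fix x y assume xy: "x \<in> X" "y \<in> Y"
  let ?d = "\<lambda>x y. ell2_tensor (ell2_delta x) (ell2_delta y)"
  show "\<sigma> (star (tens a b)) (?d x y) = \<sigma> (tens (star a) (star b)) (?d x y)"
  proof (rule ell2_eqI[of _ "X \<times> Y"])
    fix p assume "p \<in> X \<times> Y"
    then obtain x' y' where p: "p = (x', y')" "x' \<in> X" "y' \<in> Y" by auto
    have "\<sigma> c (?d x y) p = ell2_inner (?d x' y') (\<sigma> c (?d x y))" for c
      by (simp add: ell2_tensor_delta ell2_inner_delta p)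
    then show "\<sigma> (star (tens a b)) (?d x y) p = \<sigma> (tens (star a) (star b)) (?d x y) p"
      using xy p
      by (simp add: C.rep_adjoint star_star ell2_tensor ell2_delta rep_tens)
        (simp add: ell2_inner_tensor[of _ X _ _ Y] ell2_delta A.rep_adjoint' B.rep_adjoint' ell2_inner_delta,
          simp add: ell2_tensor_def)
  qed (use xy in \<open>simp_all add: ell2_tensor ell2_delta\<close>)
qed

lemma rep_tens_sum_list:
  assumes "f \<in> ell2 X" "g \<in> ell2 Y"
  shows "\<sigma> (\<Sum>(a, b)\<leftarrow>ps. tens a b) (ell2_tensor f g) (i, j) = (\<Sum>(a, b)\<leftarrow>ps. \<pi> a f i * \<rho> b g j)"
proof -
  have "\<sigma> (\<Sum>p\<leftarrow>ps. tens (fst p) (snd p)) (ell2_tensor f g) (i, j) =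
      (\<Sum>p\<leftarrow>ps. \<pi> (fst p) f i * \<rho> (snd p) g j)"
    using assms by (simp add: C.rep_sum_list ell2_tensor rep_tens) (simp add: ell2_tensor_def)
  then show ?thesis by (simp add: case_prod_unfold)
qed

text \<open>A slice in the left leg by the functional that sends \<open>a\<close> to one coordinate
  of \<open>\<pi> a f\<close>. It turns a relation between tensors into a linear relation between
  the right legs.\<close>

lemma coordinate_slice_zero:
  assumes "(\<Sum>(a, b)\<leftarrow>ps. tens a b) = 0" "f \<in> ell2 X"
  shows "(\<Sum>(a, b)\<leftarrow>ps. \<pi> a f i *\<^sub>C b) = 0"
proof (rule B.rep_eqI)
  fix g assume g: "g \<in> ell2 Y"
  have "(\<Sum>(a, b)\<leftarrow>ps. \<pi> a f i * \<rho> b g j) = 0" for j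
    using rep_tens_sum_list[OF assms(2) g, of ps i j] assms(1) by (simp add: C.rep_zero ell2_tensor assms(2) g)
  then show "\<rho> (\<Sum>(a, b)\<leftarrow>ps. \<pi> a f i *\<^sub>C b) g = \<rho> 0 g"
    using g by (simp add: B.rep_sum_list B.rep_zero B.rep_scaleC case_prod_unfold fun_eq_iff)
qed

text \<open>
  Slicing with an arbitrary bounded functional is contractive because the norms on both factors
  can be tested on product vectors; no extension of \<open>h\<close> to operators is needed.
\<close>

lemma slice_bound:
  assumes h: "clinear h" "\<And>a. cmod (h a) \<le> norm a"
  shows "norm (\<Sum>(a, b)\<leftarrow>ps. h a *\<^sub>C b) \<le> norm (\<Sum>(a, b)\<leftarrow>ps. tens a b)"
proof (rule B.norm_leI_inner)
  let ?z = "\<Sum>(a, b)\<leftarrow>ps. tens a b"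
  fix g g' assume g: "g \<in> ell2 Y" "g' \<in> ell2 Y"
  \<comment> \<open>\<open>x\<close> slices the right leg by the vector functional of
    \<open>g\<close> and \<open>g'\<close>. Applying \<open>h\<close> to it gives the matrix
    coefficient to be estimated, while its norm is tested on vectors of the left leg.\<close>
  define x where "x = (\<Sum>(a, b)\<leftarrow>ps. ell2_inner g (\<rho> b g') *\<^sub>C a)"
  have inner_list: "ell2_inner v (\<lambda>i. \<Sum>k\<leftarrow>ks. F k i) = (\<Sum>k\<leftarrow>ks. ell2_inner v (F k))"
    if "v \<in> ell2 Z" "\<And>k. F k \<in> ell2 Z" for ks :: "('a \<times> 'b) list" and v and F :: "_ \<Rightarrow> 'k \<Rightarrow> complex" and Z
  proof (induction ks)
    case (Cons k ks)
    have "(\<lambda>i. \<Sum>k\<leftarrow>ks. F k i) \<in> ell2 Z" for ks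
      by (induction ks) (auto simp: ell2_zero ell2_add that(2))
    with Cons show ?case by (simp add: ell2_inner_add_right[of _ Z] that)
  qed simp
  have "ell2_inner g (\<rho> (\<Sum>p\<leftarrow>ps. h (fst p) *\<^sub>C snd p) g') = (\<Sum>p\<leftarrow>ps. h (fst p) * ell2_inner g (\<rho> (snd p) g'))"
    using g by (simp add: B.rep_sum_list inner_list[of _ Y] B.rep_scaleC ell2_scale ell2_inner_scale_right)
  also have "\<dots> = h x"
    unfolding x_def by (simp add: clinear_sum_list[OF h(1)] clinear_scaleC[OF h(1)] case_prod_unfold
        scaleC_complex_def mult.commute)
  finally have eq: "ell2_inner g (\<rho> (\<Sum>(a, b)\<leftarrow>ps. h a *\<^sub>C b) g') = h x" by (simp add: case_prod_unfold)
  have "norm x \<le> norm ?z * (ell2_norm g * ell2_norm g')"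
  proof (rule A.norm_leI_inner)
    fix f f' assume f: "f \<in> ell2 X" "f' \<in> ell2 X"
    have "ell2_inner f (\<pi> x f') = (\<Sum>p\<leftarrow>ps. ell2_inner g (\<rho> (snd p) g') * ell2_inner f (\<pi> (fst p) f'))"
      unfolding x_def using f
      by (simp add: A.rep_sum_list inner_list[of _ X] A.rep_scaleC ell2_scale ell2_inner_scale_right case_prod_unfold)
    also have "\<dots> = ell2_inner (ell2_tensor f g) (\<sigma> (\<Sum>p\<leftarrow>ps. tens (fst p) (snd p)) (ell2_tensor f' g'))"
      using f g by (simp add: C.rep_sum_list ell2_tensor inner_list[of _ "X \<times> Y"] rep_tens
          ell2_inner_tensor[of _ X _ _ Y] mult.commute)
    finally have "ell2_inner f (\<pi> x f') = ell2_inner (ell2_tensor f g) (\<sigma> ?z (ell2_tensor f' g'))"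
      by (simp add: case_prod_unfold)
    then have "cmod (ell2_inner f (\<pi> x f')) \<le> ell2_norm (ell2_tensor f g) * ell2_norm (\<sigma> ?z (ell2_tensor f' g'))"
      using f g by (auto intro!: ell2_cauchy_schwarz[of _ "X \<times> Y"] simp: ell2_tensor)
    also have "\<dots> \<le> ell2_norm (ell2_tensor f g) * (norm ?z * ell2_norm (ell2_tensor f' g'))"
      using f g by (intro mult_left_mono C.rep_norm_le) (auto simp: ell2_tensor)
    finally show "cmod (ell2_inner f (\<pi> x f')) \<le>
        norm ?z * (ell2_norm g * ell2_norm g') * (ell2_norm f * ell2_norm f')"
      using f g by (simp add: ell2_norm_tensor[of _ X _ Y] mult_ac)
  qed simp
  then show "cmod (ell2_inner g (\<rho> (\<Sum>(a, b)\<leftarrow>ps. h a *\<^sub>C b) g')) \<le> norm ?z * (ell2_norm g * ell2_norm g')"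
    unfolding eq using h(2) order_trans by blast
qed simp

end

lemma spatial_tensor_repE:
  fixes tens :: "'a::cstar_algebra \<Rightarrow> 'b::cstar_algebra \<Rightarrow> 'c::cstar_algebra"
  assumes "spatial_tensor tens"
  obtains X :: "'a set" and \<pi> and Y :: "'b set" and \<rho> \<sigma> where "spatial_tensor_rep X \<pi> Y \<rho> \<sigma> tens"
proof -
  obtain X :: "'a set" and Y :: "'b set" and \<pi> \<rho> \<sigma> where
    "faithful_rep X \<pi>" "faithful_rep Y \<rho>" "faithful_rep (X \<times> Y) \<sigma>"
    "\<forall>a b. \<forall>f\<in>ell2 X. \<forall>g\<in>ell2 Y. \<sigma> (tens a b) (\<lambda>(i, j). f i * g j) = (\<lambda>(i, j). \<pi> a f i * \<rho> b g j)"
    using assms unfolding spatial_tensor_def by blast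
  moreover have "closure (cspan {tens a b | a b. True}) = UNIV"
    using assms unfolding spatial_tensor_def by simp
  ultimately have "spatial_tensor_rep X \<pi> Y \<rho> \<sigma> tens"
    by unfold_locales (simp_all add: ell2_tensor_def)
  then show ?thesis by (rule that)
qed

text \<open>The algebraic laws mention no representation, so the auxiliary ones can be discarded
  here.\<close>

locale tensor_product =
  fixes tens :: "'a::cstar_algebra \<Rightarrow> 'b::cstar_algebra \<Rightarrow> 'c::cstar_algebra"
  assumes spatial: "spatial_tensor tens"
begin

lemma tens_add_left: "tens (a + a') b = tens a b + tens a' b"
  and tens_add_right: "tens a (b + b') = tens a b + tens a b'"
  and tens_scaleC_left: "tens (c *\<^sub>C a) b = c *\<^sub>C tens a b"
  and tens_scaleC_right: "tens a (c *\<^sub>C b) = c *\<^sub>C tens a b"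
  and tens_mult: "tens a b * tens a' b' = tens (a * a') (b * b')"
  and tens_star: "star (tens a b) = tens (star a) (star b)"
  and tens_one: "tens 1 1 = 1"
  by (metis spatial spatial_tensor_repE spatial_tensor_rep.tens_add_left,
      metis spatial spatial_tensor_repE spatial_tensor_rep.tens_add_right,
      metis spatial spatial_tensor_repE spatial_tensor_rep.tens_scaleC_left,
      metis spatial spatial_tensor_repE spatial_tensor_rep.tens_scaleC_right,
      metis spatial spatial_tensor_repE spatial_tensor_rep.tens_mult,
      metis spatial spatial_tensor_repE spatial_tensor_rep.tens_star,
      metis spatial spatial_tensor_repE spatial_tensor_rep.tens_one)

lemma tens_zero_left [simp]: "tens 0 b = 0" and tens_zero_right [simp]: "tens a 0 = 0"
  using tens_scaleC_left[of 0 0 b] tens_scaleC_right[of a 0 0] by simp_all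

lemma tens_sum_right: "tens a (\<Sum>i\<in>I. f i) = (\<Sum>i\<in>I. tens a (f i))"
  by (induction I rule: infinite_finite_induct) (simp_all add: tens_add_right)

lemma tens_dense: "closure (cspan {tens a b | a b. True}) = UNIV"
  using spatial by (simp add: spatial_tensor_def)

section \<open>Slice maps on the completed tensor product\<close>

lemma ctensor_map_eq:
  assumes "bounded_clinear F" "\<And>a b. F (tens a b) = \<beta> a b"
  shows "ctensor_map tens \<beta> = F"
  unfolding ctensor_map_def
proof (rule the_equality)
  show "bounded_clinear F \<and> (\<forall>a b. F (tens a b) = \<beta> a b)" using assms by simp
  fix G assume G: "bounded_clinear G \<and> (\<forall>a b. G (tens a b) = \<beta> a b)"
  show "G = F"
  proof (rule clinear_eqI_dense[OF _ _ tens_dense])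
    show "bounded_linear G" "bounded_linear F"
      using G assms(1) by (auto intro: bounded_clinear_bounded_linear)
    have lin: "clinear G" "clinear F" using G assms(1) by (auto simp: bounded_clinear_def)
    fix x assume "x \<in> cspan {tens a b | a b. True}"
    then show "G x = F x"
      by (induction rule: cspan_induct)
        (use G assms(2) lin in \<open>auto simp: clinear_zero clinear_add clinear_scaleC\<close>)
  qed
qed

text \<open>The bound of \<open>slice_bound\<close> yields two things at once: the value on a finite
  sum does not depend on the chosen decomposition, because two of them differ by a sum of norm 0,
  and the resulting map is contractive and extends by continuity.\<close>

lemma slice_map:
  assumes h: "clinear h" "\<And>a. cmod (h a) \<le> norm a"
  shows "\<exists>F. bounded_clinear F \<and> (\<forall>a b. F (tens a b) = h a *\<^sub>C b)"
proof -
  define S where "S = range (\<lambda>ps. \<Sum>(a, b)\<leftarrow>ps. tens a b)"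
  define f where "f z = (\<Sum>(a, b)\<leftarrow>(SOME ps. z = (\<Sum>(a, b)\<leftarrow>ps. tens a b)). h a *\<^sub>C b)" for z
  have bound: "norm (\<Sum>(a, b)\<leftarrow>ps. h a *\<^sub>C b) \<le> norm (\<Sum>(a, b)\<leftarrow>ps. tens a b)" for ps
    by (metis (no_types) spatial spatial_tensor_repE spatial_tensor_rep.slice_bound[OF _ h])
  have scale: "(\<Sum>(a, b)\<leftarrow>map (\<lambda>(a, b). (c *\<^sub>C a, b)) ps. tens a b) = c *\<^sub>C (\<Sum>(a, b)\<leftarrow>ps. tens a b)"
      "(\<Sum>(a, b)\<leftarrow>map (\<lambda>(a, b). (c *\<^sub>C a, b)) ps. h a *\<^sub>C b) = c *\<^sub>C (\<Sum>(a, b)\<leftarrow>ps. h a *\<^sub>C b)" for c ps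
    by (induction ps) (auto simp: tens_scaleC_left scaleC_add_right clinear_scaleC[OF h(1)]
        scaleC_scaleC scaleC_complex_def)
  have f: "f (\<Sum>(a, b)\<leftarrow>ps. tens a b) = (\<Sum>(a, b)\<leftarrow>ps. h a *\<^sub>C b)" for ps
  proof -
    define qs where "qs = (SOME qs. (\<Sum>(a, b)\<leftarrow>ps. tens a b) = (\<Sum>(a, b)\<leftarrow>qs. tens a b))"
    have qs: "(\<Sum>(a, b)\<leftarrow>ps. tens a b) = (\<Sum>(a, b)\<leftarrow>qs. tens a b)"
      unfolding qs_def by (rule someI[of _ ps]) simp
    have "norm ((\<Sum>(a, b)\<leftarrow>ps. h a *\<^sub>C b) - (\<Sum>(a, b)\<leftarrow>qs. h a *\<^sub>C b)) \<le> 0"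
      using bound[of "ps @ map (\<lambda>(a, b). ((-1) *\<^sub>C a, b)) qs"] scale[of "-1" qs] qs by simp
    then show ?thesis by (simp add: f_def qs_def[symmetric])
  qed
  have "cspan {tens a b | a b. True} \<subseteq> S"
  proof
    fix x assume "x \<in> cspan {tens a b | a b. True}"
    then show "x \<in> S"
    proof (induction rule: cspan_induct)
      case zero
      then show ?case unfolding S_def by (auto intro!: image_eqI[of _ _ "[]"])
    next
      case (add c x y)
      obtain a b where "x = tens a b" using add(1) by auto
      moreover obtain ps where "y = (\<Sum>(a, b)\<leftarrow>ps. tens a b)" using add(3) unfolding S_def by (rule rangeE)
      ultimately show ?case
        unfolding S_def by (auto intro!: image_eqI[of _ _ "(c *\<^sub>C a, b) # ps"] simp: tens_scaleC_left)
    qed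
  qed
  then have dense: "closure S = UNIV"
    using tens_dense closure_mono by blast
  have f_add: "\<And>x y. x \<in> S \<Longrightarrow> y \<in> S \<Longrightarrow> x + y \<in> S \<and> f (x + y) = f x + f y"
  proof -
    fix x y assume "x \<in> S" "y \<in> S"
    obtain ps where "x = (\<Sum>(a, b)\<leftarrow>ps. tens a b)" using \<open>x \<in> S\<close> unfolding S_def by (rule rangeE)
    moreover obtain qs where "y = (\<Sum>(a, b)\<leftarrow>qs. tens a b)" using \<open>y \<in> S\<close> unfolding S_def by (rule rangeE)
    ultimately show "x + y \<in> S \<and> f (x + y) = f x + f y"
      using f[of "ps @ qs"] f[of ps] f[of qs] unfolding S_def
      by (auto intro!: image_eqI[of _ _ "ps @ qs"])
  qed
  have f_scaleC: "c *\<^sub>C x \<in> S \<and> f (c *\<^sub>C x) = c *\<^sub>C f x" if x: "x \<in> S" for c x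
  proof -
    obtain ps where ps: "x = (\<Sum>(a, b)\<leftarrow>ps. tens a b)" using x unfolding S_def by (rule rangeE)
    show ?thesis
      using scale[of c ps] f[of ps] f[of "map (\<lambda>(a, b). (c *\<^sub>C a, b)) ps"] unfolding ps S_def
      by (metis rangeI)
  qed
  have "norm (f x) \<le> 1 * norm x" if x: "x \<in> S" for x
  proof -
    obtain ps where ps: "x = (\<Sum>(a, b)\<leftarrow>ps. tens a b)" using x unfolding S_def by (rule rangeE)
    show ?thesis using bound[of ps] f[of ps] unfolding ps by simp
  qed
  note f_bound = this
  show ?thesis
  proof (rule clinear_extension[OF dense, of f 1])
    fix F assume F: "clinear F" "\<And>x. norm (F x) \<le> 1 * norm x" "\<And>x. x \<in> S \<Longrightarrow> F x = f x"
    show ?thesis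
    proof (intro exI[of _ F] conjI allI)
      show "bounded_clinear F" unfolding bounded_clinear_def using F(1,2) by blast
      show "F (tens a b) = h a *\<^sub>C b" for a b
      proof -
        have "tens a b \<in> S" unfolding S_def by (auto intro!: image_eqI[of _ _ "[(a, b)]"])
        then show ?thesis using f[of "[(a, b)]"] F(3) by simp
      qed
    qed
  qed (use f_add f_scaleC f_bound in blast)+
qed

end

subsection \<open>Linear maps on the algebraic tensor product\<close>

definition csubspace :: "'a::complex_star_algebra set \<Rightarrow> bool"
  where "csubspace A \<longleftrightarrow> 0 \<in> A \<and> (\<forall>x\<in>A. \<forall>y\<in>A. x + y \<in> A) \<and> (\<forall>c. \<forall>x\<in>A. c *\<^sub>C x \<in> A)"

lemma csubspace_minus: "csubspace A \<Longrightarrow> x \<in> A \<Longrightarrow> - x \<in> A"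
  unfolding csubspace_def using scaleC_minus_one[of x] by metis

text \<open>Middle linearity as in tensor products of modules: scalars pass from one leg to the
  other, so the target needs no scalar action, only addition.\<close>

definition balanced_on :: "'a::complex_star_algebra set \<Rightarrow> ('a \<Rightarrow> 'a \<Rightarrow> 'v::ab_group_add) \<Rightarrow> bool"
  where "balanced_on A \<beta> \<longleftrightarrow>
    (\<forall>x\<in>A. \<forall>y\<in>A. \<forall>z\<in>A. \<beta> (x + y) z = \<beta> x z + \<beta> y z \<and> \<beta> x (y + z) = \<beta> x y + \<beta> x z) \<and>
    (\<forall>c. \<forall>x\<in>A. \<forall>y\<in>A. \<beta> (c *\<^sub>C x) y = \<beta> x (c *\<^sub>C y))"

text \<open>If the right leg paired with \<open>a\<close> is a combination of the other right legs,
  distributing it adds a multiple of \<open>a\<close> to each left leg and shortens the sum by one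
  term.\<close>

lemma balanced_on_eliminate:
  assumes \<beta>: "balanced_on A \<beta>" and A: "csubspace A" and "a \<in> A" "set qs \<subseteq> A \<times> A"
  shows "\<beta> a (\<Sum>(x, y)\<leftarrow>qs. c x *\<^sub>C y) + (\<Sum>(x, y)\<leftarrow>qs. \<beta> x y) =
    (\<Sum>(x, y)\<leftarrow>map (\<lambda>(x, y). (x + c x *\<^sub>C a, y)) qs. \<beta> x y) \<and> (\<Sum>(x, y)\<leftarrow>qs. c x *\<^sub>C y) \<in> A"
  using assms(4)
proof (induction qs)
  case Nil
  have "\<beta> a (0 + 0) = \<beta> a 0 + \<beta> a 0" using \<beta> A \<open>a \<in> A\<close> unfolding balanced_on_def csubspace_def by blast
  then show ?case using A by (simp add: csubspace_def)
next
  case (Cons q qs)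
  obtain x y where q: "q = (x, y)" by fastforce
  have xy: "x \<in> A" "y \<in> A" using Cons q by auto
  let ?s = "\<Sum>(x, y)\<leftarrow>qs. c x *\<^sub>C y"
  have s: "?s \<in> A" using Cons by simp
  have cy: "c x *\<^sub>C y \<in> A" "c x *\<^sub>C a \<in> A" using A xy \<open>a \<in> A\<close> by (auto simp: csubspace_def)
  have "\<beta> a (c x *\<^sub>C y + ?s) = \<beta> (c x *\<^sub>C a) y + \<beta> a ?s"
    using \<beta> s cy xy \<open>a \<in> A\<close> unfolding balanced_on_def by metis
  moreover have "\<beta> (x + c x *\<^sub>C a) y = \<beta> x y + \<beta> (c x *\<^sub>C a) y"
    using \<beta> cy xy unfolding balanced_on_def by metis
  moreover have "c x *\<^sub>C y + ?s \<in> A" using A s cy by (auto simp: csubspace_def)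
  ultimately show ?case using Cons by (simp add: q algebra_simps)
qed

locale self_tensor_product = tensor_product tens
  for tens :: "'a::cstar_algebra \<Rightarrow> 'a \<Rightarrow> 'c::cstar_algebra"
begin

text \<open>
  If the first left factor is nonzero, the relation makes the first right factor a combination of
  the remaining ones, so that one term can be eliminated.
\<close>

lemma balanced_on_kernel:
  assumes "csubspace A" "balanced_on A \<beta>" "set ps \<subseteq> A \<times> A" "(\<Sum>(a, b)\<leftarrow>ps. tens a b) = 0"
  shows "(\<Sum>(a, b)\<leftarrow>ps. \<beta> a b) = 0"
proof -
  obtain X :: "'a set" and \<pi> and Y :: "'a set" and \<rho> \<sigma> where "spatial_tensor_rep X \<pi> Y \<rho> \<sigma> tens"
    using spatial spatial_tensor_repE by blast
  then interpret spatial_tensor_rep X \<pi> Y \<rho> \<sigma> tens .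
  have tens: "balanced_on A tens"
    by (simp add: balanced_on_def tens_add_left tens_add_right tens_scaleC_left tens_scaleC_right)
  \<comment> \<open>Induction on the length and not on the list, because elimination changes the
    remaining terms.\<close>
  show ?thesis using assms(3,4)
  proof (induction "length ps" arbitrary: ps)
    case (Suc n)
    then obtain a b qs where ps: "ps = (a, b) # qs" by (metis length_Suc_conv surj_pair)
    have ab: "a \<in> A" "b \<in> A" and qs: "set qs \<subseteq> A \<times> A" using Suc.prems ps by auto
    show ?case
    proof (cases "a = 0")
      case True
      have "\<beta> (0 + 0) b = \<beta> 0 b + \<beta> 0 b" using assms(1,2) ab unfolding balanced_on_def csubspace_def by blast
      moreover have "(\<Sum>(a, b)\<leftarrow>qs. \<beta> a b) = 0" using Suc ps qs True by simp
      ultimately show ?thesis using ps True by simp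
    next
      case False
      then obtain f i where f: "f \<in> ell2 X" "\<pi> a f i \<noteq> 0"
        using A.rep_eqI[of a 0] A.rep_zero by (metis ext)
      \<comment> \<open>Solving the sliced relation for \<open>b\<close> gives these coefficients;
        the coordinate \<open>i\<close> was picked to make the denominator nonzero.\<close>
      define c where "c x = - \<pi> x f i / \<pi> a f i" for x
      define qs' where "qs' = map (\<lambda>(x, y). (x + c x *\<^sub>C a, y)) qs"
      have *: "\<pi> a f i *\<^sub>C b + (\<Sum>(x, y)\<leftarrow>qs. \<pi> x f i *\<^sub>C y) = 0"
        using coordinate_slice_zero[OF Suc.prems(2) f(1), of i] ps by simp
      have "(\<Sum>(x, y)\<leftarrow>qs. c x *\<^sub>C y) = (- 1 / \<pi> a f i) *\<^sub>C (\<Sum>(x, y)\<leftarrow>qs. \<pi> x f i *\<^sub>C y)"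
        by (induction qs) (auto simp: c_def scaleC_add_right scaleC_scaleC)
      also have "\<dots> = (- 1 / \<pi> a f i) *\<^sub>C (- (\<pi> a f i *\<^sub>C b))"
        using * by (metis add.inverse_unique)
      finally have b: "(\<Sum>(x, y)\<leftarrow>qs. c x *\<^sub>C y) = b"
        using f(2) by (simp add: scaleC_minus_right scaleC_scaleC)
      have "set qs' \<subseteq> A \<times> A"
        using qs ab assms(1) by (auto simp: qs'_def csubspace_def)
      moreover have "(\<Sum>(x, y)\<leftarrow>qs'. tens x y) = 0"
        using balanced_on_eliminate[OF tens assms(1) ab(1) qs, of c] Suc.prems(2)
        by (simp add: b ps qs'_def)
      moreover have "n = length qs'" using Suc.hyps(2) ps by (simp add: qs'_def)
      ultimately have "(\<Sum>(x, y)\<leftarrow>qs'. \<beta> x y) = 0" using Suc.hyps(1) by blast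
      then show ?thesis
        using balanced_on_eliminate[OF assms(2,1) ab(1) qs, of c] by (simp add: b ps qs'_def)
    qed
  qed simp
qed

text \<open>Two decompositions of one tensor, the left legs of the second negated, form a
  decomposition of 0, on which every balanced map vanishes. So the description in
  \<open>tensor_map\<close> determines a unique value.\<close>

lemma tensor_map_eq:
  assumes A: "csubspace A" and \<beta>: "balanced_on A \<beta>" and ps: "set ps \<subseteq> A \<times> A"
  shows "tensor_map tens A \<beta> (\<Sum>(a, b)\<leftarrow>ps. tens a b) = (\<Sum>(a, b)\<leftarrow>ps. \<beta> a b)"
  unfolding tensor_map_def
proof (rule the_equality)
  fix v assume "\<exists>qs. set qs \<subseteq> A \<times> A \<and> (\<Sum>(a, b)\<leftarrow>ps. tens a b) = (\<Sum>(a, b)\<leftarrow>qs. tens a b) \<and>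
      v = (\<Sum>(a, b)\<leftarrow>qs. \<beta> a b)"
  then obtain qs where qs: "set qs \<subseteq> A \<times> A" "(\<Sum>(a, b)\<leftarrow>ps. tens a b) = (\<Sum>(a, b)\<leftarrow>qs. tens a b)"
    "v = (\<Sum>(a, b)\<leftarrow>qs. \<beta> a b)" by blast
  define qs' where "qs' = map (\<lambda>(a, b). ((-1) *\<^sub>C a, b)) qs"
  have neg: "\<gamma> ((-1) *\<^sub>C a) b = - \<gamma> a b" if "balanced_on A \<gamma>" "a \<in> A" "b \<in> A" for \<gamma> :: "_ \<Rightarrow> _ \<Rightarrow> 'w::ab_group_add" and a b
  proof -
    have m: "(-1) *\<^sub>C a \<in> A" "0 \<in> A" using A that(2) unfolding csubspace_def by blast+
    have "\<gamma> (0 + 0) b = \<gamma> 0 b + \<gamma> 0 b" using that m unfolding balanced_on_def by metis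
    moreover have "\<gamma> (a + (-1) *\<^sub>C a) b = \<gamma> a b + \<gamma> ((-1) *\<^sub>C a) b"
      using that m unfolding balanced_on_def by metis
    ultimately show ?thesis by (simp add: eq_neg_iff_add_eq_0 add.commute)
  qed
  have neg_list: "(\<Sum>(a, b)\<leftarrow>qs'. \<gamma> a b) = - (\<Sum>(a, b)\<leftarrow>qs. \<gamma> a b)" if "balanced_on A \<gamma>"
    for \<gamma> :: "_ \<Rightarrow> _ \<Rightarrow> 'w::ab_group_add"
    unfolding qs'_def using qs(1) neg[OF that] by (induction qs) auto
  have "balanced_on A tens"
    by (simp add: balanced_on_def tens_add_left tens_add_right tens_scaleC_left tens_scaleC_right)
  from neg_list[OF this] have "(\<Sum>(a, b)\<leftarrow>ps @ qs'. tens a b) = 0" using qs(2) by simp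
  moreover have "set (ps @ qs') \<subseteq> A \<times> A"
    using ps qs(1) csubspace_minus[OF A] by (auto simp: qs'_def)
  ultimately have "(\<Sum>(a, b)\<leftarrow>ps @ qs'. \<beta> a b) = 0" using balanced_on_kernel[OF A \<beta>] by blast
  then show "v = (\<Sum>(a, b)\<leftarrow>ps. \<beta> a b)" using neg_list[OF \<beta>] qs(3) by simp
qed (use ps in blast)

end

section \<open>Positive operator matrices\<close>

definition tuple_inner :: "nat \<Rightarrow> (nat \<Rightarrow> 'i \<Rightarrow> complex) \<Rightarrow> (nat \<Rightarrow> 'i \<Rightarrow> complex) \<Rightarrow> complex"
  where "tuple_inner n F G = (\<Sum>i<n. ell2_inner (F i) (G i))"

definition mat_mult :: "nat \<Rightarrow> (nat \<Rightarrow> nat \<Rightarrow> 'a::semiring_0) \<Rightarrow> (nat \<Rightarrow> nat \<Rightarrow> 'a) \<Rightarrow> nat \<Rightarrow> nat \<Rightarrow> 'a"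
  where "mat_mult n M N i j = (\<Sum>k<n. M i k * N k j)"

text \<open>The unit matrix extends over all indices whereas products sum below \<open>n\<close>
  only; it is neutral on the left only for row indices below \<open>n\<close> and on the right only
  for column indices below \<open>n\<close>.\<close>

fun mat_pow :: "nat \<Rightarrow> (nat \<Rightarrow> nat \<Rightarrow> 'a::semiring_1) \<Rightarrow> nat \<Rightarrow> nat \<Rightarrow> nat \<Rightarrow> 'a"
  where "mat_pow n M 0 = (\<lambda>i j. if i = j then 1 else 0)"
  | "mat_pow n M (Suc k) = mat_mult n M (mat_pow n M k)"

lemma mat_mult_assoc: "mat_mult n (mat_mult n M N) R = mat_mult n M (mat_mult n N R)"
proof (intro ext)
  fix i j
  have "mat_mult n (mat_mult n M N) R i j = (\<Sum>k<n. \<Sum>l<n. M i l * N l k * R k j)"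
    by (simp add: mat_mult_def sum_distrib_right)
  also have "\<dots> = (\<Sum>l<n. \<Sum>k<n. M i l * N l k * R k j)" by (rule sum.swap)
  also have "\<dots> = mat_mult n M (mat_mult n N R) i j"
    by (simp add: mat_mult_def sum_distrib_left mult.assoc)
  finally show "mat_mult n (mat_mult n M N) R i j = mat_mult n M (mat_mult n N R) i j" .
qed

lemma mat_mult_cong:
  "(\<And>k. k < n \<Longrightarrow> M i k = M' i k) \<Longrightarrow> (\<And>k. k < n \<Longrightarrow> N k j = N' k j) \<Longrightarrow>
    mat_mult n M N i j = mat_mult n M' N' i j"
  by (simp add: mat_mult_def)

lemma mat_pow_add: "i < n \<Longrightarrow> mat_mult n (mat_pow n M k) (mat_pow n M l) i j = mat_pow n M (k + l) i j"
proof (induction k arbitrary: i)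
  case 0
  then show ?case by (simp add: mat_mult_def if_distrib if_distribR cong: if_cong)
next
  case (Suc k)
  have "mat_mult n M (mat_mult n (mat_pow n M k) (mat_pow n M l)) i j = mat_mult n M (mat_pow n M (k + l)) i j"
    by (rule mat_mult_cong) (use Suc in auto)
  then show ?case by (simp add: mat_mult_assoc)
qed

lemma mat_pow_one: "j < n \<Longrightarrow> mat_pow n M (Suc 0) i j = M i j"
  by (simp add: mat_mult_def if_distrib cong: if_cong)

lemma mat_pow_Suc_right:
  assumes "i < n" "j < n"
  shows "mat_mult n (mat_pow n M k) M i j = mat_pow n M (Suc k) i j"
proof -
  have "mat_mult n (mat_pow n M k) M i j = mat_mult n (mat_pow n M k) (mat_pow n M (Suc 0)) i j"
    by (rule mat_mult_cong) (simp_all del: mat_pow.simps add: mat_pow_one assms)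
  then show ?thesis using mat_pow_add[OF assms(1), of M k "Suc 0" j] by (simp del: mat_pow.simps)
qed

text \<open>The adjoint reverses products, so the recursion, which multiplies on the left, has to be
  matched with multiplication on the right.\<close>

lemma star_mat_pow:
  fixes P :: "nat \<Rightarrow> nat \<Rightarrow> 'a::complex_star_algebra"
  assumes "\<And>i j. i < n \<Longrightarrow> j < n \<Longrightarrow> star (P i j) = P j i"
  shows "i < n \<Longrightarrow> j < n \<Longrightarrow> star (mat_pow n P k i j) = mat_pow n P k j i"
proof (induction k arbitrary: i j)
  case (Suc k)
  have "star (mat_mult n P (mat_pow n P k) i j) = mat_mult n (mat_pow n P k) P j i"
    using Suc assms by (simp add: mat_mult_def star_sum star_mult)
  then show ?case using mat_pow_Suc_right[OF Suc.prems(2,1)] by simp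
qed simp

lemma tuple_inner_commute: "tuple_inner n F G = cnj (tuple_inner n G F)"
  unfolding tuple_inner_def cnj_sum by (intro sum.cong refl ell2_inner_commute)

lemma tuple_inner_self: "tuple_inner n F F = complex_of_real (\<Sum>i<n. (ell2_norm (F i))\<^sup>2)"
  by (simp add: tuple_inner_def ell2_inner_self)

context hilbert_rep
begin

definition tuples :: "nat \<Rightarrow> (nat \<Rightarrow> 'i \<Rightarrow> complex) set"
  where "tuples n = {F. \<forall>i<n. F i \<in> ell2 X}"

definition mat_apply :: "nat \<Rightarrow> (nat \<Rightarrow> nat \<Rightarrow> 'a) \<Rightarrow> (nat \<Rightarrow> 'i \<Rightarrow> complex) \<Rightarrow> nat \<Rightarrow> 'i \<Rightarrow> complex"
  where "mat_apply n M F i = (\<lambda>x. \<Sum>j<n. \<pi> (M i j) (F j) x)"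

text \<open>Positivity as a quadratic form, as opposed to the factorisation over the algebra
  demanded by \<open>matrix_positive\<close>. Membership in the nonnegative reals includes that the
  form is real.\<close>

definition op_positive :: "nat \<Rightarrow> (nat \<Rightarrow> nat \<Rightarrow> 'a) \<Rightarrow> bool"
  where "op_positive n M \<longleftrightarrow> (\<forall>F\<in>tuples n. (\<Sum>i<n. \<Sum>j<n. ell2_inner (F i) (\<pi> (M i j) (F j))) \<in> \<real>\<^sub>\<ge>\<^sub>0)"

lemma mat_apply_ell2: "F \<in> tuples n \<Longrightarrow> mat_apply n M F i \<in> ell2 X"
  unfolding mat_apply_def by (rule ell2_sum) (simp add: tuples_def)

lemma mat_apply_tuples: "F \<in> tuples n \<Longrightarrow> mat_apply n M F \<in> tuples n"
  by (simp add: tuples_def mat_apply_ell2)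

lemma inner_mat_apply:
  assumes "F \<in> tuples n" "G \<in> tuples n"
  shows "tuple_inner n F (mat_apply n M G) = (\<Sum>i<n. \<Sum>j<n. ell2_inner (F i) (\<pi> (M i j) (G j)))"
  unfolding tuple_inner_def mat_apply_def
  by (intro sum.cong refl ell2_inner_sum_right[of _ _ X]) (use assms in \<open>auto simp: tuples_def\<close>)

lemma op_positiveD: "op_positive n M \<Longrightarrow> F \<in> tuples n \<Longrightarrow> tuple_inner n F (mat_apply n M F) \<in> \<real>\<^sub>\<ge>\<^sub>0"
  by (simp add: op_positive_def inner_mat_apply)

lemma mat_apply_mult:
  assumes "F \<in> tuples n"
  shows "mat_apply n (mat_mult n M N) F = mat_apply n M (mat_apply n N F)"
proof (intro ext)
  fix i x
  have "mat_apply n (mat_mult n M N) F i x = (\<Sum>j<n. \<Sum>k<n. \<pi> (M i k) (\<pi> (N k j) (F j)) x)"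
    using assms by (simp add: mat_apply_def mat_mult_def rep_sum rep_mult tuples_def)
  also have "\<dots> = (\<Sum>k<n. \<Sum>j<n. \<pi> (M i k) (\<pi> (N k j) (F j)) x)" by (rule sum.swap)
  also have "\<dots> = mat_apply n M (mat_apply n N F) i x"
  proof -
    have "\<pi> (M i k) (mat_apply n N F k) = (\<lambda>x. \<Sum>j<n. \<pi> (M i k) (\<pi> (N k j) (F j)) x)" for k
      unfolding mat_apply_def by (rule rep_sum_vec) (use assms in \<open>simp add: tuples_def\<close>)
    then show ?thesis by (simp add: mat_apply_def[of n M])
  qed
  finally show "mat_apply n (mat_mult n M N) F i x = mat_apply n M (mat_apply n N F) i x" .
qed

lemma tuple_inner_add_right:
  "F \<in> tuples n \<Longrightarrow> G \<in> tuples n \<Longrightarrow> H \<in> tuples n \<Longrightarrow>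
    tuple_inner n F (\<lambda>i x. G i x + H i x) = tuple_inner n F G + tuple_inner n F H"
  by (simp add: tuple_inner_def tuples_def ell2_inner_add_right[of _ X] sum.distrib)

lemma tuple_inner_add_left:
  "F \<in> tuples n \<Longrightarrow> G \<in> tuples n \<Longrightarrow> H \<in> tuples n \<Longrightarrow>
    tuple_inner n (\<lambda>i x. F i x + G i x) H = tuple_inner n F H + tuple_inner n G H"
  by (simp add: tuple_inner_def tuples_def ell2_inner_add_left[of _ X] sum.distrib)

lemma mat_apply_add_vec:
  "F \<in> tuples n \<Longrightarrow> G \<in> tuples n \<Longrightarrow>
    mat_apply n M (\<lambda>i x. F i x + G i x) = (\<lambda>i x. mat_apply n M F i x + mat_apply n M G i x)"
  by (simp add: mat_apply_def tuples_def rep_add_vec sum.distrib fun_eq_iff)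

lemma tuples_add: "F \<in> tuples n \<Longrightarrow> G \<in> tuples n \<Longrightarrow> (\<lambda>i x. F i x + G i x) \<in> tuples n"
  by (simp add: tuples_def ell2_add)

lemma tuples_scale: "F \<in> tuples n \<Longrightarrow> (\<lambda>i x. c * F i x) \<in> tuples n"
  by (simp add: tuples_def ell2_scale)

lemma mat_apply_scale_vec:
  "F \<in> tuples n \<Longrightarrow> mat_apply n M (\<lambda>i x. c * F i x) = (\<lambda>i x. c * mat_apply n M F i x)"
  by (simp add: mat_apply_def tuples_def rep_scale_vec sum_distrib_left fun_eq_iff)

text \<open>Polarisation: a form that is real on \<open>F\<close>, on \<open>G\<close>, on their sum
  and on \<open>F\<close> plus \<open>\<i>\<close> times \<open>G\<close> is Hermitian on the
  pair.\<close>

lemma op_positive_adjoint: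
  assumes M: "op_positive n M" and FG: "F \<in> tuples n" "G \<in> tuples n"
  shows "tuple_inner n F (mat_apply n M G) = tuple_inner n (mat_apply n M F) G"
proof -
  define B where "B F G = tuple_inner n F (mat_apply n M G)" for F G
  have real: "Im (B F F) = 0" if "F \<in> tuples n" for F
    using op_positiveD[OF M that] by (simp add: B_def complex_nonneg_Reals_iff)
  have B_add: "B (\<lambda>i x. F i x + H i x) (\<lambda>i x. F i x + H i x) = B F F + B F H + (B H F + B H H)"
    if "H \<in> tuples n" for H
    using that FG(1) by (simp add: B_def mat_apply_add_vec tuple_inner_add_right tuple_inner_add_left
        tuples_add mat_apply_tuples)
  have B_scale: "B F (\<lambda>i x. \<i> * G i x) = \<i> * B F G" "B (\<lambda>i x. \<i> * G i x) F = - \<i> * B G F"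
    using FG by (simp_all add: B_def mat_apply_scale_vec tuple_inner_def ell2_inner_scale_left
        ell2_inner_scale_right sum_distrib_left)
  have "Im (B F G + B G F) = 0"
    using B_add[OF FG(2)] real[OF FG(1)] real[OF FG(2)] real[OF tuples_add[OF FG]] by simp
  moreover have "Im (\<i> * B F G - \<i> * B G F) = 0"
    using B_add[OF tuples_scale[OF FG(2)], of \<i>] real[OF FG(1)] real[OF tuples_scale[OF FG(2), of \<i>]]
      real[OF tuples_add[OF FG(1) tuples_scale[OF FG(2), of \<i>]]] by (simp add: B_scale)
  ultimately have "B F G = cnj (B G F)" by (simp add: complex_eq_iff)
  then show ?thesis unfolding B_def using tuple_inner_commute[of n G "mat_apply n M F"] tuple_inner_commute by metis
qed

end

context isometric_rep
begin

text \<open>Symmetry of the form, tested on tuples with a single basis vector in one slot, gives the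
  matrix coefficients of each entry; an isometric representation lets the conclusion return to the
  algebra.\<close>

lemma op_positive_hermitian:
  assumes M: "op_positive n M" and ij: "i < n" "j < n"
  shows "star (M i j) = M j i"
proof (rule rep_eqI_delta)
  define E where "E k x = (\<lambda>l. if l = k then ell2_delta x else (\<lambda>_. 0))" for k :: nat and x :: 'i
  have E: "E k x \<in> tuples n" if "x \<in> X" for k x
    using that by (simp add: tuples_def E_def ell2_zero ell2_delta)
  have entry: "tuple_inner n (E k x) (mat_apply n M (E l y)) = \<pi> (M k l) (ell2_delta y) x"
    if "k < n" "l < n" "x \<in> X" "y \<in> X" for k l x y
  proof -
    have app: "mat_apply n M (E l y) k = \<pi> (M k l) (ell2_delta y)" for k
      unfolding mat_apply_def E_def using that(2)
      by (simp add: if_distrib[of "\<pi> _"] if_distribR rep_zero_vec cong: if_cong)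
    have "tuple_inner n (E k x) (mat_apply n M (E l y)) =
        (\<Sum>i<n. if i = k then ell2_inner (ell2_delta x) (\<pi> (M i l) (ell2_delta y)) else 0)"
      unfolding tuple_inner_def app by (intro sum.cong) (auto simp: E_def)
    then show ?thesis using that(1) by (simp add: ell2_inner_delta)
  qed
  fix y assume y: "y \<in> X"
  show "\<pi> (star (M i j)) (ell2_delta y) = \<pi> (M j i) (ell2_delta y)"
  proof (rule ell2_eqI[of _ X])
    fix x assume x: "x \<in> X"
    have "\<pi> (M j i) (ell2_delta y) x = cnj (\<pi> (M i j) (ell2_delta x) y)"
      using op_positive_adjoint[OF M E[OF x, of j] E[OF y, of i]]
        tuple_inner_commute[of n "mat_apply n M (E j x)" "E i y"]
      by (simp add: entry ij x y)
    also have "\<dots> = \<pi> (star (M i j)) (ell2_delta y) x"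
      using rep_adjoint'[of "ell2_delta x" "ell2_delta y" "M i j"] x y
      by (simp add: ell2_inner_delta ell2_delta_inner ell2_delta)
    finally show "\<pi> (star (M i j)) (ell2_delta y) x = \<pi> (M j i) (ell2_delta y) x" by simp
  qed (simp_all add: ell2_delta y)
qed

text \<open>
  With \<open>Q = 1 - P\<close> and \<open>p = P F\<close>, \<open>q = Q F\<close> one has \<open>\<langle>p, q\<rangle> = \<langle>p, Q p\<rangle> + \<langle>q, P q\<rangle> \<ge> 0\<close>, whence
  \<open>\<parallel>p\<parallel>\<^sup>2 \<le> \<parallel>p + q\<parallel>\<^sup>2\<close>.
\<close>

lemma op_positive_contraction:
  assumes P: "op_positive n P" and Q: "op_positive n (\<lambda>i j. (if i = j then 1 else 0) - P i j)"
    and F: "F \<in> tuples n"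
  shows "Re (tuple_inner n (mat_apply n P F) (mat_apply n P F)) \<le> Re (tuple_inner n F F)"
proof -
  define Q' where "Q' = (\<lambda>i j. (if i = j then 1 else 0) - P i j)"
  have split: "G i = (\<lambda>x. mat_apply n P G i x + mat_apply n Q' G i x)" if "G \<in> tuples n" "i < n" for G i
  proof
    fix x
    have "mat_apply n P G i x + mat_apply n Q' G i x = (\<Sum>j<n. \<pi> (if i = j then 1 else 0) (G j) x)"
      using that by (simp add: mat_apply_def Q'_def rep_diff tuples_def sum.distrib[symmetric])
    also have "\<dots> = (\<Sum>j<n. if i = j then G j x else 0)"
      using that by (intro sum.cong) (auto simp: rep_one rep_zero tuples_def)
    finally show "G i x = mat_apply n P G i x + mat_apply n Q' G i x" using that(2) by simp
  qed
  define p q where "p = mat_apply n P F" and "q = mat_apply n Q' F"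
  have pq: "p \<in> tuples n" "q \<in> tuples n" using F by (simp_all add: p_def q_def mat_apply_tuples)
  \<comment> \<open>Tuples are total functions with arbitrary values from \<open>n\<close> on.
    Equations between them hold below \<open>n\<close> only and must be used through
    congruence.\<close>
  have cong: "tuple_inner n G H = tuple_inner n G' H'"
    if "\<And>i. i < n \<Longrightarrow> G i = G' i" "\<And>i. i < n \<Longrightarrow> H i = H' i" for G H G' H'
    using that by (simp add: tuple_inner_def)
  have acong: "mat_apply n M G = mat_apply n M G'" if "\<And>i. i < n \<Longrightarrow> G i = G' i" for M G G'
    unfolding mat_apply_def by (intro ext sum.cong) (simp_all add: that)
  have F_eq: "F i = (\<lambda>x. p i x + q i x)" if "i < n" for i using split[OF F that] by (simp add: p_def q_def)
  \<comment> \<open>Commutation of \<open>P\<close> with \<open>Q'\<close> on \<open>F\<close>: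
    decomposing \<open>p\<close> gives \<open>P p + Q' p\<close>, while applying \<open>P\<close> to
    \<open>p + q\<close> gives \<open>P p + P q\<close>, and both are \<open>p\<close>.\<close>
  have Qp: "mat_apply n Q' p i = mat_apply n P q i" if "i < n" for i
  proof -
    have 1: "p i x = mat_apply n P p i x + mat_apply n Q' p i x" for x
      using fun_cong[OF split[OF pq(1) that]] .
    have "p = mat_apply n P (\<lambda>i x. p i x + q i x)"
      using acong[of F "\<lambda>i x. p i x + q i x" P] F_eq by (simp add: p_def)
    then have "p = (\<lambda>i x. mat_apply n P p i x + mat_apply n P q i x)"
      using mat_apply_add_vec[OF pq, of P] by (rule trans)
    from fun_cong[OF fun_cong[OF this]] have "mat_apply n P p i x + mat_apply n Q' p i x = mat_apply n P p i x + mat_apply n P q i x" for x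
      by (rule trans[OF sym[OF 1]])
    then show ?thesis by (simp add: fun_eq_iff)
  qed
  have Q': "op_positive n Q'" using Q by (simp add: Q'_def)
  have "q = mat_apply n Q' (\<lambda>i x. p i x + q i x)"
    using acong[of F "\<lambda>i x. p i x + q i x" Q'] F_eq by (simp add: q_def)
  then have "q = (\<lambda>i x. mat_apply n Q' p i x + mat_apply n Q' q i x)"
    using mat_apply_add_vec[OF pq, of Q'] by (rule trans)
  from arg_cong[OF this, of "tuple_inner n p"]
  have "tuple_inner n p q = tuple_inner n p (mat_apply n Q' p) + tuple_inner n p (mat_apply n Q' q)"
    using tuple_inner_add_right[OF pq(1) mat_apply_tuples[OF pq(1)] mat_apply_tuples[OF pq(2)]] by (rule trans)
  also have "tuple_inner n p (mat_apply n Q' q) = tuple_inner n (mat_apply n P q) q"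
    using op_positive_adjoint[OF Q' pq] cong[of "mat_apply n Q' p" "mat_apply n P q" q q] Qp by simp
  also have "\<dots> = tuple_inner n q (mat_apply n P q)"
    using op_positive_adjoint[OF P pq(2,2)] by simp
  finally have "Re (tuple_inner n p q) \<ge> 0"
    using op_positiveD[OF Q' pq(1)] op_positiveD[OF P pq(2)] by (simp add: complex_nonneg_Reals_iff)
  moreover have "tuple_inner n F F = tuple_inner n p p + tuple_inner n p q + (tuple_inner n q p + tuple_inner n q q)"
    using cong[of F "\<lambda>i x. p i x + q i x" F "\<lambda>i x. p i x + q i x"] F_eq pq
    by (simp add: tuple_inner_add_right tuple_inner_add_left tuples_add)
  moreover have "Re (tuple_inner n q p) = Re (tuple_inner n p q)"
    using tuple_inner_commute[of n q p] by simp
  moreover have "Re (tuple_inner n q q) \<ge> 0" by (simp add: tuple_inner_self sum_nonneg)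
  ultimately show ?thesis by (simp add: p_def)
qed

text \<open>No norm on matrices is introduced. A vector is placed in slot \<open>j\<close>,
  contracted \<open>k\<close> times by \<open>P\<close>, and the entry is read off in slot
  \<open>i\<close>.\<close>

lemma norm_mat_pow_le:
  assumes P: "op_positive n P" and Q: "op_positive n (\<lambda>i j. (if i = j then 1 else 0) - P i j)"
    and ij: "i < n" "j < n"
  shows "norm (mat_pow n P k i j) \<le> 1"
proof (rule norm_leI)
  fix f assume f: "f \<in> ell2 X" "ell2_norm f \<le> 1"
  define F where "F = (\<lambda>l. if l = j then f else (\<lambda>_. 0))"
  have F: "F \<in> tuples n" using f by (simp add: tuples_def F_def ell2_zero)
  have bound: "Re (tuple_inner n (mat_apply n (mat_pow n P k) F) (mat_apply n (mat_pow n P k) F)) \<le> Re (tuple_inner n F F)"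
  proof (induction k)
    case 0
    have "mat_apply n (mat_pow n P 0) F l = F l" if "l < n" for l
    proof
      fix x
      have "mat_apply n (mat_pow n P 0) F l x = (\<Sum>m<n. if l = m then F m x else 0)"
        unfolding mat_apply_def using F by (intro sum.cong) (auto simp: rep_one rep_zero tuples_def)
      then show "mat_apply n (mat_pow n P 0) F l x = F l x" using that by simp
    qed
    then show ?case by (simp add: tuple_inner_def)
  next
    case (Suc k)
    then show ?case
      using op_positive_contraction[OF P Q mat_apply_tuples[OF F, of "mat_pow n P k"]]
      by (simp add: mat_apply_mult[OF F])
  qed
  have "(ell2_norm (mat_apply n (mat_pow n P k) F i))\<^sup>2 \<le> (\<Sum>l<n. (ell2_norm (mat_apply n (mat_pow n P k) F l))\<^sup>2)"
    by (rule member_le_sum) (use ij in auto)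
  also have "\<dots> \<le> (\<Sum>l<n. (ell2_norm (F l))\<^sup>2)" using bound by (simp add: tuple_inner_self)
  also have "\<dots> = (\<Sum>l<n. if l = j then (ell2_norm f)\<^sup>2 else 0)" by (intro sum.cong) (auto simp: F_def)
  also have "\<dots> \<le> 1\<^sup>2" using ij f(2) by (simp add: power_le_one)
  finally have "ell2_norm (mat_apply n (mat_pow n P k) F i) \<le> 1" by (rule power2_le_imp_le) simp
  moreover have "mat_apply n (mat_pow n P k) F i = \<pi> (mat_pow n P k i j) f"
    unfolding mat_apply_def F_def using ij
    by (simp add: if_distrib[of "\<pi> _"] if_distribR rep_zero_vec cong: if_cong)
  ultimately show "ell2_norm (\<pi> (mat_pow n P k i j) f) \<le> 1" by simp
qed simp

end

subsection \<open>Square roots by the binomial series\<close>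

text \<open>The Taylor coefficients of the square root of \<open>1 - x\<close> at 0.\<close>

definition sqrt_coeff :: "nat \<Rightarrow> real"
  where "sqrt_coeff k = (- 1) ^ k * ((1 / 2) gchoose k)"

lemma sqrt_coeff_0: "sqrt_coeff 0 = 1"
  by (simp add: sqrt_coeff_def)

lemma sqrt_coeff_Suc: "(real k + 1) * sqrt_coeff (Suc k) = (real k - 1 / 2) * sqrt_coeff k"
proof -
  have "(real k + 1) * ((1 / 2) gchoose Suc k) = (1 / 2 - real k) * ((1 / 2) gchoose k)"
    using gbinomial_mult_1[of "1 / 2 :: real" k] by (simp add: algebra_simps)
  then have "- ((- 1) ^ k) * ((real k + 1) * ((1 / 2) gchoose Suc k)) =
      - ((- 1) ^ k) * ((1 / 2 - real k) * ((1 / 2) gchoose k))" by simp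
  then show ?thesis by (simp add: sqrt_coeff_def algebra_simps)
qed

lemma sqrt_coeff_nonpos: "sqrt_coeff (Suc k) \<le> 0"
proof (induction k)
  case 0
  then show ?case using sqrt_coeff_Suc[of 0] by (simp add: sqrt_coeff_0)
next
  case (Suc k)
  have "(real (Suc k) + 1) * sqrt_coeff (Suc (Suc k)) \<le> 0"
    unfolding sqrt_coeff_Suc using Suc by (intro mult_nonneg_nonpos) auto
  then show ?case by (simp add: mult_le_0_iff)
qed

text \<open>Partial sums of the series at \<open>x = 1\<close>. As all coefficients after the zeroth
  are nonpositive, the closed form shows that these sums are nonnegative.\<close>

lemma sum_sqrt_coeff: "(\<Sum>k\<le>n. sqrt_coeff k) = - 2 * (real n + 1) * sqrt_coeff (Suc n)"
proof (induction n)
  case 0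
  then show ?case using sqrt_coeff_Suc[of 0] by (simp add: sqrt_coeff_0)
next
  case (Suc n)
  then show ?case using sqrt_coeff_Suc[of "Suc n"] by (simp add: algebra_simps)
qed

text \<open>The powers of the matrix will be bounded by 1 without decaying, so absolute convergence
  is needed on the boundary of the disc. The signs turn the sum of absolute values into 2 minus a
  nonnegative partial sum.\<close>

lemma summable_abs_sqrt_coeff: "summable (\<lambda>k. \<bar>sqrt_coeff k\<bar>)"
proof (rule summableI_nonneg_bounded)
  fix n
  have "(\<Sum>k<n. \<bar>sqrt_coeff k\<bar>) \<le> (\<Sum>k\<le>n. \<bar>sqrt_coeff k\<bar>)" by (intro sum_mono2) auto
  also have "\<dots> = 2 - (\<Sum>k\<le>n. sqrt_coeff k)"
  proof (induction n)
    case (Suc n)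
    then show ?case using sqrt_coeff_nonpos[of n] by simp
  qed (simp add: sqrt_coeff_0)
  also have "\<dots> \<le> 2"
    unfolding sum_sqrt_coeff
    using mult_nonneg_nonpos[OF _ sqrt_coeff_nonpos[of n], of "2 * (real n + 1)"] by (simp add: algebra_simps)
  finally show "(\<Sum>k<n. \<bar>sqrt_coeff k\<bar>) \<le> 2" .
qed simp

text \<open>The square of the series is \<open>1 - x\<close>: by Vandermonde, two binomials with
  upper index 1/2 convolve to one with upper index 1.\<close>

lemma sqrt_coeff_convolution:
  "(\<Sum>m\<le>k. sqrt_coeff m * sqrt_coeff (k - m)) = (if k = 0 then 1 else if k = 1 then - 1 else 0)"
proof -
  have "(\<Sum>m\<le>k. sqrt_coeff m * sqrt_coeff (k - m)) =
      (\<Sum>m\<le>k. (- 1) ^ k * (((1 / 2) gchoose m) * ((1 / 2) gchoose (k - m))))"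
    by (intro sum.cong) (auto simp: sqrt_coeff_def power_add[symmetric])
  also have "\<dots> = (- 1) ^ k * ((1 / 2 + 1 / 2) gchoose k :: real)"
    unfolding sum_distrib_left[symmetric] atMost_atLeast0 gbinomial_Vandermonde ..
  also have "(1 / 2 + 1 / 2 :: real) gchoose k = real (1 choose k)"
    using binomial_gbinomial[of 1 k, where 'a = real] by simp
  finally show ?thesis by (auto simp: le_Suc_eq not_le binomial_eq_0)
qed

text \<open>The binomial series in \<open>P = 1 - M\<close>, summed entry by entry in the algebra;
  its square is \<open>1 - P\<close>, which is \<open>M\<close> again.\<close>

lemma (in isometric_rep) op_positive_sqrt:
  assumes M: "op_positive n M" and bound: "op_positive n (\<lambda>i j. (if i = j then 1 else 0) - M i j)"
  shows "\<exists>S. (\<forall>i<n. \<forall>j<n. star (S i j) = S j i \<and> mat_mult n S S i j = M i j)"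
proof -
  define P where "P = (\<lambda>i j. (if i = j then 1 else 0) - M i j)"
  have P: "op_positive n P" "op_positive n (\<lambda>i j. (if i = j then 1 else 0) - P i j)"
    using assms by (simp_all add: P_def)
  have herm: "star (mat_pow n P k i j) = mat_pow n P k j i" if "i < n" "j < n" for k i j
    using star_mat_pow[OF op_positive_hermitian[OF P(1)] that] .
  define s where "s i j k = sqrt_coeff k *\<^sub>R mat_pow n P k i j" for i j k
  have summ: "summable (\<lambda>k. norm (s i j k))" if "i < n" "j < n" for i j
  proof (rule summable_comparison_test_ev[OF _ summable_abs_sqrt_coeff], rule always_eventually, rule allI)
    fix k
    show "norm (norm (s i j k)) \<le> \<bar>sqrt_coeff k\<bar>"
      using norm_mat_pow_le[OF P that, of k] by (simp add: s_def mult_left_le)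
  qed
  define S where "S i j = (\<Sum>k. s i j k)" for i j
  show ?thesis
  proof (intro exI allI impI conjI)
    fix i j assume ij: "i < n" "j < n"
    have "star (S i j) = (\<Sum>k. star (s i j k))"
      unfolding S_def
      using bounded_linear.suminf[OF bounded_linear_star summable_norm_cancel[OF summ[OF ij]]] by simp
    also have "\<dots> = S j i"
      unfolding S_def s_def using herm[OF ij]
      by (simp add: linear_cmul bounded_linear.linear[OF bounded_linear_star] linear_simps)
    finally show "star (S i j) = S j i" .
    \<comment> \<open>Each product of two entries is a Cauchy product; only the summation over
      \<open>l\<close> assembles the products of powers of \<open>P\<close>.\<close>
    have "(\<lambda>k. \<Sum>l<n. \<Sum>m\<le>k. s i l m * s l j (k - m)) sums (\<Sum>l<n. S i l * S l j)"
      unfolding S_def by (intro sums_sum Cauchy_product_sums summ) (use ij in auto)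
    moreover have "(\<Sum>l<n. \<Sum>m\<le>k. s i l m * s l j (k - m)) =
        (if k = 0 then 1 else if k = 1 then - 1 else 0) *\<^sub>R mat_pow n P k i j" for k
    proof -
      have "(\<Sum>l<n. \<Sum>m\<le>k. s i l m * s l j (k - m)) =
          (\<Sum>m\<le>k. \<Sum>l<n. s i l m * s l j (k - m))" by (rule sum.swap)
      also have "\<dots> = (\<Sum>m\<le>k. (sqrt_coeff m * sqrt_coeff (k - m)) *\<^sub>R
          mat_mult n (mat_pow n P m) (mat_pow n P (k - m)) i j)"
        by (simp add: s_def mat_mult_def scaleR_sum_right mult.commute)
      also have "\<dots> = (\<Sum>m\<le>k. (sqrt_coeff m * sqrt_coeff (k - m)) *\<^sub>R mat_pow n P k i j)"
        using ij by (intro sum.cong) (auto simp: mat_pow_add)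
      finally show ?thesis by (simp add: scaleR_sum_left[symmetric] sqrt_coeff_convolution)
    qed
    ultimately have "(\<lambda>k. (if k = 0 then 1 else if k = 1 then - 1 else 0) *\<^sub>R mat_pow n P k i j)
        sums (\<Sum>l<n. S i l * S l j)" by simp
    moreover have "(\<lambda>k. (if k = 0 then 1 else if k = 1 then - 1 else 0) *\<^sub>R mat_pow n P k i j)
        sums (\<Sum>k\<in>{0, 1}. (if k = 0 then 1 else if k = 1 then - 1 else 0) *\<^sub>R mat_pow n P k i j)"
      by (rule sums_finite) auto
    ultimately have "(\<Sum>l<n. S i l * S l j) = (if i = j then 1 else 0) - mat_pow n P (Suc 0) i j"
      using sums_unique2 by fastforce
    also have "\<dots> = M i j" using mat_pow_one[OF ij(2), of P i] by (simp add: P_def del: mat_pow.simps)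
    finally show "mat_mult n S S i j = M i j" by (simp add: mat_mult_def)
  qed
qed

context isometric_rep
begin

text \<open>A crude bound by the sum of the entry norms; any constant will do, as it serves only to
  scale a matrix below the identity.\<close>

lemma norm_form_le:
  assumes F: "F \<in> tuples n"
  shows "cmod (tuple_inner n F (mat_apply n M F)) \<le>
    (\<Sum>i<n. \<Sum>j<n. norm (M i j)) * Re (tuple_inner n F F)"
proof -
  define N where "N = (\<Sum>i<n. (ell2_norm (F i))\<^sup>2)"
  have N: "(ell2_norm (F i))\<^sup>2 \<le> N" if "i < n" for i
    unfolding N_def by (rule member_le_sum) (use that in auto)
  have "cmod (ell2_inner (F i) (\<pi> (M i j) (F j))) \<le> norm (M i j) * N" if "i < n" "j < n" for i j
  proof -
    have Fij: "F i \<in> ell2 X" "F j \<in> ell2 X" using F that by (auto simp: tuples_def)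
    have "cmod (ell2_inner (F i) (\<pi> (M i j) (F j))) \<le> ell2_norm (F i) * ell2_norm (\<pi> (M i j) (F j))"
      using Fij by (intro ell2_cauchy_schwarz[of _ X]) auto
    also have "\<dots> \<le> ell2_norm (F i) * (norm (M i j) * ell2_norm (F j))"
      using Fij by (intro mult_left_mono rep_norm_le) auto
    also have "\<dots> = norm (M i j) * (ell2_norm (F i) * ell2_norm (F j))" by simp
    also have "\<dots> \<le> norm (M i j) * N"
    proof (rule mult_left_mono)
      show "ell2_norm (F i) * ell2_norm (F j) \<le> N"
        using N[OF that(1)] N[OF that(2)] sum_squares_bound[of "ell2_norm (F i)" "ell2_norm (F j)"]
        by linarith
    qed simp
    finally show ?thesis .
  qed
  then have "cmod (\<Sum>i<n. \<Sum>j<n. ell2_inner (F i) (\<pi> (M i j) (F j))) \<le> (\<Sum>i<n. \<Sum>j<n. norm (M i j) * N)"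
    by (intro sum_norm_le) auto
  then show ?thesis
    by (simp add: inner_mat_apply F tuple_inner_self N_def sum_distrib_right)
qed

text \<open>Scaled by \<open>1 / c\<close> the matrix lies between 0 and the identity, so it has a
  Hermitian square root \<open>S\<close> with entries in the algebra itself; \<open>S\<close> times
  the root of \<open>c\<close> is the factor sought.\<close>

lemma op_positive_imp_matrix_positive:
  assumes M: "op_positive n M"
  shows "matrix_positive n M"
proof -
  \<comment> \<open>The summand 1 keeps \<open>c\<close> positive when all entries vanish.\<close>
  define c where "c = 1 + (\<Sum>i<n. \<Sum>j<n. norm (M i j))"
  have c: "c > 0" unfolding c_def by (intro add_pos_nonneg sum_nonneg) auto
  define Q where "Q = (\<lambda>i j. complex_of_real (1 / c) *\<^sub>C M i j)"
  have apply_Q: "tuple_inner n F (mat_apply n Q F) = complex_of_real (1 / c) * tuple_inner n F (mat_apply n M F)"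
    if "F \<in> tuples n" for F
  proof -
    have "tuple_inner n F (mat_apply n (\<lambda>i j. d *\<^sub>C M i j) F) = d * tuple_inner n F (mat_apply n M F)" for d
      using that by (simp add: inner_mat_apply rep_scaleC tuples_def ell2_inner_scale_right sum_distrib_left)
    then show ?thesis by (simp add: Q_def)
  qed
  have "op_positive n Q"
    unfolding op_positive_def
  proof
    fix F assume F: "F \<in> tuples n"
    show "(\<Sum>i<n. \<Sum>j<n. ell2_inner (F i) (\<pi> (Q i j) (F j))) \<in> \<real>\<^sub>\<ge>\<^sub>0"
      using apply_Q[OF F] op_positiveD[OF M F] c
      by (simp add: inner_mat_apply[OF F F, symmetric] complex_nonneg_Reals_iff)
  qed
  moreover have "op_positive n (\<lambda>i j. (if i = j then 1 else 0) - Q i j)"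
    unfolding op_positive_def
  proof
    fix F assume F: "F \<in> tuples n"
    have "(\<Sum>i<n. \<Sum>j<n. ell2_inner (F i) (\<pi> ((if i = j then 1 else 0) - Q i j) (F j))) =
        (\<Sum>i<n. \<Sum>j<n. (if i = j then ell2_inner (F i) (F j) else 0) - ell2_inner (F i) (\<pi> (Q i j) (F j)))"
      using F by (intro sum.cong) (auto simp: rep_diff rep_one rep_zero tuples_def ell2_inner_diff_right[of _ X] ell2_zero)
    also have "\<dots> = tuple_inner n F F - tuple_inner n F (mat_apply n Q F)"
      by (simp add: sum_subtractf inner_mat_apply[OF F F]) (simp add: tuple_inner_def)
    finally have eq: "(\<Sum>i<n. \<Sum>j<n. ell2_inner (F i) (\<pi> ((if i = j then 1 else 0) - Q i j) (F j))) =
      tuple_inner n F F - complex_of_real (1 / c) * tuple_inner n F (mat_apply n M F)"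
      using apply_Q[OF F] by simp
    have "Re (tuple_inner n F (mat_apply n M F)) \<le> c * Re (tuple_inner n F F)"
    proof -
      have "Re (tuple_inner n F (mat_apply n M F)) \<le> (c - 1) * Re (tuple_inner n F F)"
        using order_trans[OF complex_Re_le_cmod norm_form_le[OF F, of M]] by (simp add: c_def)
      moreover have "Re (tuple_inner n F F) \<ge> 0" by (simp add: tuple_inner_self sum_nonneg)
      ultimately show ?thesis by (simp add: algebra_simps)
    qed
    then have "Re (tuple_inner n F (mat_apply n M F)) / c \<le> Re (tuple_inner n F F)"
      using c by (simp add: divide_le_eq mult.commute)
    moreover have "Im (tuple_inner n F (mat_apply n M F)) = 0" "Im (tuple_inner n F F) = 0"
      using op_positiveD[OF M F] by (simp_all add: complex_nonneg_Reals_iff tuple_inner_self)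
    ultimately show "(\<Sum>i<n. \<Sum>j<n. ell2_inner (F i) (\<pi> ((if i = j then 1 else 0) - Q i j) (F j))) \<in> \<real>\<^sub>\<ge>\<^sub>0"
      unfolding eq by (simp add: complex_nonneg_Reals_iff)
  qed
  ultimately obtain S where "\<forall>i<n. \<forall>j<n. star (S i j) = S j i \<and> mat_mult n S S i j = Q i j"
    using op_positive_sqrt[of n Q] by blast
  then have S: "\<And>i j. i < n \<Longrightarrow> j < n \<Longrightarrow> star (S i j) = S j i"
    "\<And>i j. i < n \<Longrightarrow> j < n \<Longrightarrow> mat_mult n S S i j = Q i j" by blast+
  show ?thesis
    unfolding matrix_positive_def
  proof (intro exI allI impI)
    fix i j assume ij: "i < n" "j < n"
    have "(\<Sum>k<n. star (complex_of_real (sqrt c) *\<^sub>C S k i) * complex_of_real (sqrt c) *\<^sub>C S k j) =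
        complex_of_real c *\<^sub>C mat_mult n S S i j"
      unfolding mat_mult_def scaleC_sum_right using S(1) ij c
      by (intro sum.cong)
        (auto simp: star_scaleC mult_scaleC_left mult_scaleC_right scaleC_scaleC simp flip: of_real_mult)
    also have "\<dots> = M i j"
      using S(2)[OF ij] c by (simp add: Q_def scaleC_scaleC flip: of_real_mult of_real_divide)
    finally show "M i j = (\<Sum>k<n. star (complex_of_real (sqrt c) *\<^sub>C S k i) * complex_of_real (sqrt c) *\<^sub>C S k j)" ..
  qed
qed

end

subsection \<open>Stability of operator positivity\<close>

lemma infsum_sum_finite:
  fixes f :: "'k \<Rightarrow> 'i \<Rightarrow> complex"
  assumes "finite I" "\<And>k. k \<in> I \<Longrightarrow> f k summable_on A"
  shows "(\<lambda>x. \<Sum>k\<in>I. f k x) summable_on A \<and> (\<Sum>\<^sub>\<infinity>x\<in>A. \<Sum>k\<in>I. f k x) = (\<Sum>k\<in>I. infsum (f k) A)"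
  using assms
proof (induction I rule: finite_induct)
  case (insert k I)
  then show ?case by (simp add: summable_on_add infsum_add)
qed simp

definition psd_on :: "'k set \<Rightarrow> ('k \<Rightarrow> 'k \<Rightarrow> complex) \<Rightarrow> bool"
  where "psd_on I G \<longleftrightarrow> (\<forall>c. (\<Sum>a\<in>I. \<Sum>b\<in>I. cnj (c a) * c b * G a b) \<in> \<real>\<^sub>\<ge>\<^sub>0)"

lemma nonneg_Reals_sum: "(\<And>k. k \<in> I \<Longrightarrow> f k \<in> \<real>\<^sub>\<ge>\<^sub>0) \<Longrightarrow> (\<Sum>k\<in>I. f k) \<in> (\<real>\<^sub>\<ge>\<^sub>0 :: complex set)"
  by (induction I rule: infinite_finite_induct) auto

text \<open>A Schur product argument: the coordinates of the vectors supply the coefficients \<open>c\<close>.\<close>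

lemma psd_on_inner:
  assumes "finite I" "psd_on I G" "\<And>a. a \<in> I \<Longrightarrow> v a \<in> ell2 X"
  shows "(\<Sum>a\<in>I. \<Sum>b\<in>I. G a b * ell2_inner (v a) (v b)) \<in> \<real>\<^sub>\<ge>\<^sub>0"
proof -
  have s: "(\<lambda>x. G a b * (cnj (v a x) * v b x)) summable_on UNIV" if "a \<in> I" "b \<in> I" for a b
    using that assms(3) by (intro summable_on_cmult_right ell2_inner_summable') auto
  have "(\<Sum>a\<in>I. \<Sum>b\<in>I. G a b * ell2_inner (v a) (v b)) =
      (\<Sum>p\<in>I \<times> I. \<Sum>\<^sub>\<infinity>x. G (fst p) (snd p) * (cnj (v (fst p) x) * v (snd p) x))"
    by (simp add: sum.cartesian_product case_prod_unfold ell2_inner_def infsum_cmult_right')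
  also have "\<dots> = (\<Sum>\<^sub>\<infinity>x. \<Sum>p\<in>I \<times> I. G (fst p) (snd p) * (cnj (v (fst p) x) * v (snd p) x))"
    using infsum_sum_finite[of "I \<times> I" "\<lambda>p x. G (fst p) (snd p) * (cnj (v (fst p) x) * v (snd p) x)" UNIV]
      assms(1) s by auto
  also have "\<dots> = (\<Sum>\<^sub>\<infinity>x. \<Sum>a\<in>I. \<Sum>b\<in>I. cnj (v a x) * v b x * G a b)"
    by (simp add: sum.cartesian_product case_prod_unfold mult_ac)
  also have "\<dots> \<in> \<real>\<^sub>\<ge>\<^sub>0"
  proof -
    have pos: "(\<Sum>a\<in>I. \<Sum>b\<in>I. cnj (v a x) * v b x * G a b) \<in> \<real>\<^sub>\<ge>\<^sub>0" for x
      using assms(2)[unfolded psd_on_def, THEN spec, of "\<lambda>a. v a x"] .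
    have nonneg: "z \<in> \<real>\<^sub>\<ge>\<^sub>0 \<longleftrightarrow> 0 \<le> z" for z :: complex
      by (auto simp: complex_nonneg_Reals_iff less_eq_complex_def)
    have "(\<lambda>x. \<Sum>a\<in>I. \<Sum>b\<in>I. cnj (v a x) * v b x * G a b) summable_on UNIV"
      using infsum_sum_finite[of "I \<times> I" "\<lambda>p x. G (fst p) (snd p) * (cnj (v (fst p) x) * v (snd p) x)" UNIV]
        assms(1) s by (auto simp: sum.cartesian_product case_prod_unfold mult_ac)
    then show ?thesis
      using infsum_nonneg_complex pos unfolding nonneg by blast
  qed
  finally show ?thesis .
qed

context isometric_rep
begin

lemma matrix_positive_inner:
  assumes M: "\<forall>i<n. \<forall>j<n. M i j = (\<Sum>k<n. star (Y k i) * Y k j)"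
    and "i < n" "j < n" "f \<in> ell2 X" "g \<in> ell2 X"
  shows "ell2_inner f (\<pi> (M i j) g) = (\<Sum>k<n. ell2_inner (\<pi> (Y k i) f) (\<pi> (Y k j) g))"
  using assms by (simp add: rep_sum ell2_inner_sum_right[of _ _ X] rep_mult rep_adjoint star_star)

text \<open>Factoring \<open>M\<close> splits the sum into one Schur product per \<open>k\<close>,
  with \<open>v a\<close> moved by \<open>Y k (\<nu> a)\<close>. Several indices may share a matrix
  row, which \<open>\<nu>\<close> records.\<close>

lemma op_positive_schur:
  assumes M: "op_positive n M" and I: "finite I" "\<nu> ` I \<subseteq> {..<n}" and G: "psd_on I G"
    and v: "\<And>a. a \<in> I \<Longrightarrow> v a \<in> ell2 X"
  shows "(\<Sum>a\<in>I. \<Sum>b\<in>I. G a b * ell2_inner (v a) (\<pi> (M (\<nu> a) (\<nu> b)) (v b))) \<in> \<real>\<^sub>\<ge>\<^sub>0"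
proof -
  obtain Y where Y: "\<forall>i<n. \<forall>j<n. M i j = (\<Sum>k<n. star (Y k i) * Y k j)"
    using op_positive_imp_matrix_positive[OF M] unfolding matrix_positive_def by blast
  have "(\<Sum>a\<in>I. \<Sum>b\<in>I. G a b * ell2_inner (v a) (\<pi> (M (\<nu> a) (\<nu> b)) (v b))) =
      (\<Sum>a\<in>I. \<Sum>b\<in>I. \<Sum>k<n. G a b * ell2_inner (\<pi> (Y k (\<nu> a)) (v a)) (\<pi> (Y k (\<nu> b)) (v b)))"
    using I(2) v by (intro sum.cong refl) (auto simp: matrix_positive_inner[OF Y] image_subset_iff sum_distrib_left)
  also have "\<dots> = (\<Sum>k<n. \<Sum>a\<in>I. \<Sum>b\<in>I. G a b * ell2_inner (\<pi> (Y k (\<nu> a)) (v a)) (\<pi> (Y k (\<nu> b)) (v b)))"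
    by (simp add: sum.swap[of _ "{..<n}" I])
  also have "\<dots> \<in> \<real>\<^sub>\<ge>\<^sub>0"
    by (rule nonneg_Reals_sum, rule psd_on_inner[OF I(1) G, where X = X]) (use v in auto)
  finally show ?thesis .
qed

lemma matrix_positive_imp_op_positive:
  assumes "matrix_positive n M"
  shows "op_positive n M"
  unfolding op_positive_def
proof
  fix F assume F: "F \<in> tuples n"
  obtain Y where Y: "\<forall>i<n. \<forall>j<n. M i j = (\<Sum>k<n. star (Y k i) * Y k j)"
    using assms unfolding matrix_positive_def by blast
  define w where "w k = (\<lambda>x. \<Sum>j<n. \<pi> (Y k j) (F j) x)" for k
  have F': "F i \<in> ell2 X" if "i < n" for i using F that by (simp add: tuples_def)
  have w: "w k \<in> ell2 X" for k unfolding w_def by (rule ell2_sum) (use F' in auto)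
  have inner_w: "ell2_inner (w k) (w k) = (\<Sum>i<n. \<Sum>j<n. ell2_inner (\<pi> (Y k i) (F i)) (\<pi> (Y k j) (F j)))" for k
  proof -
    have "ell2_inner (w k) (w k) = (\<Sum>i<n. ell2_inner (\<pi> (Y k i) (F i)) (w k))"
      by (subst (1) w_def) (intro ell2_inner_sum_left[of _ _ X], use F' w in auto)
    also have "\<dots> = (\<Sum>i<n. \<Sum>j<n. ell2_inner (\<pi> (Y k i) (F i)) (\<pi> (Y k j) (F j)))"
      unfolding w_def by (intro sum.cong refl ell2_inner_sum_right[of _ _ X]) (use F' in auto)
    finally show ?thesis .
  qed
  have "(\<Sum>i<n. \<Sum>j<n. ell2_inner (F i) (\<pi> (M i j) (F j))) =
      (\<Sum>i<n. \<Sum>j<n. \<Sum>k<n. ell2_inner (\<pi> (Y k i) (F i)) (\<pi> (Y k j) (F j)))"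
    using F' by (intro sum.cong refl) (auto intro!: matrix_positive_inner[OF Y])
  also have "\<dots> = (\<Sum>k<n. \<Sum>i<n. \<Sum>j<n. ell2_inner (\<pi> (Y k i) (F i)) (\<pi> (Y k j) (F j)))"
  proof -
    have "(\<Sum>i<n. \<Sum>j<n. \<Sum>k<n. g i j k) = (\<Sum>k<n. \<Sum>i<n. \<Sum>j<n. g i j k)" for g :: "nat \<Rightarrow> nat \<Rightarrow> nat \<Rightarrow> complex"
      by (subst sum.swap[of "\<lambda>k i. \<Sum>j<n. g i j k"], intro sum.cong refl sum.swap)
    then show ?thesis .
  qed
  also have "\<dots> = (\<Sum>k<n. ell2_inner (w k) (w k))" by (simp add: inner_w)
  also have "\<dots> \<in> \<real>\<^sub>\<ge>\<^sub>0" by (intro nonneg_Reals_sum) (simp add: ell2_inner_self)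
  finally show "(\<Sum>i<n. \<Sum>j<n. ell2_inner (F i) (\<pi> (M i j) (F j))) \<in> \<real>\<^sub>\<ge>\<^sub>0" .
qed

lemma op_positive_limit:
  assumes "\<And>k. op_positive n (M k)" "\<And>i j. i < n \<Longrightarrow> j < n \<Longrightarrow> (\<lambda>k. M k i j) \<longlonglongrightarrow> L i j"
  shows "op_positive n L"
  unfolding op_positive_def
proof
  fix F assume F: "F \<in> tuples n"
  have "(\<lambda>k. \<Sum>i<n. \<Sum>j<n. ell2_inner (F i) (\<pi> (M k i j) (F j))) \<longlonglongrightarrow>
      (\<Sum>i<n. \<Sum>j<n. ell2_inner (F i) (\<pi> (L i j) (F j)))"
    by (intro tendsto_sum inner_rep_tendsto assms(2)) (use F in \<open>auto simp: tuples_def\<close>)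
  moreover have "(\<Sum>i<n. \<Sum>j<n. ell2_inner (F i) (\<pi> (M k i j) (F j))) \<in> \<real>\<^sub>\<ge>\<^sub>0" for k
    using assms(1)[of k] F by (simp add: op_positive_def)
  ultimately show "(\<Sum>i<n. \<Sum>j<n. ell2_inner (F i) (\<pi> (L i j) (F j))) \<in> \<real>\<^sub>\<ge>\<^sub>0"
    by (rule closed_sequentially[OF closed_nonneg_Reals_complex, rotated])
qed

text \<open>The form is continuous in its vectors because every entry acts boundedly, and the
  nonnegative reals are closed.\<close>

lemma op_positive_dense:
  assumes D: "D \<subseteq> ell2 X" "\<And>f e. f \<in> ell2 X \<Longrightarrow> e > 0 \<Longrightarrow> \<exists>g\<in>D. ell2_norm (\<lambda>i. g i - f i) < e"
    and pos: "\<And>F. (\<And>i. i < n \<Longrightarrow> F i \<in> D) \<Longrightarrow> (\<Sum>i<n. \<Sum>j<n. ell2_inner (F i) (\<pi> (M i j) (F j))) \<in> \<real>\<^sub>\<ge>\<^sub>0"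
  shows "op_positive n M"
  unfolding op_positive_def
proof
  fix F assume F: "F \<in> tuples n"
  have "\<exists>g. (\<forall>k. g k \<in> D) \<and> (\<lambda>k. ell2_norm (\<lambda>x. g k x - f x)) \<longlonglongrightarrow> 0" if "f \<in> ell2 X" for f
  proof -
    have "\<forall>k. \<exists>g\<in>D. ell2_norm (\<lambda>x. g x - f x) < 1 / real (Suc k)" using D(2)[OF that] by simp
    then obtain g where g: "\<And>k. g k \<in> D" "\<And>k. ell2_norm (\<lambda>x. g k x - f x) < 1 / real (Suc k)" by metis
    have "norm (ell2_norm (\<lambda>x. g k x - f x)) \<le> 1 / real (Suc k)" for k using less_imp_le[OF g(2)] by simp
    then have "(\<lambda>k. ell2_norm (\<lambda>x. g k x - f x)) \<longlonglongrightarrow> 0"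
      by (rule Lim_null_comparison[OF always_eventually[OF allI] lim_1_over_n[THEN LIMSEQ_Suc]])
    then show ?thesis using g(1) by blast
  qed
  then have "\<forall>i. \<exists>g. i < n \<longrightarrow> (\<forall>k. g k \<in> D) \<and> (\<lambda>k. ell2_norm (\<lambda>x. g k x - F i x)) \<longlonglongrightarrow> 0"
    using F by (simp add: tuples_def)
  then obtain g where g: "\<And>i k. i < n \<Longrightarrow> g i k \<in> D"
    "\<And>i. i < n \<Longrightarrow> (\<lambda>k. ell2_norm (\<lambda>x. g i k x - F i x)) \<longlonglongrightarrow> 0" by metis
  have rep_lim: "(\<lambda>k. ell2_norm (\<lambda>x. \<pi> a (g i k) x - \<pi> a (F i) x)) \<longlonglongrightarrow> 0" if i: "i < n" for i a
  proof -
    have ell2: "g i k \<in> ell2 X" "F i \<in> ell2 X" for k using g(1)[OF i] D(1) F i by (auto simp: tuples_def)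
    have bound: "norm (ell2_norm (\<lambda>x. \<pi> a (g i k) x - \<pi> a (F i) x)) \<le> norm a * ell2_norm (\<lambda>x. g i k x - F i x)" for k
      using rep_norm_le[OF ell2_diff[OF ell2(1) ell2(2)], of a k] by (simp add: rep_diff_vec ell2)
    have lim: "(\<lambda>k. norm a * ell2_norm (\<lambda>x. g i k x - F i x)) \<longlonglongrightarrow> 0"
      using tendsto_mult_left[OF g(2)[OF i], of "norm a"] by simp
    show ?thesis by (rule Lim_null_comparison[OF always_eventually[OF allI[OF bound]] lim])
  qed
  have "(\<lambda>k. \<Sum>i<n. \<Sum>j<n. ell2_inner (g i k) (\<pi> (M i j) (g j k))) \<longlonglongrightarrow>
      (\<Sum>i<n. \<Sum>j<n. ell2_inner (F i) (\<pi> (M i j) (F j)))"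
  proof (intro tendsto_sum)
    fix i j assume "i \<in> {..<n}" "j \<in> {..<n}"
    then have ij: "i < n" "j < n" by auto
    have ell2: "g i k \<in> ell2 X" "F i \<in> ell2 X" "g j k \<in> ell2 X" "F j \<in> ell2 X" for k
      using g(1) D(1) F ij by (auto simp: tuples_def)
    show "(\<lambda>k. ell2_inner (g i k) (\<pi> (M i j) (g j k))) \<longlonglongrightarrow> ell2_inner (F i) (\<pi> (M i j) (F j))"
      by (rule ell2_inner_tendsto[where X = X, OF _ _ _ _ g(2)[OF ij(1)] rep_lim[OF ij(2)]])
        (use ell2 in auto)
  qed
  moreover have "(\<Sum>i<n. \<Sum>j<n. ell2_inner (g i k) (\<pi> (M i j) (g j k))) \<in> \<real>\<^sub>\<ge>\<^sub>0" for k
    using pos[of "\<lambda>i. g i k"] g(1) by simp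
  ultimately show "(\<Sum>i<n. \<Sum>j<n. ell2_inner (F i) (\<pi> (M i j) (F j))) \<in> \<real>\<^sub>\<ge>\<^sub>0"
    by (rule closed_sequentially[OF closed_nonneg_Reals_complex, rotated])
qed

section \<open>Two by two matrices and the norm\<close>

lemma op_positive_norm_matrix:
  "op_positive 2 (\<lambda>i j. if i = j then complex_of_real (norm a) *\<^sub>C 1 else if i = 0 then a else star a)"
  unfolding op_positive_def
proof
  fix F assume F: "F \<in> tuples 2"
  have F': "F 0 \<in> ell2 X" "F 1 \<in> ell2 X" using F by (auto simp: tuples_def)
  let ?z = "ell2_inner (F 0) (\<pi> a (F 1))"
  have "cmod ?z \<le> ell2_norm (F 0) * ell2_norm (\<pi> a (F 1))"
    using F' by (intro ell2_cauchy_schwarz[of _ X]) auto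
  also have "\<dots> \<le> ell2_norm (F 0) * (norm a * ell2_norm (F 1))"
    using F' by (intro mult_left_mono rep_norm_le) auto
  also have "\<dots> = norm a * (ell2_norm (F 0) * ell2_norm (F 1))" by simp
  finally have "2 * cmod ?z \<le> norm a * (2 * ell2_norm (F 0) * ell2_norm (F 1))" by simp
  also have "\<dots> \<le> norm a * ((ell2_norm (F 0))\<^sup>2 + (ell2_norm (F 1))\<^sup>2)"
    by (intro mult_left_mono sum_squares_bound) auto
  finally have bound: "2 * cmod ?z \<le> norm a * (ell2_norm (F 0))\<^sup>2 + norm a * (ell2_norm (F 1))\<^sup>2"
    by (simp add: distrib_left)
  have "ell2_inner (F 1) (\<pi> (star a) (F 0)) = cnj ?z"
    using rep_adjoint'[OF F'(2,1), of a] ell2_inner_commute[of "\<pi> a (F 1)" "F 0"] by simp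
  then have "(\<Sum>i<2. \<Sum>j<2. ell2_inner (F i) (\<pi> (if i = j then complex_of_real (norm a) *\<^sub>C 1
        else if i = 0 then a else star a) (F j))) =
      complex_of_real (norm a * (ell2_norm (F 0))\<^sup>2 + norm a * (ell2_norm (F 1))\<^sup>2) + (?z + cnj ?z)"
    using F' by (simp add: numeral_2_eq_2 rep_scaleC rep_one ell2_inner_scale_right ell2_inner_self)
  also have "\<dots> = complex_of_real (norm a * (ell2_norm (F 0))\<^sup>2 + norm a * (ell2_norm (F 1))\<^sup>2 + 2 * Re ?z)"
    by (simp add: complex_add_cnj)
  also have "\<dots> \<in> \<real>\<^sub>\<ge>\<^sub>0"
    using bound abs_Re_le_cmod[of ?z] by (simp only: nonneg_Reals_of_real_iff)
  finally show "(\<Sum>i<2. \<Sum>j<2. ell2_inner (F i) (\<pi> (if i = j then complex_of_real (norm a) *\<^sub>C 1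
        else if i = 0 then a else star a) (F j))) \<in> \<real>\<^sub>\<ge>\<^sub>0" .
qed

text \<open>The converse of the preceding estimate. The lower entry \<open>b\<close> is left free
  since positivity forces it to be \<open>star a\<close>; in the application, compatibility of the
  convolution operator with adjoints thus comes out of positivity.\<close>

lemma op_positive_norm_matrixD:
  assumes pos: "op_positive 2 (\<lambda>i j. if i = j then complex_of_real K *\<^sub>C 1 else if i = 0 then a else b)"
    and K: "0 \<le> K"
  shows "norm a \<le> K"
proof (rule norm_leI[OF K])
  have b: "b = star a" using op_positive_hermitian[OF pos, of 0 1] by simp
  fix f assume f: "f \<in> ell2 X" "ell2_norm f \<le> 1"
  define t where "t = ell2_norm (\<pi> a f)"
  show "ell2_norm (\<pi> a f) \<le> K"
  proof (cases "t = 0")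
    case False
    then have t: "t > 0" using ell2_norm_nonneg[of "\<pi> a f"] unfolding t_def by linarith
    \<comment> \<open>The unit vector opposite to \<open>\<pi> a f\<close> makes both cross terms
      equal to \<open>- t\<close>, so that the form becomes
      \<open>K + K * (ell2_norm f)\<^sup>2 - 2 * t\<close>.\<close>
    define g where "g = (\<lambda>x. complex_of_real (- 1 / t) * \<pi> a f x)"
    have g: "g \<in> ell2 X" unfolding g_def using f by (intro ell2_scale) auto
    have "cmod (complex_of_real (- 1 / t)) = 1 / t" using t unfolding norm_of_real by simp
    then have norm_g: "ell2_norm g = 1"
      unfolding g_def ell2_norm_scale using t by (simp add: t_def)
    have "ell2_inner g (\<pi> a f) = complex_of_real (- 1 / t) * complex_of_real (t\<^sup>2)"
      unfolding g_def ell2_inner_scale_left ell2_inner_self t_def by (simp only: complex_cnj_complex_of_real)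
    then have ga: "ell2_inner g (\<pi> a f) = - complex_of_real t"
      using t by (simp add: power2_eq_square)
    have fb: "ell2_inner f (\<pi> b g) = - complex_of_real t"
      using rep_adjoint'[OF f(1) g, of a] ell2_inner_commute[of "\<pi> a f" g] b ga by simp
    have "(\<lambda>i::nat. if i = 0 then g else f) \<in> tuples 2" using f g by (simp add: tuples_def)
    then have "(\<Sum>i<2. \<Sum>j<2. ell2_inner (if i = 0 then g else f) (\<pi> (if i = j then complex_of_real K *\<^sub>C 1
        else if i = 0 then a else b) (if j = (0::nat) then g else f))) \<in> \<real>\<^sub>\<ge>\<^sub>0"
      using pos unfolding op_positive_def by (rule bspec[rotated])
    moreover have "(\<Sum>i<2. \<Sum>j<2. ell2_inner (if i = 0 then g else f) (\<pi> (if i = j then complex_of_real K *\<^sub>C 1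
        else if i = 0 then a else b) (if j = (0::nat) then g else f))) =
        complex_of_real (K + K * (ell2_norm f)\<^sup>2 - 2 * t)"
      using f g by (simp add: numeral_2_eq_2 rep_scaleC rep_one ell2_inner_scale_right ell2_inner_self norm_g ga fb)
    ultimately have "complex_of_real (K + K * (ell2_norm f)\<^sup>2 - 2 * t) \<in> \<real>\<^sub>\<ge>\<^sub>0" by simp
    then have "2 * t \<le> K + K * (ell2_norm f)\<^sup>2" by (simp only: nonneg_Reals_of_real_iff)
    also have "\<dots> \<le> K + K * 1" using f(2) K by (intro add_left_mono mult_left_mono power_le_one) auto
    finally show ?thesis by (simp add: t_def)
  qed (use K t_def in simp)
qed

end

section \<open>The convolution semigroup on the reduced C*-algebra\<close>

lemma star_sum_list: "star (\<Sum>k\<leftarrow>ks. f k) = (\<Sum>k\<leftarrow>ks. star (f k :: 'a::complex_star_algebra))"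
  by (induction ks) (auto simp: star_add)

lemma scaleC_sum_list_right: "c *\<^sub>C (\<Sum>k\<leftarrow>ks. f k) = (\<Sum>k\<leftarrow>ks. c *\<^sub>C (f k :: 'a::complex_star_algebra))"
  by (induction ks) (auto simp: scaleC_add_right)

lemma sum_list_upt: "(\<Sum>k\<leftarrow>[0..<n]. f k) = (\<Sum>k<n. f k)"
  by (simp add: interv_sum_list_conv_sum_set_nat atLeast0LessThan)

lemma sum_list_nth: "(\<Sum>k\<leftarrow>ks. f k) = (\<Sum>r<length ks. f (ks ! r))"
  by (simp add: sum_list_sum_nth atLeast0LessThan)

locale levy_process_on_cqg =
  fixes tens :: "'a::cstar_algebra \<Rightarrow> 'a \<Rightarrow> 'c::cstar_algebra"
    and tens3 :: "'c \<Rightarrow> 'a \<Rightarrow> 'd::cstar_algebra"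
    and \<Delta> :: "'a \<Rightarrow> 'c"
    and A :: "'a set"
    and \<epsilon> h :: "'a \<Rightarrow> complex"
    and \<iota> :: "'a \<Rightarrow> 'r::cstar_algebra"
    and \<Phi> :: "'b::complex_star_algebra \<Rightarrow> complex"
    and j :: "real \<Rightarrow> real \<Rightarrow> 'a \<Rightarrow> 'b"
    and \<phi> :: "real \<Rightarrow> 'a \<Rightarrow> complex"
  assumes cqg: "compact_quantum_group tens tens3 \<Delta>"
    and A_def: "A = coefficient_algebra tens \<Delta>"
    and hopf: "dense_hopf_star_algebra tens \<Delta> A \<epsilon>"
    and haar: "haar_state tens \<Delta> h"
    and reduced: "reduced_cstar_algebra A h \<iota>"
    and levy: "levy_process tens \<Delta> A \<epsilon> \<Phi> j"
    and phi: "\<And>t a. 0 \<le> t \<Longrightarrow> a \<in> A \<Longrightarrow> \<phi> t a = \<Phi> (j 0 t a)"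

sublocale levy_process_on_cqg \<subseteq> self_tensor_product tens
  by unfold_locales (use cqg in \<open>simp add: compact_quantum_group_def\<close>)

context levy_process_on_cqg
begin

section \<open>The coefficient algebra and finite decompositions of the comultiplication\<close>

lemma A_one [simp]: "1 \<in> A"
  and A_add [simp]: "x \<in> A \<Longrightarrow> y \<in> A \<Longrightarrow> x + y \<in> A"
  and A_mult [simp]: "x \<in> A \<Longrightarrow> y \<in> A \<Longrightarrow> x * y \<in> A"
  and A_scaleC [simp]: "x \<in> A \<Longrightarrow> c *\<^sub>C x \<in> A"
  and A_star [simp]: "x \<in> A \<Longrightarrow> star x \<in> A"
  using hopf by (auto simp: dense_hopf_star_algebra_def star_subalgebra_def)

lemma A_zero [simp]: "0 \<in> A"
  using A_scaleC[OF A_one, of 0] by simp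

lemma csubspace_A: "csubspace A"
  by (simp add: csubspace_def)

lemma A_sum: "(\<And>i. i \<in> I \<Longrightarrow> f i \<in> A) \<Longrightarrow> (\<Sum>i\<in>I. f i) \<in> A"
  by (induction I rule: infinite_finite_induct) auto

lemma A_sum_list: "(\<And>k. k \<in> set ks \<Longrightarrow> f k \<in> A) \<Longrightarrow> (\<Sum>k\<leftarrow>ks. f k) \<in> A"
  by (induction ks) auto

lemma comult_one: "\<Delta> 1 = 1"
  and comult_add: "\<Delta> (x + y) = \<Delta> x + \<Delta> y"
  and comult_mult: "\<Delta> (x * y) = \<Delta> x * \<Delta> y"
  and comult_scaleC: "\<Delta> (c *\<^sub>C x) = c *\<^sub>C \<Delta> x"
  and comult_star: "\<Delta> (star x) = star (\<Delta> x)"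
  using cqg by (auto simp: compact_quantum_group_def unital_star_hom_on_def)

lemma coefficient_in_A: "unitary_corep tens \<Delta> n u \<Longrightarrow> i < n \<Longrightarrow> k < n \<Longrightarrow> u i k \<in> A"
  unfolding A_def coefficient_algebra_def by (rule cspan_superset) blast

lemma A_induct [consumes 1, case_names zero add]:
  assumes "x \<in> A" "P 0"
    and "\<And>c n u i k y. unitary_corep tens \<Delta> n u \<Longrightarrow> i < n \<Longrightarrow> k < n \<Longrightarrow> y \<in> A \<Longrightarrow> P y \<Longrightarrow> P (c *\<^sub>C u i k + y)"
  shows "P x"
  using assms(1) unfolding A_def coefficient_algebra_def
proof (induction rule: cspan_induct)
  case (add c x y)
  then show ?case using assms(3) unfolding A_def coefficient_algebra_def by blast
qed (rule assms(2))

text \<open>A list in the role of Sweedler notation: a witness of \<open>\<Delta> a\<close> from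
  which \<open>tensor_map\<close> can be evaluated.\<close>

definition decomp :: "'a \<Rightarrow> ('a \<times> 'a) list \<Rightarrow> bool"
  where "decomp a ps \<longleftrightarrow> set ps \<subseteq> A \<times> A \<and> \<Delta> a = (\<Sum>p\<leftarrow>ps. tens (fst p) (snd p))"

lemma ex_decomp: "a \<in> A \<Longrightarrow> \<exists>ps. decomp a ps"
proof -
  assume "a \<in> A"
  then have "\<Delta> a \<in> alg_tensor tens A" using hopf by (auto simp: dense_hopf_star_algebra_def)
  then show ?thesis by (auto simp: alg_tensor_def decomp_def case_prod_unfold)
qed

lemma decomp_coefficient:
  assumes "unitary_corep tens \<Delta> n u" "i < n" "k < n"
  shows "decomp (u i k) (map (\<lambda>l. (u i l, u l k)) [0..<n])"
  using assms coefficient_in_A[OF assms(1)]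
  by (auto simp: decomp_def unitary_corep_def o_def sum_list_upt)

lemma decomp_one: "decomp 1 [(1, 1)]"
  by (simp add: decomp_def comult_one tens_one)

lemma decomp_add: "decomp a ps \<Longrightarrow> decomp b qs \<Longrightarrow> decomp (a + b) (ps @ qs)"
  by (simp add: decomp_def comult_add)

lemma decomp_scaleC: "decomp a ps \<Longrightarrow> decomp (c *\<^sub>C a) (map (\<lambda>p. (c *\<^sub>C fst p, snd p)) ps)"
  by (auto simp: decomp_def comult_scaleC o_def tens_scaleC_left scaleC_sum_list_right)

lemma decomp_fst: "decomp a ps \<Longrightarrow> p \<in> set ps \<Longrightarrow> fst p \<in> A"
  and decomp_snd: "decomp a ps \<Longrightarrow> p \<in> set ps \<Longrightarrow> snd p \<in> A"
  by (auto simp: decomp_def)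

lemma tensor_map_decomp:
  assumes "balanced_on A \<beta>" "decomp a ps"
  shows "tensor_map tens A \<beta> (\<Delta> a) = (\<Sum>p\<leftarrow>ps. \<beta> (fst p) (snd p))"
  using tensor_map_eq[OF csubspace_A assms(1), of ps] assms(2) by (simp add: decomp_def case_prod_unfold)

section \<open>The states of the increments\<close>

lemma state_add: "\<Phi> (x + y) = \<Phi> x + \<Phi> y" and state_scaleC: "\<Phi> (c *\<^sub>C x) = c * \<Phi> x"
  and state_one: "\<Phi> 1 = 1" and state_pos: "\<Phi> (star x * x) \<in> \<real>\<^sub>\<ge>\<^sub>0"
  using levy_process.state[OF levy] by (auto simp: is_state_def clinear_def scaleC_complex_def)

lemma state_sum: "\<Phi> (\<Sum>i\<in>I. f i) = (\<Sum>i\<in>I. \<Phi> (f i))"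
  using levy_process.state[OF levy] by (auto simp: is_state_def intro: clinear_sum)

lemma
  assumes "0 \<le> s" "s \<le> t"
  shows j_one: "j s t 1 = 1"
    and j_add: "x \<in> A \<Longrightarrow> y \<in> A \<Longrightarrow> j s t (x + y) = j s t x + j s t y"
    and j_mult: "x \<in> A \<Longrightarrow> y \<in> A \<Longrightarrow> j s t (x * y) = j s t x * j s t y"
    and j_scaleC: "x \<in> A \<Longrightarrow> j s t (c *\<^sub>C x) = c *\<^sub>C j s t x"
    and j_star: "x \<in> A \<Longrightarrow> j s t (star x) = star (j s t x)"
  using levy_process.hom[OF levy assms] by (auto simp: unital_star_hom_on_def)

lemma phi_one: "0 \<le> t \<Longrightarrow> \<phi> t 1 = 1"
  and phi_add: "0 \<le> t \<Longrightarrow> x \<in> A \<Longrightarrow> y \<in> A \<Longrightarrow> \<phi> t (x + y) = \<phi> t x + \<phi> t y"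
  and phi_scaleC: "0 \<le> t \<Longrightarrow> x \<in> A \<Longrightarrow> \<phi> t (c *\<^sub>C x) = c * \<phi> t x"
  by (simp_all add: phi j_one j_add j_scaleC state_one state_add state_scaleC)

lemma phi_zero: "0 \<le> t \<Longrightarrow> \<phi> t 0 = 0"
  using phi_scaleC[of t 0 0] by simp

lemma phi_sum_list:
  "0 \<le> t \<Longrightarrow> (\<And>k. k \<in> set ks \<Longrightarrow> f k \<in> A) \<Longrightarrow> \<phi> t (\<Sum>k\<leftarrow>ks. c k *\<^sub>C f k) = (\<Sum>k\<leftarrow>ks. c k * \<phi> t (f k))"
  by (induction ks) (simp_all add: phi_zero phi_add phi_scaleC A_sum_list)

text \<open>Since \<open>j 0 t\<close> is a *-homomorphism, the kernel is the Gram matrix of the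
  elements \<open>j 0 t (y a)\<close> for the form given by \<open>\<Phi>\<close>; the quadratic
  form is the value of \<open>\<Phi>\<close> at \<open>star z * z\<close>.\<close>

lemma phi_psd:
  assumes t: "0 \<le> t" and y: "\<And>a. a \<in> I \<Longrightarrow> y a \<in> A"
  shows "psd_on I (\<lambda>a b. \<phi> t (star (y a) * y b))"
  unfolding psd_on_def
proof
  fix c :: "_ \<Rightarrow> complex"
  define z where "z = (\<Sum>a\<in>I. c a *\<^sub>C j 0 t (y a))"
  have "star z * z = (\<Sum>a\<in>I. \<Sum>b\<in>I. (cnj (c a) * c b) *\<^sub>C (star (j 0 t (y a)) * j 0 t (y b)))"
    by (simp add: z_def star_sum star_scaleC sum_product mult_scaleC_left mult_scaleC_right scaleC_scaleC mult.commute)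
  then have "\<Phi> (star z * z) = (\<Sum>a\<in>I. \<Sum>b\<in>I. cnj (c a) * c b * \<Phi> (star (j 0 t (y a)) * j 0 t (y b)))"
    by (simp add: state_sum state_scaleC)
  also have "\<dots> = (\<Sum>a\<in>I. \<Sum>b\<in>I. cnj (c a) * c b * \<phi> t (star (y a) * y b))"
    by (intro sum.cong refl) (simp add: phi t y j_mult j_star)
  finally show "(\<Sum>a\<in>I. \<Sum>b\<in>I. cnj (c a) * c b * \<phi> t (star (y a) * y b)) \<in> \<real>\<^sub>\<ge>\<^sub>0"
    using state_pos[of z] by simp
qed

section \<open>Convolution operators on the coefficient algebra\<close>

definition conv_op :: "real \<Rightarrow> 'a \<Rightarrow> 'a"
  where "conv_op t a = tensor_map tens A (\<lambda>x y. \<phi> t y *\<^sub>C x) (\<Delta> a)"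

lemma conv_op_decomp:
  assumes "0 \<le> t" "decomp a ps"
  shows "conv_op t a = (\<Sum>p\<leftarrow>ps. \<phi> t (snd p) *\<^sub>C fst p)"
proof -
  have "balanced_on A (\<lambda>x y. \<phi> t y *\<^sub>C x)"
    using assms(1) by (simp add: balanced_on_def scaleC_add_right scaleC_add_left phi_add phi_scaleC
        scaleC_scaleC mult.commute)
  then show ?thesis using tensor_map_decomp[OF _ assms(2)] by (simp add: conv_op_def)
qed

lemma conv_op_in_A: "0 \<le> t \<Longrightarrow> a \<in> A \<Longrightarrow> conv_op t a \<in> A"
proof -
  assume "0 \<le> t" "a \<in> A"
  obtain ps where ps: "decomp a ps" using ex_decomp \<open>a \<in> A\<close> by blast
  show ?thesis
    unfolding conv_op_decomp[OF \<open>0 \<le> t\<close> ps] by (intro A_sum_list A_scaleC decomp_fst[OF ps])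
qed

lemma conv_op_add:
  assumes "0 \<le> t" "a \<in> A" "b \<in> A"
  shows "conv_op t (a + b) = conv_op t a + conv_op t b"
proof -
  obtain ps qs where "decomp a ps" "decomp b qs" using ex_decomp assms by metis
  then show ?thesis
    using decomp_add[of a ps b qs] conv_op_decomp[OF assms(1)] by simp
qed

lemma conv_op_scaleC:
  assumes "0 \<le> t" "a \<in> A"
  shows "conv_op t (c *\<^sub>C a) = c *\<^sub>C conv_op t a"
proof -
  obtain ps where ps: "decomp a ps" using ex_decomp assms by metis
  then show ?thesis
    using conv_op_decomp[OF assms(1) decomp_scaleC[OF ps, of c]] conv_op_decomp[OF assms(1) ps]
    by (simp add: scaleC_sum_list_right o_def scaleC_scaleC mult.commute)
qed

lemma conv_op_one: "0 \<le> t \<Longrightarrow> conv_op t 1 = 1"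
  using conv_op_decomp[OF _ decomp_one] by (simp add: phi_one)

lemma conv_op_coefficient:
  assumes "0 \<le> t" "unitary_corep tens \<Delta> n u" "i < n" "k < n"
  shows "conv_op t (u i k) = (\<Sum>l<n. \<phi> t (u l k) *\<^sub>C u i l)"
  using conv_op_decomp[OF assms(1) decomp_coefficient[OF assms(2-4)]] by (simp add: o_def sum_list_upt)

lemma conv_op_0:
  assumes "a \<in> A"
  shows "conv_op 0 a = a"
proof -
  have eps: "\<epsilon> (x + y) = \<epsilon> x + \<epsilon> y" "\<epsilon> (c *\<^sub>C x) = c * \<epsilon> x" if "x \<in> A" "y \<in> A" for x y c
    using hopf that by (auto simp: dense_hopf_star_algebra_def unital_star_hom_on_def scaleC_complex_def)
  obtain ps where ps: "decomp a ps" using ex_decomp assms by metis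
  have "balanced_on A (\<lambda>x y. \<epsilon> y *\<^sub>C x)"
    by (simp add: balanced_on_def scaleC_add_right scaleC_add_left eps scaleC_scaleC mult.commute)
  from tensor_map_decomp[OF this ps] have "(\<Sum>p\<leftarrow>ps. \<epsilon> (snd p) *\<^sub>C fst p) = a"
    using hopf assms by (auto simp: dense_hopf_star_algebra_def)
  moreover have "\<phi> 0 y = \<epsilon> y" if "y \<in> A" for y
    using levy_process.initial[OF levy order_refl that] that by (simp add: phi state_scaleC state_one)
  ultimately show ?thesis
    using conv_op_decomp[OF order_refl ps] decomp_snd[OF ps] by (simp cong: map_cong)
qed

text \<open>The increment from 0 to \<open>s + t\<close> splits at \<open>s\<close>; independence
  factorises the state and stationarity shifts the second factor back to 0. Coefficients suffice,
  since they span \<open>A\<close>.\<close>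

lemma phi_convolution:
  assumes "0 \<le> s" "0 \<le> t" "unitary_corep tens \<Delta> n u" "i < n" "k < n"
  shows "\<phi> (s + t) (u i k) = (\<Sum>l<n. \<phi> s (u i l) * \<phi> t (u l k))"
proof -
  have u: "u i l \<in> A" if "i < n" "l < n" for i l using coefficient_in_A[OF assms(3) that] .
  have st: "0 \<le> s" "s \<le> s + t" "0 \<le> s + t" using assms by auto
  have "balanced_on A (\<lambda>x y. j 0 s x * j s (s + t) y)"
    by (simp add: balanced_on_def assms(1,2) j_add j_scaleC mult_scaleC_left mult_scaleC_right algebra_simps)
  from tensor_map_decomp[OF this decomp_coefficient[OF assms(3-5)]]
  have "j 0 (s + t) (u i k) = (\<Sum>l<n. j 0 s (u i l) * j s (s + t) (u l k))"
    using levy_process.increments[OF levy order_refl st(1,2) u[OF assms(4,5)]] by (simp add: o_def sum_list_upt)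
  then have "\<phi> (s + t) (u i k) = (\<Sum>l<n. \<Phi> (j 0 s (u i l) * j s (s + t) (u l k)))"
    using st u[OF assms(4,5)] by (simp add: phi state_sum)
  also have "\<dots> = (\<Sum>l<n. \<phi> s (u i l) * \<phi> t (u l k))"
  proof (intro sum.cong refl)
    fix l assume "l \<in> {..<n}"
    then have l: "u i l \<in> A" "u l k \<in> A" using u assms by auto
    \<comment> \<open>Independence is stated for families indexed by naturals; the conditionals
      encode a family of two increments.\<close>
    have "\<Phi> (prod_list (map (\<lambda>r. j (if r = 0 then 0 else s) (if r = 0 then s else s + t) (if r = 0 then u i l else u l k)) [0..<2])) =
        (\<Prod>r<2::nat. \<Phi> (j (if r = 0 then 0 else s) (if r = 0 then s else s + t) (if r = 0 then u i l else u l k)))"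
      by (rule levy_process.factorize[OF levy]) (use st l assms(2) in auto)
    then have "\<Phi> (j 0 s (u i l) * j s (s + t) (u l k)) = \<Phi> (j 0 s (u i l)) * \<Phi> (j s (s + t) (u l k))"
      by (simp add: numeral_2_eq_2)
    also have "\<Phi> (j s (s + t) (u l k)) = \<Phi> (j 0 t (u l k))"
      by (rule levy_process.stationary[OF levy]) (use st l assms(2) in auto)
    finally show "\<Phi> (j 0 s (u i l) * j s (s + t) (u l k)) = \<phi> s (u i l) * \<phi> t (u l k)"
      using l assms by (simp add: phi)
  qed
  finally show ?thesis .
qed

lemma conv_op_zero: "0 \<le> t \<Longrightarrow> conv_op t 0 = 0"
  using conv_op_scaleC[of t 0 0] by simp

lemma conv_op_sum:
  "0 \<le> t \<Longrightarrow> (\<And>i. i \<in> I \<Longrightarrow> f i \<in> A) \<Longrightarrow> conv_op t (\<Sum>i\<in>I. c i *\<^sub>C f i) = (\<Sum>i\<in>I. c i *\<^sub>C conv_op t (f i))"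
  by (induction I rule: infinite_finite_induct) (simp_all add: conv_op_zero conv_op_add conv_op_scaleC A_sum)

text \<open>On the coefficients of \<open>u\<close>, the operator at time \<open>t\<close> is right
  multiplication of \<open>u\<close> by the matrix of values \<open>\<phi> t (u l k)\<close>, and by
  \<open>phi_convolution\<close> these matrices multiply as times add. Linearity covers the rest of
  \<open>A\<close>.\<close>

lemma conv_op_semigroup:
  assumes "0 \<le> s" "0 \<le> t" "a \<in> A"
  shows "conv_op (s + t) a = conv_op s (conv_op t a)"
  using assms(3)
proof (induction rule: A_induct)
  case zero
  then show ?case using assms by (simp add: conv_op_zero)
next
  case (add c n u i k y)
  have u: "u i l \<in> A" if "i < n" "l < n" for i l using coefficient_in_A[OF add(1) that] .
  have "conv_op s (conv_op t (u i k)) = (\<Sum>l<n. \<phi> t (u l k) *\<^sub>C conv_op s (u i l))"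
    unfolding conv_op_coefficient[OF assms(2) add(1-3)] by (rule conv_op_sum) (use assms u add in auto)
  also have "\<dots> = (\<Sum>l<n. \<Sum>m<n. (\<phi> s (u m l) * \<phi> t (u l k)) *\<^sub>C u i m)"
    by (intro sum.cong refl)
      (use add in \<open>simp add: conv_op_coefficient[OF assms(1) add(1)] scaleC_sum_right scaleC_scaleC mult.commute\<close>)
  also have "\<dots> = (\<Sum>m<n. (\<Sum>l<n. \<phi> s (u m l) * \<phi> t (u l k)) *\<^sub>C u i m)"
    by (subst sum.swap) (simp add: scaleC_sum_left)
  also have "\<dots> = conv_op (s + t) (u i k)"
    using conv_op_coefficient[of "s + t", OF _ add(1-3)] phi_convolution[OF assms(1,2) add(1) _ add(3)] assms by simp
  finally have "conv_op (s + t) (u i k) = conv_op s (conv_op t (u i k))" ..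
  with add show ?case
    using assms u by (simp add: conv_op_add conv_op_scaleC conv_op_in_A)
qed

text \<open>For strong continuity: the orbit of \<open>a\<close> stays in the span of finitely many
  fixed elements, and only scalar coefficients vary with time.\<close>

lemma conv_op_expansion:
  assumes "a \<in> A"
  shows "\<exists>n c (f :: nat \<Rightarrow> 'a) d. (\<forall>l<n. f l \<in> A \<and> ((\<lambda>t. c t l) \<longlongrightarrow> d l) (at_right 0)) \<and>
    (\<forall>t\<ge>0. conv_op t a = (\<Sum>l<n. c t l *\<^sub>C f l)) \<and> a = (\<Sum>l<n. d l *\<^sub>C f l)"
proof -
  obtain ps where ps: "decomp a ps" using ex_decomp assms by metis
  have c: "conv_op t a = (\<Sum>l<length ps. \<phi> t (snd (ps ! l)) *\<^sub>C fst (ps ! l))" if "0 \<le> t" for t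
    using conv_op_decomp[OF that ps] by (simp add: sum_list_nth)
  have lim: "((\<lambda>t. \<phi> t y) \<longlongrightarrow> \<phi> 0 y) (at_right 0)" if y: "y \<in> A" for y
  proof -
    have "((\<lambda>t. \<Phi> (j 0 t y)) \<longlongrightarrow> \<epsilon> y) (at_right 0)" by (rule levy_process.continuity[OF levy order_refl y])
    \<comment> \<open>\<open>\<phi>\<close> is tied to the process for nonnegative times only, hence
      the eventual equality from the right.\<close>
    moreover have "\<forall>\<^sub>F t in at_right 0. \<Phi> (j 0 t y) = \<phi> t y"
      using eventually_at_right_less[of "0::real"] by eventually_elim (simp add: phi y)
    ultimately have "((\<lambda>t. \<phi> t y) \<longlongrightarrow> \<epsilon> y) (at_right 0)" by (rule Lim_transform_eventually)
    moreover have "\<phi> 0 y = \<epsilon> y"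
      using levy_process.initial[OF levy order_refl y] y by (simp add: phi state_scaleC state_one)
    ultimately show ?thesis by simp
  qed
  show ?thesis
    by (rule exI[of _ "length ps"], rule exI[of _ "\<lambda>t l. \<phi> t (snd (ps ! l))"],
        rule exI[of _ "\<lambda>l. fst (ps ! l)"], rule exI[of _ "\<lambda>l. \<phi> 0 (snd (ps ! l))"])
      (use c conv_op_0[OF assms] c[of 0] lim decomp_fst[OF ps] decomp_snd[OF ps] in auto)
qed

subsection \<open>Untwisting\<close>

text \<open>
  \<open>untwist b ps\<close> says that \<open>ps\<close> is the inverse image of \<open>b \<otimes> 1\<close> under \<open>x \<otimes> y \<mapsto> \<Delta>(x) (1 \<otimes> y)\<close>, the
  isometry of Fell's absorption principle; for a coefficient it is given by unitarity of the corepresentation.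
\<close>

definition untwist :: "'a \<Rightarrow> ('a \<times> 'a) list \<Rightarrow> bool"
  where "untwist b ps \<longleftrightarrow> set ps \<subseteq> A \<times> A \<and> (\<Sum>p\<leftarrow>ps. \<Delta> (fst p) * tens 1 (snd p)) = tens b 1"

lemma ex_untwist:
  assumes "b \<in> A"
  shows "\<exists>ps. untwist b ps"
  using assms
proof (induction rule: A_induct)
  case zero
  have "untwist 0 []" by (simp add: untwist_def)
  then show ?case ..
next
  case (add c n u i k y)
  have u: "u i l \<in> A" if "i < n" "l < n" for i l using coefficient_in_A[OF add(1) that] .
  \<comment> \<open>\<open>star (u k q)\<close> is the entry \<open>(q, k)\<close> of the inverse of
    \<open>u\<close>, so summing over \<open>q\<close> leaves only the term with
    \<open>s = k\<close>.\<close>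
  define qs where "qs = map (\<lambda>q. (u i q, star (u k q))) [0..<n]"
  have "(\<Sum>q\<leftarrow>qs. \<Delta> (fst q) * tens 1 (snd q)) = (\<Sum>q<n. \<Sum>s<n. tens (u i s) (u s q * star (u k q)))"
    unfolding qs_def using add(1-3)
    by (simp add: o_def sum_list_upt unitary_corep_def sum_distrib_right tens_mult)
  also have "\<dots> = (\<Sum>s<n. tens (u i s) (\<Sum>q<n. u s q * star (u k q)))"
    by (subst sum.swap) (simp add: tens_sum_right)
  also have "\<dots> = (\<Sum>s<n. if s = k then tens (u i s) 1 else 0)"
    using add(1-3) by (intro sum.cong refl) (auto simp: unitary_corep_def)
  also have "\<dots> = tens (u i k) 1" using add by simp
  finally have qs: "(\<Sum>q\<leftarrow>qs. \<Delta> (fst q) * tens 1 (snd q)) = tens (u i k) 1" .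
  obtain ps where ps: "untwist y ps" using add by blast
  have "untwist (c *\<^sub>C u i k + y) (map (\<lambda>q. (c *\<^sub>C fst q, snd q)) qs @ ps)"
  proof -
    have "(\<Sum>q\<leftarrow>map (\<lambda>q. (c *\<^sub>C fst q, snd q)) qs. \<Delta> (fst q) * tens 1 (snd q)) = c *\<^sub>C tens (u i k) 1"
      unfolding qs[symmetric] by (simp add: o_def comult_scaleC mult_scaleC_left scaleC_sum_list_right)
    moreover have "set (map (\<lambda>q. (c *\<^sub>C fst q, snd q)) qs) \<subseteq> A \<times> A"
      using u add by (auto simp: qs_def)
    ultimately show ?thesis using ps by (simp add: untwist_def tens_add_left tens_scaleC_left)
  qed
  then show ?case ..
qed

text \<open>Realises the slice of the left leg by \<open>h\<close> as an actual bounded map. It is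
  then the map described in \<open>haar_state\<close>, so invariance becomes an equation that can be
  calculated with.\<close>

lemma haar_slice: "\<exists>F. bounded_clinear F \<and> (\<forall>a b. F (tens a b) = h a *\<^sub>C b) \<and> (\<forall>a. F (\<Delta> a) = h a *\<^sub>C 1)"
proof -
  have h: "clinear h" "\<And>a. cmod (h a) \<le> norm a"
    using haar by (auto simp: haar_state_def is_cstar_state_def is_state_def)
  obtain F where F: "bounded_clinear F" "\<forall>a b. F (tens a b) = h a *\<^sub>C b" using slice_map[OF h] by blast
  have "\<forall>a. F (\<Delta> a) = h a *\<^sub>C 1"
    using haar ctensor_map_eq[of F "\<lambda>x y. h x *\<^sub>C y"] F by (simp add: haar_state_def)
  with F show ?thesis by blast
qed

lemma haar_add: "h (x + y) = h x + h y" and haar_scaleC: "h (c *\<^sub>C x) = c * h x"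
  using haar by (auto simp: haar_state_def is_cstar_state_def is_state_def clinear_def scaleC_complex_def)

lemma haar_sum_list: "h (\<Sum>k\<leftarrow>ks. f k) = (\<Sum>k\<leftarrow>ks. h (f k))"
  using haar by (auto simp: haar_state_def is_cstar_state_def is_state_def intro: clinear_sum_list)

text \<open>The slice of \<open>tens (star b) 1 * \<Delta> a * tens c 1\<close> by \<open>h\<close>
  is computed twice: from a decomposition of \<open>\<Delta> a\<close>, and by untwisting both outer
  factors so that everything in the middle is a value of \<open>\<Delta>\<close> and invariance
  applies. Both results lie in \<open>A\<close>, where \<open>\<phi> t\<close> may be
  applied.\<close>

lemma conv_op_untwist:
  assumes t: "0 \<le> t" and a: "a \<in> A" and bc: "b \<in> A" "c \<in> A" and ps: "untwist b ps" and qs: "untwist c qs"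
  shows "h (star b * conv_op t a * c) =
    (\<Sum>p\<leftarrow>ps. \<Sum>q\<leftarrow>qs. h (star (fst p) * a * fst q) * \<phi> t (star (snd p) * snd q))"
proof -
  obtain F where F: "bounded_clinear F" "\<forall>a b. F (tens a b) = h a *\<^sub>C b" "\<forall>a. F (\<Delta> a) = h a *\<^sub>C 1"
    using haar_slice by blast
  have lin: "clinear F" using F(1) by (simp add: bounded_clinear_def)
  obtain ds where ds: "decomp a ds" using ex_decomp a by metis
  have ps_A: "fst p \<in> A" "snd p \<in> A" if "p \<in> set ps" for p using ps that by (auto simp: untwist_def)
  have qs_A: "fst p \<in> A" "snd p \<in> A" if "p \<in> set qs" for p using qs that by (auto simp: untwist_def)
  \<comment> \<open>A slice of the left leg is a bimodule map over the right leg; invariance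
    evaluates what remains.\<close>
  have module: "F (tens 1 x * \<Delta> z * tens 1 y) = h z *\<^sub>C (x * y)" if "z \<in> A" for x y z
  proof -
    obtain es where es: "decomp z es" using ex_decomp \<open>z \<in> A\<close> by metis
    have "F (tens 1 x * \<Delta> z * tens 1 y) = x * F (\<Delta> z) * y"
      using es unfolding decomp_def
      by (simp add: sum_list_const_mult[symmetric] sum_list_mult_const[symmetric] tens_mult
          clinear_sum_list[OF lin] F(2) mult_scaleC_left mult_scaleC_right)
    then show ?thesis by (simp add: F(3) mult_scaleC_left mult_scaleC_right)
  qed
  have "tens (star b) 1 = (\<Sum>p\<leftarrow>ps. tens 1 (star (snd p)) * \<Delta> (star (fst p)))"
    using arg_cong[OF ps[unfolded untwist_def, THEN conjunct2], of star]
    by (simp add: star_sum_list star_mult tens_star comult_star)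
  then have "tens (star b) 1 * \<Delta> a * tens c 1 = (\<Sum>p\<leftarrow>ps. tens 1 (star (snd p)) * \<Delta> (star (fst p)) * \<Delta> a * tens c 1)"
    by (simp add: sum_list_mult_const[symmetric])
  also have "\<dots> =
      (\<Sum>p\<leftarrow>ps. \<Sum>q\<leftarrow>qs. tens 1 (star (snd p)) * \<Delta> (star (fst p)) * \<Delta> a * (\<Delta> (fst q) * tens 1 (snd q)))"
    unfolding qs[unfolded untwist_def, THEN conjunct2, symmetric] by (simp add: sum_list_const_mult[symmetric])
  also have "\<dots> = (\<Sum>p\<leftarrow>ps. \<Sum>q\<leftarrow>qs. tens 1 (star (snd p)) * \<Delta> (star (fst p) * a * fst q) * tens 1 (snd q))"
    by (simp add: comult_mult mult.assoc)
  finally have "F (tens (star b) 1 * \<Delta> a * tens c 1) =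
      (\<Sum>p\<leftarrow>ps. \<Sum>q\<leftarrow>qs. F (tens 1 (star (snd p)) * \<Delta> (star (fst p) * a * fst q) * tens 1 (snd q)))"
    by (simp add: clinear_sum_list[OF lin])
  also have "\<dots> = (\<Sum>p\<leftarrow>ps. \<Sum>q\<leftarrow>qs. h (star (fst p) * a * fst q) *\<^sub>C (star (snd p) * snd q))"
    by (intro arg_cong[of _ _ sum_list] map_cong refl module) (use ps_A qs_A a in auto)
  finally have "F (tens (star b) 1 * \<Delta> a * tens c 1) =
      (\<Sum>p\<leftarrow>ps. \<Sum>q\<leftarrow>qs. h (star (fst p) * a * fst q) *\<^sub>C (star (snd p) * snd q))" .
  moreover have "F (tens (star b) 1 * \<Delta> a * tens c 1) = (\<Sum>d\<leftarrow>ds. h (star b * fst d * c) *\<^sub>C snd d)"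
    using ds unfolding decomp_def
    by (simp add: sum_list_const_mult[symmetric] sum_list_mult_const[symmetric] tens_mult
        clinear_sum_list[OF lin] F(2))
  ultimately have "(\<Sum>d\<leftarrow>ds. h (star b * fst d * c) *\<^sub>C snd d) =
      (\<Sum>p\<leftarrow>ps. \<Sum>q\<leftarrow>qs. h (star (fst p) * a * fst q) *\<^sub>C (star (snd p) * snd q))" by simp
  \<comment> \<open>The coefficient 1 gives the outer sum the shape of a linear combination in
    \<open>A\<close>, the only kind of sum that \<open>phi_sum_list\<close> handles.\<close>
  then have eq: "\<phi> t (\<Sum>d\<leftarrow>ds. h (star b * fst d * c) *\<^sub>C snd d) =
      \<phi> t (\<Sum>p\<leftarrow>ps. 1 *\<^sub>C (\<Sum>q\<leftarrow>qs. h (star (fst p) * a * fst q) *\<^sub>C (star (snd p) * snd q)))" by simp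
  have "\<phi> t (\<Sum>d\<leftarrow>ds. h (star b * fst d * c) *\<^sub>C snd d) = (\<Sum>d\<leftarrow>ds. h (star b * fst d * c) * \<phi> t (snd d))"
    by (rule phi_sum_list[OF t]) (rule decomp_snd[OF ds])
  also have "\<dots> = h (star b * conv_op t a * c)"
    unfolding conv_op_decomp[OF t ds]
    by (simp add: sum_list_const_mult[symmetric] sum_list_mult_const[symmetric] haar_sum_list
        mult_scaleC_left mult_scaleC_right haar_scaleC mult.commute)
  finally have "h (star b * conv_op t a * c) = \<phi> t (\<Sum>d\<leftarrow>ds. h (star b * fst d * c) *\<^sub>C snd d)" ..
  also have "\<dots> = (\<Sum>p\<leftarrow>ps. 1 * \<phi> t (\<Sum>q\<leftarrow>qs. h (star (fst p) * a * fst q) *\<^sub>C (star (snd p) * snd q)))"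
    unfolding eq by (rule phi_sum_list[OF t]) (use ps_A qs_A in \<open>auto intro!: A_sum_list\<close>)
  also have "\<dots> = (\<Sum>p\<leftarrow>ps. \<Sum>q\<leftarrow>qs. h (star (fst p) * a * fst q) * \<phi> t (star (snd p) * snd q))"
    unfolding mult_1 by (intro arg_cong[of _ _ sum_list] map_cong refl phi_sum_list[OF t]) (use ps_A qs_A in auto)
  finally show ?thesis .
qed

end

subsection \<open>Positivity on the GNS space\<close>

text \<open>\<open>\<pi>\<close> and \<open>\<sigma>\<close> act on the same space: the GNS
  representation \<open>\<pi>\<close> supplies the vectors and the values of \<open>h\<close>, the
  isometric \<open>\<sigma>\<close> supplies the reduced norm.\<close>

locale levy_process_gns = levy_process_on_cqg tens tens3 \<Delta> A \<epsilon> h \<iota> \<Phi> j \<phi>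
  for tens :: "'a::cstar_algebra \<Rightarrow> 'a \<Rightarrow> 'c::cstar_algebra"
    and tens3 :: "'c \<Rightarrow> 'a \<Rightarrow> 'd::cstar_algebra"
    and \<Delta> A \<epsilon> h
    and \<iota> :: "'a \<Rightarrow> 'r::cstar_algebra"
    and \<Phi> :: "'b::complex_star_algebra \<Rightarrow> complex"
    and j \<phi> +
  fixes X :: "'i set" and \<pi> :: "'a \<Rightarrow> 'i operator" and \<xi> :: "'i \<Rightarrow> complex" and \<sigma> :: "'r \<Rightarrow> 'i operator"
  assumes gns: "gns_rep h X \<pi> \<xi>" and faithful: "faithful_rep X \<sigma>"
    and rep_embed: "a \<in> A \<Longrightarrow> f \<in> ell2 X \<Longrightarrow> \<sigma> (\<iota> a) f = \<pi> a f"
    and dense: "closure (\<iota> ` A) = UNIV"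

sublocale levy_process_gns \<subseteq> G: hilbert_rep X \<pi>
  by unfold_locales (use gns in \<open>simp add: gns_rep_def\<close>)

sublocale levy_process_gns \<subseteq> S: isometric_rep X \<sigma>
  by unfold_locales (rule faithful)

context levy_process_gns
begin

text \<open>On \<open>A\<close> the map \<open>\<iota>\<close> is given through the operators that
  \<open>\<sigma>\<close> assigns to its values; its algebraic laws are those of
  \<open>\<pi>\<close>, pulled back along the injective \<open>\<sigma>\<close>.\<close>

lemma embed_add: "x \<in> A \<Longrightarrow> y \<in> A \<Longrightarrow> \<iota> (x + y) = \<iota> x + \<iota> y"
  and embed_mult: "x \<in> A \<Longrightarrow> y \<in> A \<Longrightarrow> \<iota> (x * y) = \<iota> x * \<iota> y"
  and embed_scaleC: "x \<in> A \<Longrightarrow> \<iota> (c *\<^sub>C x) = c *\<^sub>C \<iota> x"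
  and embed_one: "\<iota> 1 = 1"
  by (rule S.rep_eqI, simp add: rep_embed S.rep_add S.rep_mult S.rep_scaleC S.rep_one
      G.rep_add G.rep_mult G.rep_scaleC G.rep_one)+

lemma embed_star:
  assumes "x \<in> A"
  shows "\<iota> (star x) = star (\<iota> x)"
proof (rule S.rep_eqI_delta)
  fix y assume y: "y \<in> X"
  show "\<sigma> (\<iota> (star x)) (ell2_delta y) = \<sigma> (star (\<iota> x)) (ell2_delta y)"
  proof (rule ell2_eqI[of _ X])
    fix z assume z: "z \<in> X"
    have "ell2_inner (ell2_delta z) (\<sigma> (\<iota> (star x)) (ell2_delta y)) =
        ell2_inner (ell2_delta z) (\<sigma> (star (\<iota> x)) (ell2_delta y))"
      using S.rep_adjoint'[of "ell2_delta z" "ell2_delta y" "\<iota> x"]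
        G.rep_adjoint'[of "ell2_delta z" "ell2_delta y" x] assms y z
      by (simp add: rep_embed ell2_delta)
    then show "\<sigma> (\<iota> (star x)) (ell2_delta y) z = \<sigma> (star (\<iota> x)) (ell2_delta y) z"
      by (simp add: ell2_inner_delta)
  qed (use y in \<open>simp_all add: ell2_delta\<close>)
qed

lemma cyclic_ell2: "\<xi> \<in> ell2 X"
  using gns by (simp add: gns_rep_def)

lemma inner_cyclic: "ell2_inner (\<pi> b \<xi>) (\<pi> a (\<pi> c \<xi>)) = h (star b * a * c)"
proof -
  have "ell2_inner (\<pi> b \<xi>) (\<pi> (a * c) \<xi>) = ell2_inner \<xi> (\<pi> (star b * (a * c)) \<xi>)"
    using G.rep_adjoint'[OF cyclic_ell2 G.rep_ell2[OF cyclic_ell2], of b "a * c"]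
    by (simp add: G.rep_mult cyclic_ell2)
  also have "\<dots> = h (star b * (a * c))" using gns unfolding gns_rep_def by blast
  finally show ?thesis by (simp add: G.rep_mult cyclic_ell2 mult.assoc)
qed

lemma norm_cyclic_le: "ell2_norm (\<pi> a \<xi>) \<le> norm a"
proof (rule power2_le_imp_le)
  have "complex_of_real ((ell2_norm (\<pi> a \<xi>))\<^sup>2) = h (star a * a)"
    using inner_cyclic[of a 1 a] by (simp add: ell2_inner_self G.rep_one cyclic_ell2)
  then have "(ell2_norm (\<pi> a \<xi>))\<^sup>2 = cmod (h (star a * a))"
    by (metis norm_of_real abs_power2)
  also have "\<dots> \<le> norm (star a * a)"
    using haar by (simp add: haar_state_def is_cstar_state_def)
  finally show "(ell2_norm (\<pi> a \<xi>))\<^sup>2 \<le> (norm a)\<^sup>2" by (simp add: norm_star_mult)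
qed simp

text \<open>Cyclicity provides vectors from the whole C*-algebra; \<open>norm_cyclic_le\<close>
  turns norm density of \<open>A\<close> into density of the vectors coming from \<open>A\<close>.
  Only for these can elements be untwisted.\<close>

lemma cyclic_dense:
  assumes f: "f \<in> ell2 X" and "e > 0"
  shows "\<exists>g\<in>(\<lambda>b. \<pi> b \<xi>) ` A. ell2_norm (\<lambda>i. g i - f i) < e"
proof -
  obtain a where a: "ell2_norm (\<lambda>i. f i - \<pi> a \<xi> i) < e / 2"
    using gns f \<open>e > 0\<close> unfolding gns_rep_def by (meson half_gt_zero)
  have "a \<in> closure A" using hopf by (simp add: dense_hopf_star_algebra_def)
  then obtain b where b: "b \<in> A" "dist b a < e / 2"
    using \<open>e > 0\<close> unfolding closure_approachable by (meson half_gt_zero)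
  have "(\<lambda>i. \<pi> b \<xi> i - f i) = (\<lambda>i. \<pi> (b - a) \<xi> i + (\<pi> a \<xi> i - f i))"
    by (simp add: G.rep_diff cyclic_ell2)
  then have "ell2_norm (\<lambda>i. \<pi> b \<xi> i - f i) \<le> ell2_norm (\<pi> (b - a) \<xi>) + ell2_norm (\<lambda>i. \<pi> a \<xi> i - f i)"
    using ell2_norm_add_le[OF G.rep_ell2[OF cyclic_ell2, of "b - a"] ell2_diff[OF G.rep_ell2[OF cyclic_ell2, of a] f]]
    by simp
  also have "\<dots> < e"
    using a b(2) norm_cyclic_le[of "b - a"] ell2_norm_uminus[of f "\<pi> a \<xi>"] by (simp add: dist_norm)
  finally show ?thesis using b(1) by blast
qed

lemma op_positive_conv_op:
  assumes t: "0 \<le> t" and m: "\<And>i k. i < n \<Longrightarrow> k < n \<Longrightarrow> m i k \<in> A"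
    and pos: "S.op_positive n (\<lambda>i k. \<iota> (m i k))"
  shows "S.op_positive n (\<lambda>i k. \<iota> (conv_op t (m i k)))"
proof (rule S.op_positive_dense[OF _ cyclic_dense])
  show "(\<lambda>b. \<pi> b \<xi>) ` A \<subseteq> ell2 X" using cyclic_ell2 by auto
  fix F assume "\<And>i. i < n \<Longrightarrow> F i \<in> (\<lambda>b. \<pi> b \<xi>) ` A"
  then have "\<forall>i. \<exists>b ps. i < n \<longrightarrow> b \<in> A \<and> F i = \<pi> b \<xi> \<and> untwist b ps"
    using ex_untwist by (metis imageE)
  then obtain b ps where b: "\<And>i. i < n \<Longrightarrow> b i \<in> A" "\<And>i. i < n \<Longrightarrow> F i = \<pi> (b i) \<xi>"
    and ps: "\<And>i. i < n \<Longrightarrow> untwist (b i) (ps i)" by metis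
  \<comment> \<open>An index is a matrix row \<open>i\<close> together with a term of the untwisting
    of \<open>b i\<close>. The Gram kernel \<open>G\<close> sees both components, the matrix only
    the first, hence \<open>\<nu> = fst\<close> below.\<close>
  define I where "I = (SIGMA i:{..<n}. {..<length (ps i)})"
  define x y where "x = (\<lambda>(i, r). fst (ps i ! r))" and "y = (\<lambda>(i, r). snd (ps i ! r))"
  have xy: "x \<alpha> \<in> A \<and> y \<alpha> \<in> A" if \<alpha>_in: "\<alpha> \<in> I" for \<alpha>
  proof -
    obtain i r where \<alpha>: "\<alpha> = (i, r)" "i < n" "r < length (ps i)" using \<alpha>_in by (auto simp: I_def)
    then have "ps i ! r \<in> A \<times> A" using ps[OF \<alpha>(2)] nth_mem unfolding untwist_def by blast
    then show ?thesis by (auto simp: x_def y_def \<alpha>(1))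
  qed
  define G where "G = (\<lambda>\<alpha> \<beta>. \<phi> t (star (y \<alpha>) * y \<beta>))"
  define H where "H = (\<lambda>\<alpha> \<beta>. h (star (x \<alpha>) * m (fst \<alpha>) (fst \<beta>) * x \<beta>))"
  have "(\<Sum>i<n. \<Sum>k<n. ell2_inner (F i) (\<sigma> (\<iota> (conv_op t (m i k))) (F k))) =
      (\<Sum>i<n. \<Sum>k<n. \<Sum>r<length (ps i). \<Sum>s<length (ps k). G (i, r) (k, s) * H (i, r) (k, s))"
  proof (intro sum.cong refl)
    fix i k assume "i \<in> {..<n}" "k \<in> {..<n}"
    then have ik: "i < n" "k < n" by auto
    have "ell2_inner (F i) (\<sigma> (\<iota> (conv_op t (m i k))) (F k)) = h (star (b i) * conv_op t (m i k) * b k)"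
      using b ik m t by (simp add: rep_embed conv_op_in_A cyclic_ell2 inner_cyclic)
    also have "\<dots> = (\<Sum>p\<leftarrow>ps i. \<Sum>q\<leftarrow>ps k. h (star (fst p) * m i k * fst q) * \<phi> t (star (snd p) * snd q))"
      by (rule conv_op_untwist[OF t m b(1) b(1) ps ps]) (use ik in auto)
    also have "\<dots> = (\<Sum>r<length (ps i). \<Sum>s<length (ps k). G (i, r) (k, s) * H (i, r) (k, s))"
      by (simp add: sum_list_nth G_def H_def x_def y_def mult.commute)
    finally show "ell2_inner (F i) (\<sigma> (\<iota> (conv_op t (m i k))) (F k)) =
        (\<Sum>r<length (ps i). \<Sum>s<length (ps k). G (i, r) (k, s) * H (i, r) (k, s))" .
  qed
  also have "\<dots> = (\<Sum>i<n. \<Sum>r<length (ps i). \<Sum>k<n. \<Sum>s<length (ps k). G (i, r) (k, s) * H (i, r) (k, s))"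
    by (intro sum.cong refl sum.swap)
  also have "\<dots> = (\<Sum>\<alpha>\<in>I. \<Sum>\<beta>\<in>I. G \<alpha> \<beta> * H \<alpha> \<beta>)"
  proof -
    have dbl: "(\<Sum>i<n. \<Sum>r<length (ps i). f (i, r)) = (\<Sum>\<alpha>\<in>I. f \<alpha>)" for f :: "nat \<times> nat \<Rightarrow> complex"
      unfolding I_def by (subst sum.Sigma) auto
    have "(\<Sum>i<n. \<Sum>r<length (ps i). \<Sum>k<n. \<Sum>s<length (ps k). G (i, r) (k, s) * H (i, r) (k, s)) =
        (\<Sum>i<n. \<Sum>r<length (ps i). \<Sum>\<beta>\<in>I. G (i, r) \<beta> * H (i, r) \<beta>)"
      by (intro sum.cong refl dbl)
    also have "\<dots> = (\<Sum>\<alpha>\<in>I. \<Sum>\<beta>\<in>I. G \<alpha> \<beta> * H \<alpha> \<beta>)" by (rule dbl)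
    finally show ?thesis .
  qed
  also have "\<dots> = (\<Sum>\<alpha>\<in>I. \<Sum>\<beta>\<in>I. G \<alpha> \<beta> * ell2_inner (\<pi> (x \<alpha>) \<xi>) (\<sigma> (\<iota> (m (fst \<alpha>) (fst \<beta>))) (\<pi> (x \<beta>) \<xi>)))"
    by (intro sum.cong refl) (auto simp: H_def I_def rep_embed m cyclic_ell2 inner_cyclic)
  also have "\<dots> \<in> \<real>\<^sub>\<ge>\<^sub>0"
  proof (rule S.op_positive_schur[OF pos, where \<nu> = fst])
    show "finite I" "fst ` I \<subseteq> {..<n}" by (auto simp: I_def)
    show "psd_on I G" unfolding G_def by (rule phi_psd[OF t]) (use xy in blast)
  qed (use cyclic_ell2 in auto)
  finally show "(\<Sum>i<n. \<Sum>k<n. ell2_inner (F i) (\<sigma> (\<iota> (conv_op t (m i k))) (F k))) \<in> \<real>\<^sub>\<ge>\<^sub>0" .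
qed

lemma norm_conv_op_le:
  assumes t: "0 \<le> t" and a: "a \<in> A"
  shows "norm (\<iota> (conv_op t a)) \<le> norm (\<iota> a)"
proof (rule S.op_positive_norm_matrixD)
  define m where "m i k = (if i = k then complex_of_real (norm (\<iota> a)) *\<^sub>C 1 else if i = 0 then a else star a)" for i k :: nat
  have "S.op_positive 2 (\<lambda>i k. \<iota> (m i k))"
    using S.op_positive_norm_matrix[of "\<iota> a"] a
    by (simp add: m_def if_distrib[of \<iota>] embed_scaleC embed_one embed_star cong: if_cong)
  then have "S.op_positive 2 (\<lambda>i k. \<iota> (conv_op t (m i k)))"
    by (rule op_positive_conv_op[OF t, rotated]) (use a in \<open>auto simp: m_def\<close>)
  \<comment> \<open>The convolution operator is unital, so the diagonal is unchanged and still
    carries the old norm.\<close>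
  then show "S.op_positive 2 (\<lambda>i k. if i = k then complex_of_real (norm (\<iota> a)) *\<^sub>C 1
      else if i = 0 then \<iota> (conv_op t a) else \<iota> (conv_op t (star a)))"
    using t by (simp add: m_def if_distrib[of "conv_op t"] if_distrib[of \<iota>] conv_op_scaleC conv_op_one
        embed_scaleC embed_one cong: if_cong)
qed simp

subsection \<open>Extension to the reduced C*-algebra\<close>

definition extends_conv_op :: "real \<Rightarrow> ('r \<Rightarrow> 'r) \<Rightarrow> bool"
  where "extends_conv_op t T \<longleftrightarrow> clinear T \<and> (\<forall>x. norm (T x) \<le> norm x) \<and> (\<forall>a\<in>A. T (\<iota> a) = \<iota> (conv_op t a))"

lemma ex_extends_conv_op:
  assumes t: "0 \<le> t"
  shows "\<exists>T. extends_conv_op t T"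
proof -
  define f where "f z = \<iota> (conv_op t (inv_into A \<iota> z))" for z
  \<comment> \<open>Contractivity for the reduced norm, applied to the difference of two preimages,
    makes the value depend on \<open>\<iota> a\<close> alone.\<close>
  have f: "f (\<iota> a) = \<iota> (conv_op t a)" if a: "a \<in> A" for a
  proof -
    define b where "b = inv_into A \<iota> (\<iota> a)"
    have b: "b \<in> A" "\<iota> b = \<iota> a" unfolding b_def using a by (auto intro: inv_into_into f_inv_into_f)
    have m: "(-1) *\<^sub>C a \<in> A" using a by (rule A_scaleC)
    have "norm (\<iota> (conv_op t (b + (-1) *\<^sub>C a))) \<le> norm (\<iota> (b + (-1) *\<^sub>C a))"
      by (rule norm_conv_op_le[OF t]) (use b(1) m in \<open>rule A_add\<close>)
    then have "norm (\<iota> (conv_op t b) - \<iota> (conv_op t a)) \<le> norm (\<iota> b - \<iota> a)"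
      using embed_add[OF b(1) m] embed_scaleC[OF a, of "-1"] conv_op_add[OF t b(1) m]
        conv_op_scaleC[OF t a, of "-1"] embed_scaleC[OF conv_op_in_A[OF t a], of "-1"]
        embed_add[OF conv_op_in_A[OF t b(1)] A_scaleC[OF conv_op_in_A[OF t a], of "-1"]]
      by simp
    then show ?thesis by (simp add: f_def b_def[symmetric] b(2))
  qed
  show ?thesis
  proof (rule clinear_extension[OF dense, of f 1])
    fix T assume T: "clinear T" "\<And>x. norm (T x) \<le> 1 * norm x" "\<And>x. x \<in> \<iota> ` A \<Longrightarrow> T x = f x"
    show ?thesis
      unfolding extends_conv_op_def using T f by (intro exI[of _ T]) auto
  next
    fix x y assume "x \<in> \<iota> ` A" "y \<in> \<iota> ` A"
    then obtain a b where ab: "a \<in> A" "b \<in> A" "x = \<iota> a" "y = \<iota> b" by auto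
    show "x + y \<in> \<iota> ` A" using ab embed_add[of a b] by (auto intro!: image_eqI[of _ _ "a + b"])
    show "f (x + y) = f x + f y"
      using ab f[of "a + b"] by (simp add: embed_add[symmetric] f conv_op_add t conv_op_in_A)
  next
    fix c x assume "x \<in> \<iota> ` A"
    then obtain a where a: "a \<in> A" "x = \<iota> a" by auto
    show "c *\<^sub>C x \<in> \<iota> ` A" using a by (auto intro!: image_eqI[of _ _ "c *\<^sub>C a"] simp: embed_scaleC)
    show "f (c *\<^sub>C x) = c *\<^sub>C f x"
      using a f[of "c *\<^sub>C a"] by (simp add: embed_scaleC[symmetric] f conv_op_scaleC t conv_op_in_A)
  next
    fix x assume "x \<in> \<iota> ` A"
    then show "norm (f x) \<le> 1 * norm x" using f norm_conv_op_le[OF t] by auto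
  qed
qed

definition semigroup_op :: "real \<Rightarrow> 'r \<Rightarrow> 'r"
  where "semigroup_op t = (SOME T. extends_conv_op t T)"

lemma
  assumes "0 \<le> t"
  shows clinear_semigroup_op: "clinear (semigroup_op t)"
    and norm_semigroup_op: "norm (semigroup_op t x) \<le> norm x"
    and semigroup_op_embed: "a \<in> A \<Longrightarrow> semigroup_op t (\<iota> a) = \<iota> (conv_op t a)"
  using someI_ex[OF ex_extends_conv_op[OF assms]] by (auto simp: semigroup_op_def extends_conv_op_def)

lemma bounded_linear_semigroup_op: "0 \<le> t \<Longrightarrow> bounded_linear (semigroup_op t)"
  using clinear_bounded_linear[OF clinear_semigroup_op, of t 1] norm_semigroup_op[of t] by simp

lemma semigroup_op_0: "semigroup_op 0 = id"
  by (rule clinear_eqI_dense[OF _ _ dense])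
    (auto simp: bounded_linear_semigroup_op semigroup_op_embed conv_op_0 id_def bounded_linear_ident)

lemma semigroup_op_add:
  assumes "0 \<le> s" "0 \<le> t"
  shows "semigroup_op (s + t) = semigroup_op s \<circ> semigroup_op t"
  unfolding o_def
  by (rule clinear_eqI_dense[OF _ _ dense])
    (use assms in \<open>auto simp: semigroup_op_embed conv_op_in_A conv_op_semigroup
      intro: bounded_linear_semigroup_op bounded_linear_compose\<close>)

text \<open>The factor \<open>Y\<close> is approximated and not \<open>M\<close>: approximants of
  the form \<open>star Y * Y\<close> with entries from \<open>A\<close> stay positive and are
  reached by \<open>op_positive_conv_op\<close>. Operator positivity survives the limit and is then
  factored again.\<close>

lemma semigroup_op_completely_positive:
  assumes t: "0 \<le> t"
  shows "completely_positive (semigroup_op t)"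
  unfolding completely_positive_def
proof (intro conjI allI impI)
  fix n and M :: "nat \<Rightarrow> nat \<Rightarrow> 'r"
  assume "matrix_positive n M"
  then obtain Y where Y: "\<And>i k. i < n \<Longrightarrow> k < n \<Longrightarrow> M i k = (\<Sum>l<n. star (Y l i) * Y l k)"
    unfolding matrix_positive_def by blast
  have "\<forall>i k. \<exists>z. (\<forall>r. z r \<in> A) \<and> (\<lambda>r. \<iota> (z r)) \<longlonglongrightarrow> Y i k"
  proof (intro allI)
    fix i k
    have "Y i k \<in> closure (\<iota> ` A)" by (simp add: dense)
    then obtain w where w: "\<forall>r::nat. w r \<in> \<iota> ` A" "w \<longlonglongrightarrow> Y i k" unfolding closure_sequential by blast
    then have "\<forall>r. \<exists>z\<in>A. w r = \<iota> z" by blast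
    then obtain z where "\<forall>r. z r \<in> A \<and> w r = \<iota> (z r)" by metis
    moreover from this have "w = (\<lambda>r. \<iota> (z r))" by auto
    ultimately show "\<exists>z. (\<forall>r. z r \<in> A) \<and> (\<lambda>r. \<iota> (z r)) \<longlonglongrightarrow> Y i k" using w(2) by blast
  qed
  then obtain z where z: "\<And>i k r. z i k r \<in> A" "\<And>i k. (\<lambda>r. \<iota> (z i k r)) \<longlonglongrightarrow> Y i k" by metis
  define m where "m r i k = (\<Sum>l<n. star (z l i r) * z l k r)" for r i k
  have m_A: "m r i k \<in> A" for r i k unfolding m_def by (intro A_sum) (simp add: z(1))
  have embed_sum: "\<iota> (\<Sum>l\<in>I. f l) = (\<Sum>l\<in>I. \<iota> (f l))" if "\<And>l. f l \<in> A" for I and f :: "nat \<Rightarrow> 'a"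
    by (induction I rule: infinite_finite_induct)
      (use embed_scaleC[of 0 0] in \<open>auto simp: embed_add A_sum that\<close>)
  have m_eq: "\<iota> (m r i k) = (\<Sum>l<n. star (\<iota> (z l i r)) * \<iota> (z l k r))" for r i k
    unfolding m_def using z(1) by (simp add: embed_sum embed_mult embed_star)
  have "S.op_positive n (\<lambda>i k. \<iota> (m r i k))" for r
    by (rule S.matrix_positive_imp_op_positive)
      (auto simp: matrix_positive_def m_eq intro!: exI[of _ "\<lambda>l i. \<iota> (z l i r)"])
  then have pos: "S.op_positive n (\<lambda>i k. \<iota> (conv_op t (m r i k)))" for r
    by (intro op_positive_conv_op[OF t] m_A)
  have "S.op_positive n (\<lambda>i k. semigroup_op t (M i k))"
  proof (rule S.op_positive_limit[OF pos])
    fix i k assume ik: "i < n" "k < n"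
    have "(\<lambda>r. \<Sum>l<n. star (\<iota> (z l i r)) * \<iota> (z l k r)) \<longlonglongrightarrow> (\<Sum>l<n. star (Y l i) * Y l k)"
      by (intro tendsto_sum tendsto_mult bounded_linear.tendsto[OF bounded_linear_star] z(2))
    then have "(\<lambda>r. \<iota> (m r i k)) \<longlonglongrightarrow> M i k" using Y[OF ik] by (simp add: m_eq)
    from bounded_linear.tendsto[OF bounded_linear_semigroup_op[OF t] this]
    show "(\<lambda>r. \<iota> (conv_op t (m r i k))) \<longlonglongrightarrow> semigroup_op t (M i k)"
      by (simp add: semigroup_op_embed[OF t] m_A)
  qed
  then show "matrix_positive n (\<lambda>i k. semigroup_op t (M i k))"
    by (rule S.op_positive_imp_matrix_positive)
qed (rule clinear_semigroup_op[OF t])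

section \<open>Strong continuity\<close>

lemma semigroup_op_tendsto_0: "((\<lambda>t. semigroup_op t x) \<longlongrightarrow> x) (at_right 0)"
proof (rule tendstoI)
  fix e :: real assume e: "e > 0"
  have "x \<in> closure (\<iota> ` A)" by (simp add: dense)
  \<comment> \<open>One third for replacing \<open>x\<close> by \<open>\<iota> a\<close>, one for
    the same replacement after the contractive operator, and one for the motion of
    \<open>\<iota> a\<close> itself.\<close>
  then obtain a where a: "a \<in> A" "dist (\<iota> a) x < e / 3"
    using e unfolding closure_approachable by (metis (no_types) imageE zero_less_divide_iff zero_less_numeral)
  obtain n c and f :: "nat \<Rightarrow> 'a" and d where f: "\<forall>l<n. f l \<in> A \<and> ((\<lambda>t. c t l) \<longlongrightarrow> d l) (at_right 0)"
    "\<forall>t\<ge>0. conv_op t a = (\<Sum>l<n. c t l *\<^sub>C f l)" "a = (\<Sum>l<n. d l *\<^sub>C f l)"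
    using conv_op_expansion[OF a(1)] by blast
  have embed_sum: "\<iota> (\<Sum>l\<in>I. b l *\<^sub>C f l) = (\<Sum>l\<in>I. b l *\<^sub>C \<iota> (f l))" if "I \<subseteq> {..<n}" for I b
    using that
  proof (induction I rule: infinite_finite_induct)
    case (insert l I)
    have "(\<Sum>l\<in>I. b l *\<^sub>C f l) \<in> A" by (rule A_sum) (use f(1) insert.prems in auto)
    with insert f(1) show ?case by (simp add: embed_add embed_scaleC)
  qed (use embed_scaleC[of 0 0] in auto)
  have "((\<lambda>t. norm (\<Sum>l<n. (c t l - d l) *\<^sub>C \<iota> (f l))) \<longlongrightarrow> 0) (at_right 0)"
  proof (rule Lim_null_comparison[OF always_eventually])
    show "\<forall>t. norm (norm (\<Sum>l<n. (c t l - d l) *\<^sub>C \<iota> (f l))) \<le> (\<Sum>l<n. cmod (c t l - d l) * norm (\<iota> (f l)))"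
      by (auto intro!: sum_norm_le simp: norm_scaleC)
    have "((\<lambda>t. \<Sum>l<n. cmod (c t l - d l) * norm (\<iota> (f l))) \<longlongrightarrow> (\<Sum>l<n. cmod (d l - d l) * norm (\<iota> (f l)))) (at_right 0)"
      by (intro tendsto_intros) (use f(1) in auto)
    then show "((\<lambda>t. \<Sum>l<n. cmod (c t l - d l) * norm (\<iota> (f l))) \<longlongrightarrow> 0) (at_right 0)" by simp
  qed
  then have "\<forall>\<^sub>F t in at_right 0. norm (\<Sum>l<n. (c t l - d l) *\<^sub>C \<iota> (f l)) < e / 3"
    using e by (intro order_tendstoD(2)) auto
  then show "\<forall>\<^sub>F t in at_right 0. dist (semigroup_op t x) x < e"
    using eventually_at_right_less[of "0::real"]
  proof eventually_elim
    fix t :: real assume t: "norm (\<Sum>l<n. (c t l - d l) *\<^sub>C \<iota> (f l)) < e / 3" "0 < t"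
    then have t0: "0 \<le> t" by simp
    have "(\<Sum>l<n. (c t l - d l) *\<^sub>C \<iota> (f l)) + \<iota> a = semigroup_op t (\<iota> a)"
    proof -
      have "(\<Sum>l<n. (c t l - d l) *\<^sub>C \<iota> (f l)) + \<iota> a = (\<Sum>l<n. (c t l - d l) *\<^sub>C \<iota> (f l) + d l *\<^sub>C \<iota> (f l))"
        using f(3) embed_sum[of "{..<n}" d] by (simp add: sum.distrib)
      also have "\<dots> = (\<Sum>l<n. c t l *\<^sub>C \<iota> (f l))" by (simp add: scaleC_add_left[symmetric])
      also have "\<dots> = semigroup_op t (\<iota> a)"
        using f(2) t0 a(1) embed_sum[of "{..<n}" "c t"] by (simp add: semigroup_op_embed)
      finally show ?thesis .
    qed
    then have mid: "dist (semigroup_op t (\<iota> a)) (\<iota> a) < e / 3" using t(1) by (simp add: dist_norm flip: eq_diff_eq)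
    have "dist (semigroup_op t x) (semigroup_op t (\<iota> a)) \<le> dist x (\<iota> a)"
      using norm_semigroup_op[OF t0, of "x - \<iota> a"] clinear_diff[OF clinear_semigroup_op[OF t0], of x "\<iota> a"]
      by (simp add: dist_norm)
    then show "dist (semigroup_op t x) x < e"
      using mid a(2) dist_triangle[of "semigroup_op t x" x "semigroup_op t (\<iota> a)"]
        dist_triangle[of "semigroup_op t (\<iota> a)" x "\<iota> a"] dist_commute[of x "\<iota> a"] by linarith
  qed
qed

text \<open>The semigroup law and contractivity bound the distance at times \<open>u \<le> v\<close>
  by the displacement over time \<open>v - u\<close>, so right continuity at 0 gives continuity from
  both sides everywhere.\<close>

lemma semigroup_op_continuous: "continuous_on {0..} (\<lambda>t. semigroup_op t x)"
  unfolding continuous_on_iff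
proof (intro ballI allI impI)
  fix s e :: real assume s: "s \<in> {0..}" and e: "e > 0"
  have diff: "dist (semigroup_op u x) (semigroup_op v x) \<le> dist (semigroup_op (v - u) x) x"
    if "0 \<le> u" "u \<le> v" for u v
  proof -
    have "semigroup_op v x = semigroup_op u (semigroup_op (v - u) x)"
      using semigroup_op_add[of u "v - u"] that by simp
    then have "semigroup_op v x - semigroup_op u x = semigroup_op u (semigroup_op (v - u) x - x)"
      using that by (simp add: clinear_diff[OF clinear_semigroup_op])
    then show ?thesis
      using norm_semigroup_op[OF that(1), of "semigroup_op (v - u) x - x"] by (metis dist_commute dist_norm)
  qed
  have "\<forall>\<^sub>F t in at_right 0. dist (semigroup_op t x) x < e" by (rule tendstoD[OF semigroup_op_tendsto_0 e])
  then obtain d where d: "d > 0" "\<And>t. 0 < t \<Longrightarrow> t < d \<Longrightarrow> dist (semigroup_op t x) x < e"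
    unfolding eventually_at_right_field by blast
  \<comment> \<open>The limit from the right says nothing at time 0, where the operator is the
    identity.\<close>
  have d0: "dist (semigroup_op t x) x < e" if "0 \<le> t" "t < d" for t
    using d(2)[of t] that e by (cases "t = 0") (auto simp: semigroup_op_0)
  show "\<exists>d>0. \<forall>t\<in>{0..}. dist t s < d \<longrightarrow> dist (semigroup_op t x) (semigroup_op s x) < e"
  proof (intro exI[of _ d] conjI ballI impI d(1))
    fix t assume t: "t \<in> {0..}" "dist t s < d"
    show "dist (semigroup_op t x) (semigroup_op s x) < e"
    proof (cases "t \<le> s")
      case True
      then show ?thesis using diff[of t s] d0[of "s - t"] s t by (auto simp: dist_real_def)
    next
      case False
      then show ?thesis using diff[of s t] d0[of "t - s"] s t by (auto simp: dist_real_def dist_commute)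
    qed
  qed
qed

section \<open>Existence and uniqueness of the semigroup\<close>

lemma quantum_markov_semigroup_op: "quantum_markov_semigroup semigroup_op"
  unfolding quantum_markov_semigroup_def
  using semigroup_op_0 semigroup_op_add semigroup_op_continuous clinear_semigroup_op
    semigroup_op_completely_positive norm_semigroup_op semigroup_op_embed[OF _ A_one]
  by (simp add: embed_one conv_op_one)

lemma semigroup_op_unique:
  assumes T: "quantum_markov_semigroup T" "\<And>a. a \<in> A \<Longrightarrow> T t (\<iota> a) = \<iota> (conv_op t a)" and t: "0 \<le> t"
  shows "T t = semigroup_op t"
proof (rule clinear_eqI_dense[OF _ bounded_linear_semigroup_op[OF t] dense])
  show "bounded_linear (T t)"
    using T(1) t clinear_bounded_linear[of "T t" 1] by (simp add: quantum_markov_semigroup_def)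
qed (use T(2) t in \<open>auto simp: semigroup_op_embed\<close>)

end

theorem theorem3p2:
  fixes tens :: "'a::cstar_algebra \<Rightarrow> 'a \<Rightarrow> 'c::cstar_algebra"
    and tens3 :: "'c \<Rightarrow> 'a \<Rightarrow> 'd::cstar_algebra"
    and \<Delta> :: "'a \<Rightarrow> 'c"
    and A :: "'a set"
    and \<epsilon> h :: "'a \<Rightarrow> complex"
    and \<iota> :: "'a \<Rightarrow> 'r::cstar_algebra"
    and \<Phi> :: "'b::complex_star_algebra \<Rightarrow> complex"
    and j :: "real \<Rightarrow> real \<Rightarrow> 'a \<Rightarrow> 'b"
    and \<phi> :: "real \<Rightarrow> 'a \<Rightarrow> complex"
  assumes "compact_quantum_group tens tens3 \<Delta>"
    and "A = coefficient_algebra tens \<Delta>"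
    and "dense_hopf_star_algebra tens \<Delta> A \<epsilon>"
    and "haar_state tens \<Delta> h"
    and "reduced_cstar_algebra A h \<iota>"
    and "levy_process tens \<Delta> A \<epsilon> \<Phi> j"
    and "\<And>t a. 0 \<le> t \<Longrightarrow> a \<in> A \<Longrightarrow> \<phi> t a = \<Phi> (j 0 t a)"
  shows "\<exists>T. (quantum_markov_semigroup T \<and>
              (\<forall>t\<ge>0. \<forall>a\<in>A. T t (\<iota> a) = \<iota> (tensor_map tens A (\<lambda>x y. \<phi> t y *\<^sub>C x) (\<Delta> a)))) \<and>
             (\<forall>T'. quantum_markov_semigroup T' \<and>
              (\<forall>t\<ge>0. \<forall>a\<in>A. T' t (\<iota> a) = \<iota> (tensor_map tens A (\<lambda>x y. \<phi> t y *\<^sub>C x) (\<Delta> a))) \<longrightarrow>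
              (\<forall>t\<ge>0. T' t = T t))"
proof -
  interpret levy_process_on_cqg tens tens3 \<Delta> A \<epsilon> h \<iota> \<Phi> j \<phi>
    by (rule levy_process_on_cqg.intro) (fact assms)+
  obtain X :: "'a set" and \<pi> \<xi> \<sigma> where rep: "gns_rep h X \<pi> \<xi>" "faithful_rep X \<sigma>"
    "\<forall>a\<in>A. \<forall>f\<in>ell2 X. \<sigma> (\<iota> a) f = \<pi> a f" "closure (\<iota> ` A) = UNIV"
    using assms(5) unfolding reduced_cstar_algebra_def by blast
  interpret levy_process_gns tens tens3 \<Delta> A \<epsilon> h \<iota> \<Phi> j \<phi> X \<pi> \<xi> \<sigma>
    by (intro levy_process_gns.intro levy_process_on_cqg_axioms levy_process_gns_axioms.intro) (use rep in auto)
  show ?thesis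
    unfolding conv_op_def[symmetric]
    using quantum_markov_semigroup_op semigroup_op_embed semigroup_op_unique
    by (intro exI[of _ semigroup_op]) blast
qed

end
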